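(* Suppose $\alpha$ is real and $-N<n+1+\alpha<-N+1$ for some positive integer $N$. Then for any polynomial $$Q(z,w)=\sum_{|m|\le N}\omega_mz^m\overline w^m$$ with (real) coefficients having the property that $$\omega_m>(-1)^{N+1}\frac{\Gamma(n+|m|+\alpha+1)}{m!\,\Gamma(n+\alpha+1)}\qquad\text{for all }|m|\le N,$$ we can equip $A^2_\alpha$ with an inner product such that the associated reproducing kernel is given by $$K_\alpha(z,w)=Q(z,w)+\frac{(-1)^N}{(1-\langle z,w\rangle)^{n+1+\alpha}}.$$
   Context: Fix a positive integer $n$. $\mathbb B_n$ is the open unit ball of $\mathbb C^n$, $\langle z,w\rangle=\sum_j z_j\overline{w_j}$, $dv$ is volume measure, and $dv_\alpha(z)=(1-|z|^2)^\alpha dv(z)$ for real $\alpha\le-1$. $m=(m_1,\dots,m_n)$ denotes a multi-index of nonnegative integers, $|m|=m_1+\cdots+m_n$, $m!=m_1!\cdots m_n!$, $z^m=z_1^{m_1}\cdots z_n^{m_n}$. The radial derivative is $Rf(z)=\sum_{k=1}^n z_k\frac{\partial f}{\partial z_k}(z)$ and $R^k$ is its $k$-fold iterate. $A^2_\alpha$ is the space of holomorphic $f$ in $\mathbb B_n$ such that, for a nonnegative integer $k$ with $2k+\alpha>-1$, $(1-|z|^2)^kR^kf(z)\in L^2(\mathbb B_n,dv_\alpha)$ (independent of the choice of such $k$). Saying an inner product has reproducing kernel $K_\alpha$ means that $A^2_\alpha$ is a Hilbert space under it and, for every $w\in\mathbb B_n$, $K_\alpha(\cdot,w)\in A^2_\alpha$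 and $f(w)=\langle f,K_\alpha(\cdot,w)\rangle$ for all $f\in A^2_\alpha$. Powers use the principal branch. *)

theory Defs
  imports "HOL-Analysis.Analysis"
begin

type_synonym 'n midx = "'n \<Rightarrow> nat"

definition mi_size :: "'n::finite midx \<Rightarrow> nat" where
  "mi_size m = (\<Sum>i\<in>UNIV. m i)"

definition mi_fact :: "'n::finite midx \<Rightarrow> nat" where
  "mi_fact m = (\<Prod>i\<in>UNIV. fact (m i))"

definition mi_monom :: "complex ^ 'n::finite \<Rightarrow> 'n midx \<Rightarrow> complex" where
  "mi_monom z m = (\<Prod>i\<in>UNIV. (z $ i) ^ m i)"

lemma finite_mi_size_le: "finite {m :: 'n::finite midx. mi_size m \<le> N}"
proof (rule finite_subset)
  show "{m :: 'n midx. mi_size m \<le> N} \<subseteq> PiE UNIV (\<lambda>_. {..N})"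
    unfolding mi_size_def
    by (auto simp: PiE_UNIV_domain) (metis UNIV_I finite le_trans member_le_sum zero_le)
  show "finite (PiE (UNIV :: 'n set) (\<lambda>_. {..N}))"
    by (intro finite_PiE) auto
qed

definition cdot :: "complex ^ 'n::finite \<Rightarrow> complex ^ 'n \<Rightarrow> complex" where
  "cdot z w = (\<Sum>j\<in>UNIV. z $ j * cnj (w $ j))"

text \<open>Holomorphy in several variables: Frechet differentiability with a complex-linear derivative.\<close>

definition holomorphic_vec_on :: "(complex ^ 'n::finite \<Rightarrow> complex) \<Rightarrow> (complex ^ 'n) set \<Rightarrow> bool" where
  "holomorphic_vec_on f S \<longleftrightarrow>
     (\<forall>z\<in>S. \<exists>D. (f has_derivative D) (at z within S) \<and> (\<forall>c v. D (c *s v) = c * D v))"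

definition partial_deriv :: "'n::finite \<Rightarrow> (complex ^ 'n \<Rightarrow> complex) \<Rightarrow> complex ^ 'n \<Rightarrow> complex" where
  "partial_deriv k f z = deriv (\<lambda>\<zeta>. f (\<chi> j. if j = k then \<zeta> else z $ j)) (z $ k)"

definition radial_deriv :: "(complex ^ 'n::finite \<Rightarrow> complex) \<Rightarrow> complex ^ 'n \<Rightarrow> complex" where
  "radial_deriv f z = (\<Sum>k\<in>UNIV. z $ k * partial_deriv k f z)"

definition weighted_volume :: "real \<Rightarrow> (complex ^ 'n::finite) measure" where
  "weighted_volume \<alpha> =
     density (restrict_space lborel (ball 0 1)) (\<lambda>z. ennreal ((1 - (norm z)\<^sup>2) powr \<alpha>))"

definition square_integrable :: "'a measure \<Rightarrow> ('a \<Rightarrow> complex) \<Rightarrow> bool" where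
  "square_integrable M g \<longleftrightarrow> g \<in> borel_measurable M \<and> integrable M (\<lambda>x. (norm (g x))\<^sup>2)"

text \<open>
  Functions on the open unit ball are represented by total functions that vanish off the ball,
  so that equality on the ball is equality of functions. The choice of k is immaterial among
  all k with 2 k + \<alpha> > -1.
\<close>

definition A2 :: "real \<Rightarrow> (complex ^ 'n::finite \<Rightarrow> complex) set" where
  "A2 \<alpha> = {f. holomorphic_vec_on f (ball 0 1) \<and> (\<forall>z. z \<notin> ball 0 1 \<longrightarrow> f z = 0) \<and>
     (\<exists>k::nat. 2 * real k + \<alpha> > -1 \<and>
        square_integrable (weighted_volume \<alpha>)
          (\<lambda>z. complex_of_real ((1 - (norm z)\<^sup>2) ^ k) * (radial_deriv ^^ k) f z))}"

definition function_space :: "('a \<Rightarrow> complex) set \<Rightarrow> bool" where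
  "function_space V \<longleftrightarrow> (\<lambda>_. 0) \<in> V \<and>
     (\<forall>f\<in>V. \<forall>g\<in>V. (\<lambda>x. f x + g x) \<in> V) \<and> (\<forall>c. \<forall>f\<in>V. (\<lambda>x. c * f x) \<in> V)"

definition inner_product_on ::
    "('a \<Rightarrow> complex) set \<Rightarrow> (('a \<Rightarrow> complex) \<Rightarrow> ('a \<Rightarrow> complex) \<Rightarrow> complex) \<Rightarrow> bool" where
  "inner_product_on V ip \<longleftrightarrow>
     (\<forall>f\<in>V. \<forall>g\<in>V. \<forall>h\<in>V. ip (\<lambda>x. f x + g x) h = ip f h + ip g h) \<and>
     (\<forall>c. \<forall>f\<in>V. \<forall>g\<in>V. ip (\<lambda>x. c * f x) g = c * ip f g) \<and>
     (\<forall>f\<in>V. \<forall>g\<in>V. ip g f = cnj (ip f g)) \<and>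
     (\<forall>f\<in>V. f \<noteq> (\<lambda>_. 0) \<longrightarrow> Re (ip f f) > 0)"

definition ip_norm ::
    "(('a \<Rightarrow> complex) \<Rightarrow> ('a \<Rightarrow> complex) \<Rightarrow> complex) \<Rightarrow> ('a \<Rightarrow> complex) \<Rightarrow> real" where
  "ip_norm ip f = sqrt (Re (ip f f))"

definition hilbert_space_on ::
    "('a \<Rightarrow> complex) set \<Rightarrow> (('a \<Rightarrow> complex) \<Rightarrow> ('a \<Rightarrow> complex) \<Rightarrow> complex) \<Rightarrow> bool" where
  "hilbert_space_on V ip \<longleftrightarrow> function_space V \<and> inner_product_on V ip \<and>
     (\<forall>F :: nat \<Rightarrow> 'a \<Rightarrow> complex.
        range F \<subseteq> V \<and>
        (\<forall>\<epsilon>>0. \<exists>M. \<forall>i\<ge>M. \<forall>j\<ge>M. ip_norm ip (\<lambda>x. F i x - F j x) < \<epsilon>) \<longrightarrow>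
        (\<exists>f\<in>V. (\<lambda>i. ip_norm ip (\<lambda>x. F i x - f x)) \<longlonglongrightarrow> 0))"

text \<open>The sections of the kernel are cut off outside S to match the representation above.\<close>

definition has_reproducing_kernel ::
    "'a set \<Rightarrow> ('a \<Rightarrow> complex) set \<Rightarrow> (('a \<Rightarrow> complex) \<Rightarrow> ('a \<Rightarrow> complex) \<Rightarrow> complex) \<Rightarrow>
     ('a \<Rightarrow> 'a \<Rightarrow> complex) \<Rightarrow> bool" where
  "has_reproducing_kernel S V ip K \<longleftrightarrow> hilbert_space_on V ip \<and>
     (\<forall>w\<in>S. (\<lambda>z. if z \<in> S then K z w else 0) \<in> V \<and>
        (\<forall>f\<in>V. f w = ip f (\<lambda>z. if z \<in> S then K z w else 0)))"

end

theory Submission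
  imports Defs "HOL-Complex_Analysis.Complex_Analysis"
begin

text \<open>Put \<open>s = n + 1 + \<alpha>\<close> and let \<open>(s)\<^sub>k\<close> denote the rising factorial. The binomial series and the multinomial
theorem give
\<open>(1 - \<langle>z, w\<rangle>) powr (-s) = \<Sum>m. (s)\<^sub>k / m! * z^m * cnj w^m\<close> with \<open>k = |m|\<close>.
Since \<open>-N < s < -N + 1\<close>, exactly the first \<open>N\<close> factors of \<open>(s)\<^sub>k\<close> are negative once \<open>k \<ge> N\<close>, so
\<open>(-1)^N * (s)\<^sub>k > 0\<close> for those \<open>k\<close>. Hence the kernel is \<open>\<Sum>m. \<kappa>\<^sub>m * z^m * cnj w^m\<close> with every
\<open>\<kappa>\<^sub>m\<close> positive: for \<open>|m| > N\<close> by this sign rule, and for \<open>|m| \<le> N\<close> because the hypothesis on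
\<open>\<omega>\<close> says precisely that the coefficient is positive.

Positive coefficients define a Hilbert space whenever the homogeneous parts of the diagonal \<open>\<Sum>m. \<kappa>\<^sub>m * |z^m|^2\<close>
are uniformly bounded on each smaller ball:
the functions \<open>\<Sum>m. a\<^sub>m * z^m\<close> with \<open>\<Sum>m. |a\<^sub>m|^2 / \<kappa>\<^sub>m < \<infinity>\<close>, under the inner product
\<open>\<Sum>m. a\<^sub>m * cnj b\<^sub>m / \<kappa>\<^sub>m\<close>, have \<open>\<Sum>m. \<kappa>\<^sub>m * z^m * cnj w^m\<close> as reproducing kernel
(lemma \<open>reproducing_kernel_function_space_of\<close>).

It remains to see that this space is \<open>A2 \<alpha>\<close> (lemma \<open>A2_eq_function_space_of\<close>). A holomorphic function on the
ball has an expansion \<open>\<Sum>m. a\<^sub>m * z^m\<close> (lemma \<open>holomorphic_expansion\<close>), and the radial derivative multiplies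
\<open>a\<^sub>m\<close> by \<open>|m|\<close> (lemma \<open>radial_deriv_funpow_hseries\<close>). Monomials are orthogonal for every
torus-invariant weight, so the square integral of \<open>(1 - |z|^2)^k * R^k f\<close> against \<open>(1 - |z|^2)^\<alpha>\<close>
is finite exactly when \<open>\<Sum>m. |m|^(2k) * |a\<^sub>m|^2 * I\<^sub>m\<close> is (lemma \<open>integrable_hseries_iff\<close>), where
\<open>I\<^sub>m = pi^n * m! * Gamma(2k + \<alpha> + 1) / Gamma(s + |m| + 2k)\<close> (lemma \<open>nn_integral_mi_monom_weighted\<close>).
For \<open>|m| > N\<close> the product \<open>\<kappa>\<^sub>m * |m|^(2k) * I\<^sub>m\<close> is a positive constant times
\<open>|m|^(2k) / (s + |m|)\<^sub>2\<^sub>k\<close>, which stays between two positive bounds (lemma \<open>\<kappa>_moment_bounds\<close>).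
So the integral is finite exactly when \<open>\<Sum>m. |a\<^sub>m|^2 / \<kappa>\<^sub>m\<close> is, for every admissible \<open>k\<close>.

Series over multi-indices are summed by degree: the inner sum over \<open>|m| = k\<close> is finite, and the outer one is
an ordinary series in \<open>k\<close>. This is also the order in which the one-variable Taylor series of
\<open>\<lambda>c. f (c *s z)\<close> produces them.\<close>

section \<open>Multi-indices and the multinomial theorem\<close>

lemma finite_mi_size_eq [simp]: "finite {m :: 'n::finite midx. mi_size m = k}"
  by (rule finite_subset[OF _ finite_mi_size_le[of k]]) auto

lemma mi_size_increment: "mi_size (m(i := Suc (m i))) = Suc (mi_size m)"
proof -
  have "(\<Sum>j\<in>UNIV. (m(i := Suc (m i))) j) = Suc (m i) + (\<Sum>j\<in>UNIV - {i}. m j)"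
    by (subst sum.remove[of _ i]) (auto intro!: sum.cong)
  also have "\<dots> = Suc (\<Sum>j\<in>UNIV. m j)"
    by (subst (2) sum.remove[of _ i]) auto
  finally show ?thesis by (simp add: mi_size_def)
qed

lemma mi_fact_increment: "mi_fact (m(i := Suc (m i))) = Suc (m i) * mi_fact m"
proof -
  have "mi_fact (m(i := Suc (m i))) = fact (Suc (m i)) * (\<Prod>j\<in>UNIV - {i}. fact (m j))"
    unfolding mi_fact_def by (subst prod.remove[of _ i]) (auto intro!: prod.cong)
  also have "\<dots> = Suc (m i) * mi_fact m"
    unfolding mi_fact_def by (subst (2) prod.remove[of _ i]) (auto simp: algebra_simps)
  finally show ?thesis .
qed

lemma prod_power_increment:
  fixes x :: "'n::finite \<Rightarrow> 'a::comm_monoid_mult"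
  shows "(\<Prod>j\<in>UNIV. x j ^ (m(i := Suc (m i))) j) = x i * (\<Prod>j\<in>UNIV. x j ^ m j)"
proof -
  have "(\<Prod>j\<in>UNIV. x j ^ (m(i := Suc (m i))) j) = x i ^ Suc (m i) * (\<Prod>j\<in>UNIV - {i}. x j ^ m j)"
    by (subst prod.remove[of _ i]) (auto intro!: prod.cong)
  also have "\<dots> = x i * (\<Prod>j\<in>UNIV. x j ^ m j)"
    by (subst (2) prod.remove[of _ i]) (auto simp: mult.assoc)
  finally show ?thesis .
qed

lemma mi_fact_pos [simp]: "mi_fact m > 0"
  by (simp add: mi_fact_def prod_pos)

lemma mi_fact_nonzero [simp]: "mi_fact m \<noteq> 0"
  using mi_fact_pos[of m] by linarith

text \<open>Induction on \<open>k\<close>: multiplying a term by \<open>x i\<close> raises the \<open>i\<close>-th exponent, and collecting what reaches a given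
multi-index \<open>m\<close> of size \<open>Suc k\<close> yields \<open>fact k * (\<Sum>i. m i) / m! = fact (Suc k) / m!\<close>.\<close>

lemma multinomial_theorem:
  fixes x :: "'n::finite \<Rightarrow> 'a::field_char_0"
  shows "(\<Sum>i\<in>UNIV. x i) ^ k
           = (\<Sum>m | mi_size m = k. fact k / of_nat (mi_fact m) * (\<Prod>i\<in>UNIV. x i ^ m i))"
proof (induction k)
  case 0
  have "{m :: 'n midx. mi_size m = 0} = {\<lambda>_. 0}"
    by (auto simp: mi_size_def)
  then show ?case by (simp add: mi_fact_def)
next
  case (Suc k)
  define t where "t m = (\<Prod>i\<in>UNIV. x i ^ m i)" for m
  have "(\<Sum>i\<in>UNIV. x i) ^ Suc k
      = (\<Sum>i\<in>UNIV. \<Sum>m | mi_size m = k. fact k / of_nat (mi_fact m) * (x i * t m))"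
    by (simp add: Suc t_def sum_product algebra_simps)
  also have "\<dots> = (\<Sum>i\<in>UNIV. \<Sum>m | mi_size m = Suc k. fact k * of_nat (m i) / of_nat (mi_fact m) * t m)"
  proof (rule sum.cong[OF refl])
    fix i :: 'n
    have inj: "inj_on (\<lambda>m :: 'n midx. m(i := Suc (m i))) {m. mi_size m = k}"
      by (intro inj_onI ext) (metis fun_upd_apply nat.inject)
    have img: "(\<lambda>m :: 'n midx. m(i := Suc (m i))) ` {m. mi_size m = k}
                 = {m. mi_size m = Suc k \<and> m i \<noteq> 0}" (is "?L = ?R")
    proof
      show "?L \<subseteq> ?R" by (auto simp: mi_size_increment)
      show "?R \<subseteq> ?L"
      proof
        fix m assume m: "m \<in> ?R"
        then have e: "(m(i := m i - 1))(i := Suc ((m(i := m i - 1)) i)) = m"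
          by auto
        then have "mi_size (m(i := m i - 1)) = k"
          using m mi_size_increment[of "m(i := m i - 1)" i] by simp
        with e show "m \<in> ?L" by (metis (mono_tags, lifting) image_eqI mem_Collect_eq)
      qed
    qed
    have "(\<Sum>m | mi_size m = Suc k. fact k * of_nat (m i) / of_nat (mi_fact m) * t m)
        = (\<Sum>m | mi_size m = Suc k \<and> m i \<noteq> 0. fact k * of_nat (m i) / of_nat (mi_fact m) * t m)"
      by (rule sum.mono_neutral_right) auto
    also have "\<dots> = (\<Sum>m | mi_size m = k. fact k * of_nat (Suc (m i))
        / of_nat (mi_fact (m(i := Suc (m i)))) * t (m(i := Suc (m i))))"
      unfolding img[symmetric] by (subst sum.reindex[OF inj]) (simp add: o_def)
    also have "\<dots> = (\<Sum>m | mi_size m = k. fact k / of_nat (mi_fact m) * (x i * t m))"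
    proof (rule sum.cong[OF refl])
      fix m :: "'n midx"
      have "of_nat (Suc (m i)) \<noteq> (0 :: 'a)" using of_nat_neq_0 by blast
      then show "fact k * of_nat (Suc (m i)) / of_nat (mi_fact (m(i := Suc (m i)))) * t (m(i := Suc (m i)))
          = fact k / of_nat (mi_fact m) * (x i * t m)"
        unfolding mi_fact_increment t_def prod_power_increment of_nat_mult by simp
    qed
    finally show "(\<Sum>m | mi_size m = k. fact k / of_nat (mi_fact m) * (x i * t m))
      = (\<Sum>m | mi_size m = Suc k. fact k * of_nat (m i) / of_nat (mi_fact m) * t m)" ..
  qed
  also have "\<dots> = (\<Sum>m | mi_size m = Suc k. \<Sum>i\<in>UNIV. fact k * of_nat (m i) / of_nat (mi_fact m) * t m)"
    by (rule sum.swap)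
  also have "\<dots> = (\<Sum>m | mi_size m = Suc k. fact (Suc k) / of_nat (mi_fact m) * t m)"
  proof (rule sum.cong[OF refl])
    fix m :: "'n midx" assume "m \<in> {m. mi_size m = Suc k}"
    then have s: "(\<Sum>i\<in>UNIV. of_nat (m i)) = (of_nat (Suc k) :: 'a)"
      by (simp add: mi_size_def flip: of_nat_sum)
    have "(\<Sum>i\<in>UNIV. fact k * of_nat (m i) / of_nat (mi_fact m) * t m)
       = fact k * (\<Sum>i\<in>UNIV. of_nat (m i)) / of_nat (mi_fact m) * t m"
      by (simp add: sum_distrib_left sum_distrib_right sum_divide_distrib)
    also have "\<dots> = fact (Suc k) / of_nat (mi_fact m) * t m"
      unfolding s by (simp add: algebra_simps)
    finally show "(\<Sum>i\<in>UNIV. fact k * of_nat (m i) / of_nat (mi_fact m) * t m)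
       = fact (Suc k) / of_nat (mi_fact m) * t m" .
  qed
  finally show ?case by (simp add: t_def)
qed

lemma mi_monom_scale: "mi_monom (c *s z) m = c ^ mi_size m * mi_monom z m"
  by (simp add: mi_monom_def mi_size_def power_mult_distrib prod.distrib power_sum)

lemma norm_mi_monom: "norm (mi_monom z m) = (\<Prod>i\<in>UNIV. norm (z $ i) ^ m i)"
  by (simp add: mi_monom_def prod_norm[symmetric] norm_power)

lemma norm_mi_monom_le: "norm (mi_monom z m) \<le> norm z ^ mi_size m"
proof -
  have "norm (mi_monom z m) \<le> (\<Prod>i\<in>UNIV. norm z ^ m i)"
    unfolding norm_mi_monom
    by (intro prod_mono) (auto intro!: power_mono simp: Finite_Cartesian_Product.norm_nth_le)
  then show ?thesis by (simp add: mi_size_def power_sum)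
qed

lemma norm_vec_square: "(norm z)\<^sup>2 = (\<Sum>i\<in>UNIV. (norm (z $ i))\<^sup>2)"
  by (simp add: norm_vec_def L2_set_def sum_nonneg)

lemma norm_vector_smult: "norm (c *s z) = norm c * norm (z :: complex ^ 'n::finite)"
proof -
  have "(norm (c *s z))\<^sup>2 = (norm c * norm z)\<^sup>2"
    by (simp add: norm_vec_square norm_mult power_mult_distrib sum_distrib_left)
  then show ?thesis by (simp add: power2_eq_iff_nonneg)
qed

text \<open>This identity and the next one turn sums over a fixed degree, weighted by \<open>1 / m!\<close>, into powers of the norm and
of the inner product. They are what makes the coefficients of the kernel computable.\<close>

lemma multinomial_norm:
  fixes z :: "complex ^ 'n::finite"
  shows "(\<Sum>m | mi_size m = k. fact k / real (mi_fact m) * (norm (mi_monom z m))\<^sup>2) = norm z ^ (2 * k)"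
proof -
  have "norm z ^ (2 * k) = (\<Sum>i\<in>UNIV. (norm (z $ i))\<^sup>2) ^ k"
    by (simp add: power_mult norm_vec_square)
  also have "\<dots> = (\<Sum>m | mi_size m = k. fact k / real (mi_fact m) * (\<Prod>i\<in>UNIV. ((norm (z $ i))\<^sup>2) ^ m i))"
    by (rule multinomial_theorem)
  also have "\<dots> = (\<Sum>m | mi_size m = k. fact k / real (mi_fact m) * (norm (mi_monom z m))\<^sup>2)"
    by (intro sum.cong refl) (simp add: norm_mi_monom prod_power_distrib power_mult[symmetric] mult.commute)
  finally show ?thesis ..
qed

lemma multinomial_cdot:
  fixes z w :: "complex ^ 'n::finite"
  shows "cdot z w ^ k
    = (\<Sum>m | mi_size m = k. fact k / of_nat (mi_fact m) * (mi_monom z m * cnj (mi_monom w m)))"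
  unfolding cdot_def multinomial_theorem
  by (intro sum.cong refl) (simp add: mi_monom_def power_mult_distrib prod.distrib)

section \<open>Holomorphic functions of several variables\<close>

lemma bounded_linear_smult_vector: "bounded_linear (\<lambda>c. c *s (v :: complex ^ 'n::finite))"
proof (rule bounded_linear_intro)
  show "(x + y) *s v = x *s v + y *s v" for x y
    by (rule vector_sadd_rdistrib)
  show "(r *\<^sub>R x) *s v = r *\<^sub>R (x *s v)" for r x
    by (simp add: vec_eq_iff)
  show "norm (x *s v) \<le> norm x * norm v" for x
    by (simp add: norm_vector_smult)
qed

lemma holomorphic_vec_onD:
  assumes "holomorphic_vec_on f S" "open S" "z \<in> S"
  obtains D where "(f has_derivative D) (at z)" "\<And>c v. D (c *s v) = c * D v"
  using assms by (metis holomorphic_vec_on_def at_within_open)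

lemma holomorphic_vec_onI:
  assumes "\<And>z. z \<in> S \<Longrightarrow> \<exists>D. (f has_derivative D) (at z) \<and> (\<forall>c v. D (c *s v) = c * D v)"
  shows "holomorphic_vec_on f S"
  using assms unfolding holomorphic_vec_on_def by (meson has_derivative_at_withinI)

lemma holomorphic_vec_on_cong:
  assumes "holomorphic_vec_on f S" "open S" "\<And>z. z \<in> S \<Longrightarrow> f z = g z"
  shows "holomorphic_vec_on g S"
proof (rule holomorphic_vec_onI)
  fix z assume z: "z \<in> S"
  then obtain D where "(f has_derivative D) (at z)" "\<And>c v. D (c *s v) = c * D v"
    using holomorphic_vec_onD assms by blast
  moreover from this have "(g has_derivative D) (at z)"
    using has_derivative_transform_within_open[OF _ assms(2) z, of f D UNIV g] assms(3) by blast
  ultimately show "\<exists>D. (g has_derivative D) (at z) \<and> (\<forall>c v. D (c *s v) = c * D v)"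
    by blast
qed

lemma holomorphic_vec_on_const: "holomorphic_vec_on (\<lambda>_. c) S"
  by (rule holomorphic_vec_onI) (auto intro!: exI[of _ "\<lambda>_. 0"])

lemma holomorphic_vec_on_nth: "holomorphic_vec_on (\<lambda>z. z $ i) S"
  by (rule holomorphic_vec_onI)
     (auto intro!: exI[of _ "\<lambda>z. z $ i"] bounded_linear_imp_has_derivative)

lemma holomorphic_vec_on_add:
  assumes "holomorphic_vec_on f S" "holomorphic_vec_on g S"
  shows "holomorphic_vec_on (\<lambda>z. f z + g z) S"
  unfolding holomorphic_vec_on_def
proof
  fix z assume "z \<in> S"
  then obtain D E where "(f has_derivative D) (at z within S)" "\<And>c v. D (c *s v) = c * D v"
    "(g has_derivative E) (at z within S)" "\<And>c v. E (c *s v) = c * E v"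
    using assms unfolding holomorphic_vec_on_def by metis
  then show "\<exists>D. ((\<lambda>z. f z + g z) has_derivative D) (at z within S) \<and> (\<forall>c v. D (c *s v) = c * D v)"
    by (intro exI[of _ "\<lambda>v. D v + E v"]) (auto intro!: derivative_eq_intros simp: algebra_simps)
qed

lemma holomorphic_vec_on_mult:
  assumes "holomorphic_vec_on f S" "holomorphic_vec_on g S"
  shows "holomorphic_vec_on (\<lambda>z. f z * g z) S"
  unfolding holomorphic_vec_on_def
proof
  fix z assume "z \<in> S"
  then obtain D E where "(f has_derivative D) (at z within S)" "\<And>c v. D (c *s v) = c * D v"
    "(g has_derivative E) (at z within S)" "\<And>c v. E (c *s v) = c * E v"
    using assms unfolding holomorphic_vec_on_def by metis
  then show "\<exists>D. ((\<lambda>z. f z * g z) has_derivative D) (at z within S) \<and> (\<forall>c v. D (c *s v) = c * D v)"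
    by (intro exI[of _ "\<lambda>v. f z * E v + D v * g z"])
       (auto intro!: derivative_eq_intros simp: algebra_simps)
qed

lemma holomorphic_vec_on_diff:
  assumes "holomorphic_vec_on f S" "holomorphic_vec_on g S"
  shows "holomorphic_vec_on (\<lambda>z. f z - g z) S"
  using holomorphic_vec_on_add[OF assms(1) holomorphic_vec_on_mult[OF holomorphic_vec_on_const[of "-1"] assms(2)]]
  by simp

lemma holomorphic_vec_on_sum:
  assumes "\<And>i. i \<in> I \<Longrightarrow> holomorphic_vec_on (f i) S"
  shows "holomorphic_vec_on (\<lambda>z. \<Sum>i\<in>I. f i z) S"
  using assms
  by (induction I rule: infinite_finite_induct)
     (auto intro: holomorphic_vec_on_const holomorphic_vec_on_add)

lemma holomorphic_vec_on_prod:
  assumes "\<And>i. i \<in> I \<Longrightarrow> holomorphic_vec_on (f i) S"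
  shows "holomorphic_vec_on (\<lambda>z. \<Prod>i\<in>I. f i z) S"
  using assms
  by (induction I rule: infinite_finite_induct)
     (auto intro: holomorphic_vec_on_const holomorphic_vec_on_mult)

lemma holomorphic_vec_on_power:
  "holomorphic_vec_on f S \<Longrightarrow> holomorphic_vec_on (\<lambda>z. f z ^ k) S"
  by (induction k) (auto intro: holomorphic_vec_on_const holomorphic_vec_on_mult)

lemma holomorphic_vec_on_continuous: "holomorphic_vec_on f S \<Longrightarrow> continuous_on S f"
  unfolding holomorphic_vec_on_def continuous_on_eq_continuous_within
  by (meson has_derivative_continuous)

text \<open>One-variable function theory enters through restrictions to complex lines.\<close>

lemma complex_line_derivative:
  fixes v :: "complex ^ 'n::finite"
  assumes "(f has_derivative D) (at (a + c *s v))" "\<And>c v. D (c *s v) = c * D v"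
  shows "((\<lambda>\<zeta>. f (a + \<zeta> *s v)) has_field_derivative D v) (at c)"
proof -
  have "((\<lambda>\<zeta>. a + \<zeta> *s v) has_derivative (\<lambda>h. h *s v)) (at c)"
    using has_derivative_add[OF has_derivative_const[of a]
        bounded_linear_imp_has_derivative[OF bounded_linear_smult_vector[of v]]] by simp
  from has_derivative_compose[OF this assms(1)]
  have "((\<lambda>\<zeta>. f (a + \<zeta> *s v)) has_derivative (\<lambda>h. h * D v)) (at c)"
    by (simp add: assms(2))
  then show ?thesis
    unfolding has_field_derivative_def by (subst mult.commute[abs_def])
qed

lemma holomorphic_on_complex_line:
  assumes "holomorphic_vec_on f S" "open S" "\<And>\<zeta>. \<zeta> \<in> T \<Longrightarrow> a + \<zeta> *s v \<in> S"
  shows "(\<lambda>\<zeta>. f (a + \<zeta> *s v)) holomorphic_on T"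
  unfolding holomorphic_on_def field_differentiable_def
proof
  fix \<zeta> assume "\<zeta> \<in> T"
  then obtain D where "(f has_derivative D) (at (a + \<zeta> *s v))" "\<And>c v. D (c *s v) = c * D v"
    using holomorphic_vec_onD[OF assms(1,2,3)] by blast
  then show "\<exists>f'. ((\<lambda>\<zeta>. f (a + \<zeta> *s v)) has_field_derivative f') (at \<zeta> within T)"
    using complex_line_derivative has_field_derivative_at_within by blast
qed

text \<open>Cauchy's estimate for a directional derivative, obtained on the disc of radius \<open>\<delta> / norm v\<close> in the line
through \<open>z\<close> with direction \<open>v\<close>.\<close>

lemma holomorphic_vec_derivative_bound:
  assumes f: "holomorphic_vec_on f S" "open S" and S: "cball z \<delta> \<subseteq> S" "\<delta> > 0"
    and D: "(f has_derivative D) (at z)" "\<And>c v. D (c *s v) = c * D v"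
    and B: "\<And>y. y \<in> cball z \<delta> \<Longrightarrow> norm (f y) \<le> B"
  shows "norm (D v) \<le> B / \<delta> * norm v"
proof (cases "v = 0")
  case True
  then show ?thesis using D(2)[of 0 v] by simp
next
  case False
  define \<phi> where "\<phi> \<zeta> = f (z + \<zeta> *s v)" for \<zeta>
  define r where "r = \<delta> / norm v"
  have r: "r > 0" using S False by (simp add: r_def)
  have in_ball: "z + \<zeta> *s v \<in> cball z \<delta>" if "norm \<zeta> \<le> r" for \<zeta>
    using that False by (simp add: dist_norm norm_vector_smult r_def field_simps)
  have hol: "\<phi> holomorphic_on cball 0 r"
    unfolding \<phi>_def using in_ball S by (intro holomorphic_on_complex_line[OF f]) auto
  have "norm ((deriv ^^ 1) \<phi> 0) \<le> fact 1 * B / r ^ 1"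
  proof (rule Cauchy_inequality)
    show "\<phi> holomorphic_on ball 0 r" by (rule holomorphic_on_subset[OF hol]) auto
    show "continuous_on (cball 0 r) \<phi>" by (rule holomorphic_on_imp_continuous_on[OF hol])
    show "norm (\<phi> x) \<le> B" if "norm (0 - x) = r" for x
      unfolding \<phi>_def using that by (intro B in_ball) auto
  qed fact
  moreover have "deriv \<phi> 0 = D v"
    unfolding \<phi>_def using D by (intro DERIV_imp_deriv complex_line_derivative) auto
  ultimately show ?thesis by (simp add: r_def)
qed

text \<open>Weierstrass' theorem. By the Cauchy estimate, uniform convergence of the functions on a ball forces uniform
convergence of their derivatives, as linear maps, on the ball of half the radius; a uniform limit of
derivatives is the derivative of the limit, and complex linearity survives.\<close>

lemma holomorphic_vec_on_uniform_limit:
  fixes f :: "nat \<Rightarrow> complex ^ 'n::finite \<Rightarrow> complex"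
  assumes S: "open S" and f: "\<And>n. holomorphic_vec_on (f n) S"
    and lim: "\<And>z. z \<in> S \<Longrightarrow> \<exists>d>0. cball z d \<subseteq> S \<and> uniform_limit (cball z d) f g sequentially"
  shows "holomorphic_vec_on g S"
proof (rule holomorphic_vec_onI)
  fix z0 assume "z0 \<in> S"
  then obtain d where d: "d > 0" "cball z0 d \<subseteq> S" and ul: "uniform_limit (cball z0 d) f g sequentially"
    using lim by blast
  define T where "T = ball z0 (d / 2)"
  have sub: "cball z (d / 2) \<subseteq> cball z0 d" if "z \<in> T" for z
  proof
    fix y assume "y \<in> cball z (d / 2)"
    then show "y \<in> cball z0 d"
      using that dist_triangle[of z0 y z] by (simp add: T_def)
  qed
  have TS: "z \<in> S" if "z \<in> T" for z
    using that d by (auto simp: T_def)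
  define D where "D n z = (SOME D. (f n has_derivative D) (at z) \<and> (\<forall>c v. D (c *s v) = c * D v))" for n z
  have "(f n has_derivative D n z) (at z) \<and> (\<forall>c v. D n z (c *s v) = c * D n z v)" if "z \<in> S" for n z
  proof -
    have "\<exists>D. (f n has_derivative D) (at z) \<and> (\<forall>c v. D (c *s v) = c * D v)"
      using holomorphic_vec_onD[OF f S that] by blast
    from someI_ex[OF this] show ?thesis unfolding D_def .
  qed
  then have D: "\<And>n z. z \<in> S \<Longrightarrow> (f n has_derivative D n z) (at z)"
    and Dlin: "\<And>n z c v. z \<in> S \<Longrightarrow> D n z (c *s v) = c * D n z v"
    by blast+
  have cauchy: "\<exists>M. \<forall>m\<ge>M. \<forall>n\<ge>M. \<forall>z\<in>T. \<forall>v. norm (D n z v - D m z v) \<le> e * norm v" if "e > 0" for e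
  proof -
    have "uniformly_Cauchy_on (cball z0 d) f"
      using ul uniformly_convergent_eq_Cauchy uniformly_convergentI by blast
    then obtain M where M: "\<And>m n z. m \<ge> M \<Longrightarrow> n \<ge> M \<Longrightarrow> z \<in> cball z0 d \<Longrightarrow> dist (f m z) (f n z) < e * (d / 2)"
      using \<open>e > 0\<close> \<open>d > 0\<close> unfolding uniformly_Cauchy_on_def
      by (meson half_gt_zero mult_pos_pos)
    have "norm (D n z v - D m z v) \<le> e * norm v" if mn: "m \<ge> M" "n \<ge> M" "z \<in> T" for m n z v
    proof -
      have "norm ((\<lambda>v. D n z v - D m z v) v) \<le> e * (d / 2) / (d / 2) * norm v"
      proof (rule holomorphic_vec_derivative_bound[OF holomorphic_vec_on_diff[OF f f] S])
        show "cball z (d / 2) \<subseteq> S" using sub that d by blast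
        show "((\<lambda>y. f n y - f m y) has_derivative (\<lambda>v. D n z v - D m z v)) (at z)"
          using D TS that by (intro has_derivative_diff) auto
        show "D n z (c *s v) - D m z (c *s v) = c * (D n z v - D m z v)" for c v
          using Dlin TS that by (simp add: algebra_simps)
        show "norm (f n y - f m y) \<le> e * (d / 2)" if "y \<in> cball z (d / 2)" for y
          using M[of n m y] mn sub that by (fastforce simp: dist_norm)
      qed (use d in auto)
      then show ?thesis using d by simp
    qed
    then show ?thesis by blast
  qed
  have "convergent (\<lambda>n. D n z v)" if "z \<in> T" for z v
  proof -
    have "Cauchy (\<lambda>n. D n z v)"
    proof (rule metric_CauchyI)
      fix e :: real assume "e > 0"
      then have "e / (norm v + 1) > 0" by (auto intro!: divide_pos_pos add_nonneg_pos)
      then obtain M where M: "\<And>m n. m \<ge> M \<Longrightarrow> n \<ge> M \<Longrightarrow> norm (D n z v - D m z v) \<le> e / (norm v + 1) * norm v"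
        using cauchy \<open>z \<in> T\<close> by meson
      have less: "e / (norm v + 1) * norm v < e" using \<open>e > 0\<close>
        by (simp add: divide_less_eq add_nonneg_pos) 
      then show "\<exists>M. \<forall>m\<ge>M. \<forall>n\<ge>M. dist (D m z v) (D n z v) < e"
      proof (intro exI allI impI)
        fix m n assume "m \<ge> M" "n \<ge> M"
        then have "norm (D m z v - D n z v) \<le> e / (norm v + 1) * norm v" by (intro M)
        with less show "dist (D m z v) (D n z v) < e" by (simp add: dist_norm)
      qed
    qed
    then show ?thesis by (simp add: Cauchy_convergent_iff)
  qed
  then obtain g' where g': "\<And>z v. z \<in> T \<Longrightarrow> (\<lambda>n. D n z v) \<longlonglongrightarrow> g' z v"
    unfolding convergent_def by metis
  have z0: "z0 \<in> T" using d by (simp add: T_def)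
  have ptw: "(\<lambda>n. f n z) \<longlonglongrightarrow> g z" if "z \<in> T" for z
    using tendsto_uniform_limitI[OF ul] that d by (simp add: T_def)
  have "\<exists>h. \<forall>x\<in>T. (\<lambda>n. f n x) \<longlonglongrightarrow> h x \<and> (h has_derivative g' x) (at x within T)"
  proof (rule has_derivative_sequence)
    show "convex T" by (simp add: T_def)
    show "(f n has_derivative D n x) (at x within T)" if "x \<in> T" for n x
      using D TS that has_derivative_at_withinI by blast
    show "\<forall>\<^sub>F n in sequentially. \<forall>x\<in>T. \<forall>h. norm (D n x h - g' x h) \<le> e * norm h" if "e > 0" for e
    proof -
      obtain M where M: "\<And>m n z v. m \<ge> M \<Longrightarrow> n \<ge> M \<Longrightarrow> z \<in> T \<Longrightarrow> norm (D n z v - D m z v) \<le> e * norm v"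
        using cauchy[OF \<open>e > 0\<close>] by meson
      have "norm (D n x h - g' x h) \<le> e * norm h" if "n \<ge> M" "x \<in> T" for n x h
      proof (rule tendsto_upperbound)
        show "(\<lambda>m. norm (D n x h - D m x h)) \<longlonglongrightarrow> norm (D n x h - g' x h)"
          by (intro tendsto_intros g' that)
        show "\<forall>\<^sub>F m in sequentially. norm (D n x h - D m x h) \<le> e * norm h"
          unfolding eventually_sequentially using M that by blast
      qed simp
      then show ?thesis by (auto simp: eventually_sequentially)
    qed
    show "z0 \<in> T" by fact
    show "(\<lambda>n. f n z0) \<longlonglongrightarrow> g z0" using ptw z0 by blast
  qed
  then obtain h where h: "\<And>x. x \<in> T \<Longrightarrow> (\<lambda>n. f n x) \<longlonglongrightarrow> h x"
    "\<And>x. x \<in> T \<Longrightarrow> (h has_derivative g' x) (at x within T)"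
    by auto
  have hg: "h x = g x" if "x \<in> T" for x
    by (rule LIMSEQ_unique[OF h(1)[OF that] ptw[OF that]])
  have "open T" by (simp add: T_def)
  then have "(h has_derivative g' z0) (at z0)" using h(2)[OF z0] at_within_open[OF z0] by metis
  then have 1: "(g has_derivative g' z0) (at z0)"
    by (rule has_derivative_transform_within_open[OF _ \<open>open T\<close> z0 hg])
  have "g' z0 (c *s v) = c * g' z0 v" for c v
  proof (rule LIMSEQ_unique)
    show "(\<lambda>n. D n z0 (c *s v)) \<longlonglongrightarrow> g' z0 (c *s v)" using g' z0 by blast
    show "(\<lambda>n. D n z0 (c *s v)) \<longlonglongrightarrow> c * g' z0 v"
      unfolding Dlin[OF TS[OF z0]] by (intro tendsto_intros g' z0)
  qed
  with 1 show "\<exists>D. (g has_derivative D) (at z0) \<and> (\<forall>c v. D (c *s v) = c * D v)" by blast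
qed

section \<open>Homogeneous expansions and the radial derivative\<close>

definition hpart :: "('n::finite midx \<Rightarrow> complex) \<Rightarrow> nat \<Rightarrow> complex ^ 'n \<Rightarrow> complex" where
  "hpart a k z = (\<Sum>m | mi_size m = k. a m * mi_monom z m)"

definition hseries :: "('n::finite midx \<Rightarrow> complex) \<Rightarrow> complex ^ 'n \<Rightarrow> complex" where
  "hseries a z = (\<Sum>k. hpart a k z)"

text \<open>Boundedness of all homogeneous parts on each smaller ball is the convergence condition for series of
homogeneous polynomials: applied on a slightly larger ball, homogeneity turns it into geometric decay. It
also passes to the coefficients of the radial derivative.\<close>

definition locally_bounded_parts :: "('n::finite midx \<Rightarrow> complex) \<Rightarrow> bool" where
  "locally_bounded_parts a \<longleftrightarrow>
     (\<forall>r. 0 < r \<and> r < 1 \<longrightarrow> (\<exists>C. \<forall>k z. norm z \<le> r \<longrightarrow> norm (hpart a k z) \<le> C))"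

lemma hpart_scale: "hpart a k (c *s z) = c ^ k * hpart a k z"
  unfolding hpart_def sum_distrib_left by (intro sum.cong refl) (auto simp: mi_monom_scale)

lemma holomorphic_hpart: "holomorphic_vec_on (hpart a k) S"
  unfolding hpart_def[abs_def] mi_monom_def
  by (intro holomorphic_vec_on_sum holomorphic_vec_on_mult holomorphic_vec_on_const
      holomorphic_vec_on_prod holomorphic_vec_on_power holomorphic_vec_on_nth)

lemma hpart_geometric_bound:
  assumes "locally_bounded_parts a" "0 < r" "r < 1"
  obtains C q where "C \<ge> 0" "0 < q" "q < 1" "\<And>k z. norm z \<le> r \<Longrightarrow> norm (hpart a k z) \<le> C * q ^ k"
proof -
  define r' where "r' = (1 + r) / 2"
  define q where "q = r / r'"
  have r': "0 < r'" "r' < 1" "r < r'" using assms by (auto simp: r'_def)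
  have q: "0 < q" "q < 1" using assms r' by (auto simp: q_def)
  obtain C where C: "\<And>k z. norm z \<le> r' \<Longrightarrow> norm (hpart a k z) \<le> C"
    using assms(1) r' unfolding locally_bounded_parts_def by blast
  have "norm (hpart a 0 0) \<le> C" using C[of 0 0] r' by simp
  then have "C \<ge> 0" using norm_ge_zero order_trans by blast
  moreover have "norm (hpart a k z) \<le> C * q ^ k" if "norm z \<le> r" for k z
  proof -
    define z' where "z' = complex_of_real (1 / q) *s z"
    have "z = complex_of_real q *s z'" using q by (simp add: z'_def vec_eq_iff)
    then have "hpart a k z = of_real q ^ k * hpart a k z'" by (simp add: hpart_scale)
    then have "norm (hpart a k z) = q ^ k * norm (hpart a k z')"
      using q by (simp add: norm_mult norm_power)
    moreover have "norm z' \<le> r'"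
      using that q r' assms by (simp add: z'_def norm_vector_smult norm_divide q_def field_simps)
    ultimately show ?thesis using C[of z' k] q by (simp add: mult.commute[of C])
  qed
  ultimately show ?thesis using q that by blast
qed

lemma hseries_uniform_limit:
  assumes "locally_bounded_parts a" "0 < r" "r < 1"
  shows "uniform_limit (cball 0 r) (\<lambda>n z. \<Sum>k<n. hpart a k z) (hseries a) sequentially"
proof -
  obtain C q where "C \<ge> 0" "0 < q" "q < 1" "\<And>k z. norm z \<le> r \<Longrightarrow> norm (hpart a k z) \<le> C * q ^ k"
    using hpart_geometric_bound[OF assms] by blast
  then show ?thesis
    unfolding hseries_def[abs_def]
    by (intro Weierstrass_m_test[where M = "\<lambda>k. C * q ^ k"]) (auto intro!: summable_mult summable_geometric)
qed

lemma hseries_sums: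
  assumes "locally_bounded_parts a" "z \<in> ball 0 1"
  shows "(\<lambda>k. hpart a k z) sums hseries a z"
proof -
  define r where "r = (1 + norm z) / 2"
  have "0 \<le> norm z" "norm z < 1" using assms by auto
  then have r: "0 < r \<and> r < 1 \<and> norm z \<le> r"
    unfolding r_def by argo
  have "(\<lambda>n. \<Sum>k<n. hpart a k z) \<longlonglongrightarrow> hseries a z"
    by (rule tendsto_uniform_limitI[OF hseries_uniform_limit[OF assms(1)]]) (use r in auto)
  then show ?thesis by (simp add: sums_def)
qed

lemma holomorphic_hseries:
  fixes a :: "'n::finite midx \<Rightarrow> complex"
  assumes "locally_bounded_parts a"
  shows "holomorphic_vec_on (hseries a) (ball 0 1)"
proof (rule holomorphic_vec_on_uniform_limit)
  fix z :: "complex ^ 'n" assume z: "z \<in> ball 0 1"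
  define d where "d = (1 - norm z) / 2"
  have "0 \<le> norm z" "norm z < 1" using z by auto
  then have "d > 0 \<and> norm z + d < 1 \<and> 0 < norm z + d"
    unfolding d_def by argo
  then have d: "d > 0" "norm z + d < 1" "0 < norm z + d" by auto
  have sub: "cball z d \<subseteq> cball 0 (norm z + d)"
  proof
    fix y assume "y \<in> cball z d"
    then show "y \<in> cball 0 (norm z + d)"
      using norm_triangle_ineq[of z "y - z"] by (simp add: dist_norm norm_minus_commute)
  qed
  moreover have "cball 0 (norm z + d) \<subseteq> (ball 0 1 :: (complex ^ 'n) set)" using d by auto
  ultimately show "\<exists>d>0. cball z d \<subseteq> ball 0 1 \<and>
        uniform_limit (cball z d) (\<lambda>n z. \<Sum>k<n. hpart a k z) (hseries a) sequentially"
    using d uniform_limit_on_subset[OF hseries_uniform_limit[OF assms d(3,2)] sub] by blast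
qed (auto intro!: holomorphic_vec_on_sum holomorphic_hpart)

text \<open>The radial derivative is the derivative in the direction \<open>z\<close>, that is, the derivative of \<open>\<lambda>c. f (c *s z)\<close> at
\<open>c = 1\<close>. On a homogeneous expansion this is the derivative of a power series in one variable.\<close>

lemma radial_deriv_eq_derivative:
  assumes D: "(f has_derivative D) (at z)" "\<And>c v. D (c *s v) = c * D v"
  shows "radial_deriv f z = D z"
proof -
  have "partial_deriv k f z = D (axis k 1)" for k
  proof -
    have eq: "(\<lambda>\<zeta>. f (\<chi> j. if j = k then \<zeta> else z $ j)) = (\<lambda>\<zeta>. f ((z - z $ k *s axis k 1) + \<zeta> *s axis k 1))"
      by (intro ext arg_cong[of _ _ f]) (auto simp: vec_eq_iff axis_def)
    have "(z - z $ k *s axis k 1) + z $ k *s axis k 1 = z" by simp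
    then show ?thesis
      unfolding partial_deriv_def eq using D
      by (intro DERIV_imp_deriv complex_line_derivative) auto
  qed
  then have "radial_deriv f z = (\<Sum>k\<in>UNIV. D (z $ k *s axis k 1))"
    by (simp add: radial_deriv_def D(2))
  also have "\<dots> = D (\<Sum>k\<in>UNIV. z $ k *s axis k 1)"
    by (rule linear_sum[OF bounded_linear.linear[OF has_derivative_bounded_linear[OF D(1)]], symmetric])
  also have "(\<Sum>k\<in>UNIV. z $ k *s axis k 1) = z"
    by (rule basis_expansion)
  finally show ?thesis .
qed

definition radial_coeff :: "('n::finite midx \<Rightarrow> complex) \<Rightarrow> 'n midx \<Rightarrow> complex" where
  "radial_coeff a m = of_nat (mi_size m) * a m"

lemma hpart_radial_coeff: "hpart (radial_coeff a) k z = of_nat k * hpart a k z"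
  unfolding hpart_def sum_distrib_left by (intro sum.cong refl) (auto simp: radial_coeff_def)

lemma locally_bounded_radial_coeff:
  assumes "locally_bounded_parts a"
  shows "locally_bounded_parts (radial_coeff a)"
  unfolding locally_bounded_parts_def
proof (intro allI impI)
  fix r :: real assume "0 < r \<and> r < 1"
  then obtain C q where C: "C \<ge> 0" "0 < q" "q < 1" "\<And>k z. norm z \<le> r \<Longrightarrow> norm (hpart a k z) \<le> C * q ^ k"
    using hpart_geometric_bound[OF assms, of r] by blast
  have "(\<lambda>k. of_nat k * q ^ k) \<longlonglongrightarrow> 0"
    using powser_times_n_limit_0[of q] C by simp
  then have "Bseq (\<lambda>k. of_nat k * q ^ k)"
    by (intro convergent_imp_Bseq convergentI)
  then obtain B where B: "\<And>k. norm (of_nat k * q ^ k) \<le> B"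
    by (auto simp: Bseq_def)
  have "norm (hpart (radial_coeff a) k z) \<le> C * B" if "norm z \<le> r" for k z
  proof -
    have "norm (hpart (radial_coeff a) k z) \<le> of_nat k * (C * q ^ k)"
      unfolding hpart_radial_coeff norm_mult using C(4)[OF that] by (simp add: mult_left_mono)
    also have "\<dots> = C * (of_nat k * q ^ k)" by simp
    also have "\<dots> \<le> C * B" using B[of k] C by (intro mult_left_mono) auto
    finally show ?thesis .
  qed
  then show "\<exists>C. \<forall>k z. norm z \<le> r \<longrightarrow> norm (hpart (radial_coeff a) k z) \<le> C" by blast
qed

lemma radial_deriv_hseries:
  assumes a: "locally_bounded_parts a" and f: "\<And>z. z \<in> ball 0 1 \<Longrightarrow> f z = hseries a z"
    and z: "z \<in> ball 0 1"
  shows "radial_deriv f z = hseries (radial_coeff a) z"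
proof -
  have "holomorphic_vec_on f (ball 0 1)"
    by (rule holomorphic_vec_on_cong[OF holomorphic_hseries[OF a]]) (use f in auto)
  then obtain D where D: "(f has_derivative D) (at z)" "\<And>c v. D (c *s v) = c * D v"
    using holomorphic_vec_onD[OF _ open_ball z] by blast
  have "((\<lambda>\<zeta>. f (0 + \<zeta> *s z)) has_field_derivative D z) (at 1)"
    by (rule complex_line_derivative) (use D in auto)
  then have d1: "((\<lambda>\<zeta>. f (\<zeta> *s z)) has_field_derivative D z) (at 1)" by simp
  define K where "K = (if z = 0 then 2 else 1 / norm z)"
  have K: "K > 1" using z by (simp add: K_def)
  have inK: "\<zeta> *s z \<in> ball 0 1" if "norm \<zeta> < K" for \<zeta>
    using that by (auto simp: K_def norm_vector_smult field_simps split: if_splits)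
  have sums: "(\<lambda>k. hpart a k z * \<zeta> ^ k) sums f (\<zeta> *s z)" if "norm \<zeta> < K" for \<zeta>
    using hseries_sums[OF a inK[OF that]] f[OF inK[OF that]] by (simp add: hpart_scale mult.commute)
  have d2: "((\<lambda>\<zeta>. \<Sum>k. hpart a k z * \<zeta> ^ k) has_field_derivative (\<Sum>k. diffs (\<lambda>k. hpart a k z) k * 1 ^ k)) (at 1)"
    by (rule termdiffs_strong'[where K = K]) (use sums K sums_summable in auto)
  have "((\<lambda>\<zeta>. f (\<zeta> *s z)) has_field_derivative (\<Sum>k. diffs (\<lambda>k. hpart a k z) k * 1 ^ k)) (at 1)"
  proof (rule has_field_derivative_transform_within_open[OF d2])
    show "open (ball 0 K :: complex set)" by simp
    show "(1 :: complex) \<in> ball 0 K" using K by simp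
    show "(\<Sum>k. hpart a k z * \<zeta> ^ k) = f (\<zeta> *s z)" if "\<zeta> \<in> ball 0 K" for \<zeta>
      using sums that by (simp add: sums_iff)
  qed
  then have "D z = (\<Sum>k. diffs (\<lambda>k. hpart a k z) k)"
    using DERIV_unique[OF d1] by simp
  also have "\<dots> = (\<Sum>k. hpart (radial_coeff a) (Suc k) z)"
    by (simp add: diffs_def hpart_radial_coeff)
  also have "\<dots> = hseries (radial_coeff a) z"
    using suminf_split_head[OF sums_summable[OF hseries_sums[OF locally_bounded_radial_coeff[OF a] z]]]
    by (simp add: hseries_def hpart_radial_coeff)
  finally show ?thesis using radial_deriv_eq_derivative[OF D] by simp
qed

lemma radial_coeff_funpow: "(radial_coeff ^^ j) a m = of_nat (mi_size m) ^ j * a m"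
  by (induction j) (auto simp: radial_coeff_def)

lemma locally_bounded_radial_funpow:
  "locally_bounded_parts a \<Longrightarrow> locally_bounded_parts ((radial_coeff ^^ j) a)"
  by (induction j) (auto intro: locally_bounded_radial_coeff)

lemma radial_deriv_funpow_hseries:
  assumes a: "locally_bounded_parts a" and f: "\<And>z. z \<in> ball 0 1 \<Longrightarrow> f z = hseries a z"
  shows "z \<in> ball 0 1 \<Longrightarrow> (radial_deriv ^^ j) f z = hseries ((radial_coeff ^^ j) a) z"
proof (induction j arbitrary: z)
  case 0
  then show ?case using f by simp
next
  case (Suc j)
  show ?case
    using radial_deriv_hseries[OF locally_bounded_radial_funpow[OF a] Suc.IH Suc.prems] by simp
qed

section \<open>Power series expansion of holomorphic functions on the ball\<close>

definition polynomial_vec :: "(complex ^ 'n::finite \<Rightarrow> complex) \<Rightarrow> bool" where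
  "polynomial_vec f \<longleftrightarrow> (\<exists>M b. finite M \<and> (\<forall>z. f z = (\<Sum>m\<in>M. b m * mi_monom z m)))"

text \<open>Several indices may be mapped to the same monomial here, which saves collecting terms when sums and products
are formed.\<close>

lemma polynomial_vec_indexed:
  fixes \<phi> :: "'i \<Rightarrow> 'n::finite midx"
  assumes "finite I" "\<And>z. f z = (\<Sum>i\<in>I. c i * mi_monom z (\<phi> i))"
  shows "polynomial_vec f"
  unfolding polynomial_vec_def
proof (intro exI[of _ "\<phi> ` I"] exI[of _ "\<lambda>m. \<Sum>i | i \<in> I \<and> \<phi> i = m. c i"] conjI allI)
  fix z
  have "f z = (\<Sum>m\<in>\<phi> ` I. \<Sum>i | i \<in> I \<and> \<phi> i = m. c i * mi_monom z (\<phi> i))"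
    unfolding assms(2) by (rule sum.image_gen[OF assms(1)])
  also have "\<dots> = (\<Sum>m\<in>\<phi> ` I. (\<Sum>i | i \<in> I \<and> \<phi> i = m. c i) * mi_monom z m)"
    by (intro sum.cong refl) (auto simp: sum_distrib_right)
  finally show "f z = (\<Sum>m\<in>\<phi> ` I. (\<Sum>i | i \<in> I \<and> \<phi> i = m. c i) * mi_monom z m)" .
qed (use assms in auto)

lemma polynomial_vec_const: "polynomial_vec (\<lambda>_. c)"
  by (rule polynomial_vec_indexed[of "{()}" _ "\<lambda>_. c" "\<lambda>_ _. 0"]) (auto simp: mi_monom_def)

lemma polynomial_vec_add:
  assumes "polynomial_vec f" "polynomial_vec g"
  shows "polynomial_vec (\<lambda>z. f z + g z)"
proof -
  obtain M b where M: "finite M" "\<And>z. f z = (\<Sum>m\<in>M. b m * mi_monom z m)"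
    using assms(1) unfolding polynomial_vec_def by blast
  obtain M' b' where M': "finite M'" "\<And>z. g z = (\<Sum>m\<in>M'. b' m * mi_monom z m)"
    using assms(2) unfolding polynomial_vec_def by blast
  show ?thesis
    by (rule polynomial_vec_indexed[of "M <+> M'" _ "case_sum b b'" "case_sum id id"])
       (use M M' in \<open>auto simp: sum.Plus\<close>)
qed

lemma mi_monom_add: "mi_monom z (\<lambda>i. m i + m' i) = mi_monom z m * mi_monom z m'"
  by (simp add: mi_monom_def power_add prod.distrib)

lemma polynomial_vec_mult:
  assumes "polynomial_vec f" "polynomial_vec g"
  shows "polynomial_vec (\<lambda>z. f z * g z)"
proof -
  obtain M b where M: "finite M" "\<And>z. f z = (\<Sum>m\<in>M. b m * mi_monom z m)"
    using assms(1) unfolding polynomial_vec_def by blast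
  obtain M' b' where M': "finite M'" "\<And>z. g z = (\<Sum>m\<in>M'. b' m * mi_monom z m)"
    using assms(2) unfolding polynomial_vec_def by blast
  show ?thesis
  proof (rule polynomial_vec_indexed[of "M \<times> M'" _ "\<lambda>(m, m'). b m * b' m'" "\<lambda>(m, m') i. m i + m' i"])
    fix z
    have "f z * g z = (\<Sum>m\<in>M. \<Sum>m'\<in>M'. b m * mi_monom z m * (b' m' * mi_monom z m'))"
      by (simp add: M M' sum_product)
    also have "\<dots> = (\<Sum>x\<in>M \<times> M'. (case x of (m, m') \<Rightarrow> b m * b' m') *
        mi_monom z (case x of (m, m') \<Rightarrow> \<lambda>i. m i + m' i))"
      unfolding sum.cartesian_product by (intro sum.cong refl) (auto simp: mi_monom_add mult_ac)
    finally show "f z * g z = (\<Sum>x\<in>M \<times> M'. (case x of (m, m') \<Rightarrow> b m * b' m') *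
        mi_monom z (case x of (m, m') \<Rightarrow> \<lambda>i. m i + m' i))" .
  qed (use M M' in auto)
qed

lemma polynomial_vec_sum:
  assumes "\<And>i. i \<in> I \<Longrightarrow> polynomial_vec (f i)"
  shows "polynomial_vec (\<lambda>z. \<Sum>i\<in>I. f i z)"
  using assms
  by (induction I rule: infinite_finite_induct)
     (auto intro: polynomial_vec_const polynomial_vec_add)

lemma polynomial_vec_poly_nth: "polynomial_vec (\<lambda>z. poly p (z $ i))"
proof (rule polynomial_vec_indexed[of "{..degree p}" _ "coeff p" "\<lambda>j l. if l = i then j else 0"])
  have "mi_monom z (\<lambda>l. if l = i then j else 0) = (z $ i) ^ j" for z :: "complex ^ 'a" and j
    unfolding mi_monom_def by (subst prod.remove[of _ i]) auto
  then show "poly p (z $ i) = (\<Sum>j\<le>degree p. coeff p j * mi_monom z (\<lambda>l. if l = i then j else 0))" for z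
    by (simp add: poly_altdef)
qed auto

text \<open>Interpolation at \<open>0, ..., k\<close> expresses a polynomial of degree at most \<open>k\<close> by its values at these points, with
multipliers that do not depend on the polynomial, so the polynomial may vary with further variables.\<close>

lemma lagrange_basis_exists:
  fixes k :: nat
  obtains L :: "nat \<Rightarrow> complex poly" where
    "\<And>p \<zeta>. degree p \<le> k \<Longrightarrow> poly p \<zeta> = (\<Sum>j\<le>k. poly p (of_nat j) * poly (L j) \<zeta>)"
proof
  define L :: "nat \<Rightarrow> complex poly" where
    "L j = (\<Prod>l\<in>{..k} - {j}. smult (1 / (of_nat j - of_nat l)) [:- of_nat l, 1:])" for j
  have Lval: "poly (L j) (of_nat i) = (if i = j then 1 else 0)" if "i \<le> k" for i j
  proof (cases "i = j")
    case True
    then show ?thesis 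
      by (auto simp: L_def poly_prod diff_divide_distrib[symmetric] intro!: prod.neutral)
  next
    case False
    then have "\<exists>l\<in>{..k} - {j}. poly (smult (1 / (of_nat j - of_nat l)) [:- of_nat l, 1:]) (of_nat i :: complex) = 0"
      using that by (intro bexI[of _ i]) auto
    then show ?thesis using False unfolding L_def poly_prod
      by (simp add: prod_zero_iff del: poly_smult)
  qed
  have Ldeg: "degree (L j) \<le> k" if "j \<le> k" for j
  proof -
    have "degree (L j) \<le> (\<Sum>l\<in>{..k} - {j}. degree (smult (1 / (of_nat j - of_nat l)) [:- of_nat l, 1::complex:]))"
      
      unfolding L_def by (rule degree_prod_sum_le[unfolded o_def]) simp
    also have "\<dots> \<le> (\<Sum>l\<in>{..k} - {j}. 1)"
      by (intro sum_mono) (auto intro: order_trans[OF degree_smult_le])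
    also have "\<dots> = k" using that by simp
    finally show ?thesis .
  qed
  fix p :: "complex poly" and \<zeta> assume p: "degree p \<le> k"
  define q where "q = (\<Sum>j\<le>k. smult (poly p (of_nat j)) (L j))"
  have "p = q"
  proof (rule poly_eqI_degree)
    show "poly p x = poly q x" if "x \<in> of_nat ` {..k}" for x
      using that by (auto simp: q_def poly_sum Lval if_distrib[of "(*) _"] cong: if_cong)
    have "card (of_nat ` {..k} :: complex set) = Suc k"
      by (subst card_image) (auto intro: inj_onI)
    moreover have "degree q \<le> k"
      unfolding q_def by (intro degree_sum_le) (auto intro: order_trans[OF degree_smult_le] Ldeg)
    ultimately show "card (of_nat ` {..k} :: complex set) > degree p" "card (of_nat ` {..k} :: complex set) > degree q"
      using p by auto
  qed
  then have "poly p \<zeta> = poly q \<zeta>" by simp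
  then show "poly p \<zeta> = (\<Sum>j\<le>k. poly p (of_nat j) * poly (L j) \<zeta>)"
    by (simp add: q_def poly_sum)
qed

text \<open>Interpolation in one variable after the other: the claim for a set \<open>S\<close> of active variables, the others being
frozen at \<open>w\<close>, passes to \<open>insert i S\<close> since \<open>f\<close> is a combination of its restrictions to \<open>z $ i = 0, ..., k\<close>
with polynomial coefficients in \<open>z $ i\<close>.\<close>

lemma polynomial_vec_of_separately_polynomial:
  fixes f :: "complex ^ 'n::finite \<Rightarrow> complex"
  assumes "\<And>i z. \<exists>p. degree p \<le> k \<and> (\<forall>\<zeta>. f (\<chi> j. if j = i then \<zeta> else z $ j) = poly p \<zeta>)"
  shows "polynomial_vec f"
proof -
  obtain L :: "nat \<Rightarrow> complex poly" where
    L: "\<And>p \<zeta>. degree p \<le> k \<Longrightarrow> poly p \<zeta> = (\<Sum>j\<le>k. poly p (of_nat j) * poly (L j) \<zeta>)"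
    using lagrange_basis_exists by blast
  have interp: "f (\<chi> j. if j = i then \<zeta> else z $ j)
      = (\<Sum>l\<le>k. f (\<chi> j. if j = i then of_nat l else z $ j) * poly (L l) \<zeta>)" for i z \<zeta>
  proof -
    obtain p where p: "degree p \<le> k" "\<And>\<zeta>. f (\<chi> j. if j = i then \<zeta> else z $ j) = poly p \<zeta>"
      using assms by blast
    show ?thesis unfolding p(2) by (rule L[OF p(1)])
  qed
  have "polynomial_vec (\<lambda>z. f (\<chi> j. if j \<in> S then z $ j else w $ j))" if "finite S" for S w
    using that
  proof (induction S arbitrary: w)
    case empty
    then show ?case by (simp add: polynomial_vec_const)
  next
    case (insert i S)
    have "f (\<chi> j. if j \<in> insert i S then z $ j else w $ j)
       = (\<Sum>l\<le>k. f (\<chi> j. if j \<in> S then z $ j else (\<chi> j. if j = i then of_nat l else w $ j) $ j) * poly (L l) (z $ i))" for z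
    proof -
      define y where "y = (\<chi> j. if j \<in> S then z $ j else w $ j)"
      have 1: "(\<chi> j. if j \<in> insert i S then z $ j else w $ j) = (\<chi> j. if j = i then z $ i else y $ j)"
        by (auto simp: y_def vec_eq_iff)
      have 2: "(\<chi> j. if j \<in> S then z $ j else (\<chi> j. if j = i then of_nat l else w $ j) $ j)
          = (\<chi> j. if j = i then of_nat l else y $ j)" for l
        using insert.hyps by (auto simp: y_def vec_eq_iff)
      show ?thesis unfolding 1 2 by (rule interp)
    qed
    then show ?case
      using insert.IH by (auto intro!: polynomial_vec_sum polynomial_vec_mult polynomial_vec_poly_nth)
  qed
  from this[of UNIV 0] show ?thesis by simp
qed

lemma homogeneous_polynomial_eq_hpart:
  fixes g :: "complex ^ 'n::finite \<Rightarrow> complex"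
  assumes "polynomial_vec g" and hom: "\<And>c z. g (c *s z) = c ^ k * g z"
  shows "\<exists>b. \<forall>z. g z = hpart b k z"
proof -
  obtain M b where M: "finite M" "\<And>z. g z = (\<Sum>m\<in>M. b m * mi_monom z m)"
    using assms(1) unfolding polynomial_vec_def by blast
  have "g z = hpart (\<lambda>m. if m \<in> M then b m else 0) k z" for z
  proof -
    define p where "p = (\<Sum>m\<in>M. monom (b m * mi_monom z m) (mi_size m))"
    have "poly p c = poly (monom (g z) k) c" for c
    proof -
      have "poly p c = g (c *s z)"
        by (simp add: p_def poly_sum poly_monom M mi_monom_scale mult_ac)
      then show ?thesis by (simp add: hom poly_monom mult.commute)
    qed
    then have "p = monom (g z) k" by (simp add: poly_eq_poly_eq_iff[symmetric] fun_eq_iff)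
    then have "g z = coeff p k" by simp
    also have "\<dots> = (\<Sum>m\<in>M. if mi_size m = k then b m * mi_monom z m else 0)"
      by (simp add: p_def coeff_sum)
    also have "\<dots> = (\<Sum>m\<in>{m \<in> M. mi_size m = k}. b m * mi_monom z m)"
      using M by (simp add: sum.inter_filter)
    also have "\<dots> = hpart (\<lambda>m. if m \<in> M then b m else 0) k z"
      unfolding hpart_def by (rule sum.mono_neutral_cong_left) auto
    finally show ?thesis .
  qed
  then show ?thesis by blast
qed

lemma holomorphic_vec_on_scale:
  fixes f :: "complex ^ 'n::finite \<Rightarrow> complex"
  assumes "holomorphic_vec_on f S" "open S" "\<And>z. z \<in> T \<Longrightarrow> c *s z \<in> S"
  shows "holomorphic_vec_on (\<lambda>z. f (c *s z)) T"
proof (rule holomorphic_vec_onI)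
  fix z assume "z \<in> T"
  then obtain D where D: "(f has_derivative D) (at (c *s z))" "\<And>c v. D (c *s v) = c * D v"
    using holomorphic_vec_onD[OF assms(1,2,3)] by blast
  have "bounded_linear (\<lambda>z. c *s (z :: complex ^ 'n))"
    by (rule bounded_linear_intro[where K = "norm c"])
       (auto simp: vec_eq_iff algebra_simps norm_vector_smult)
  then have "((\<lambda>z. c *s z) has_derivative (\<lambda>z. c *s z)) (at z)"
    by (rule bounded_linear_imp_has_derivative)
  from has_derivative_compose[OF this D(1)]
  have "((\<lambda>z. f (c *s z)) has_derivative (\<lambda>v. D (c *s v))) (at z)" .
  then show "\<exists>D. ((\<lambda>z. f (c *s z)) has_derivative D) (at z) \<and> (\<forall>c v. D (c *s v) = c * D v)"
    by (intro exI[of _ "\<lambda>v. D (c *s v)"]) (auto simp: D(2))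
qed

text \<open>The degree \<open>k\<close> part of \<open>f\<close> is the \<open>k\<close>-th Taylor coefficient of the slice \<open>\<lambda>c. f (c *s z)\<close>. It makes sense for
every \<open>z\<close>, because the slice is holomorphic near \<open>0\<close>, and is visibly homogeneous; the work lies in showing that
it is a polynomial.\<close>

definition taylor_part :: "(complex ^ 'n::finite \<Rightarrow> complex) \<Rightarrow> nat \<Rightarrow> complex ^ 'n \<Rightarrow> complex" where
  "taylor_part f k z = (deriv ^^ k) (\<lambda>c. f (c *s z)) 0 / fact k"

lemma slice_holomorphic:
  assumes "holomorphic_vec_on f (ball 0 1)" "\<And>c. c \<in> T \<Longrightarrow> norm c * norm z < 1"
  shows "(\<lambda>c. f (c *s z)) holomorphic_on T"
  using holomorphic_on_complex_line[OF assms(1) open_ball, of T 0 z] assms(2)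
  by (simp add: norm_vector_smult)

lemma taylor_part_sums:
  assumes "holomorphic_vec_on f (ball 0 1)" "norm c * norm z < 1"
  shows "(\<lambda>k. taylor_part f k z * c ^ k) sums f (c *s z)"
proof -
  define R where "R = (if z = 0 then norm c + 1 else 1 / norm z)"
  have R: "norm d * norm z < 1" if "d \<in> ball 0 R" for d
    using that by (auto simp: R_def field_simps split: if_splits)
  have "c \<in> ball 0 R" using assms(2) by (auto simp: R_def field_simps)
  from holomorphic_power_series[OF slice_holomorphic[OF assms(1) R] this]
  show ?thesis by (simp add: taylor_part_def)
qed

lemma taylor_part_scale:
  assumes f: "holomorphic_vec_on f (ball 0 1)"
  shows "taylor_part f k (c *s z) = c ^ k * taylor_part f k z"
proof -
  define R where "R = 1 / (norm z + 1)"
  have R: "R > 0" by (simp add: R_def add_nonneg_pos)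
  have hol: "(\<lambda>d. f (d *s z)) holomorphic_on ball 0 R"
  proof (rule slice_holomorphic[OF f])
    fix d :: complex assume "d \<in> ball 0 R"
    then have "norm d * (norm z + 1) < 1"
      by (simp add: R_def pos_less_divide_eq add_nonneg_pos)
    then show "norm d * norm z < 1" 
      using norm_ge_zero[of d] unfolding distrib_left by linarith
  qed
  have "(deriv ^^ k) (\<lambda>w. (\<lambda>d. f (d *s z)) (c * w)) 0 = c ^ k * (deriv ^^ k) (\<lambda>d. f (d *s z)) (c * 0)"
  proof (rule higher_deriv_compose_linear[OF hol])
    show "open (ball 0 (R / (norm c + 1)) :: complex set)" "open (ball 0 R :: complex set)" by auto
    show "(0 :: complex) \<in> ball 0 (R / (norm c + 1))" using R by (simp add: add_nonneg_pos)
    fix w :: complex assume "w \<in> ball 0 (R / (norm c + 1))"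
    then have "norm w * (norm c + 1) < R" by (simp add: pos_less_divide_eq add_nonneg_pos)
    then have "norm c * norm w < R"
      using norm_ge_zero[of w] unfolding distrib_left mult.commute[of "norm c"] by linarith
    then show "c * w \<in> ball 0 R" by (simp add: norm_mult)
  qed
  moreover have "(\<lambda>w. f (w *s (c *s z))) = (\<lambda>w. f ((c * w) *s z))"
    by (simp add: vector_smult_assoc mult.commute)
  ultimately show ?thesis by (simp add: taylor_part_def)
qed

lemma taylor_part_bound:
  assumes f: "holomorphic_vec_on f (ball 0 1)" and "r < 1" "norm z \<le> r"
    and M: "\<And>y. norm y \<le> r \<Longrightarrow> norm (f y) \<le> M"
  shows "norm (taylor_part f k z) \<le> M"
proof -
  have le: "norm c * norm z \<le> r" if "norm c \<le> 1" for c :: complex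
    using mult_right_mono[OF that norm_ge_zero[of z]] assms(3) by simp
  have hol: "(\<lambda>c. f (c *s z)) holomorphic_on cball 0 1"
    by (rule slice_holomorphic[OF f]) (use le \<open>r < 1\<close> in fastforce)
  have "norm ((deriv ^^ k) (\<lambda>c. f (c *s z)) 0) \<le> fact k * M / 1 ^ k"
  proof (rule Cauchy_inequality)
    show "(\<lambda>c. f (c *s z)) holomorphic_on ball 0 1"
      by (rule holomorphic_on_subset[OF hol]) auto
    show "continuous_on (cball 0 1) (\<lambda>c. f (c *s z))"
      by (rule holomorphic_on_imp_continuous_on[OF hol])
    show "norm (f (x *s z)) \<le> M" if "norm (0 - x) = 1" for x
      using le[of x] that by (intro M) (auto simp: norm_vector_smult)
  qed simp
  then show ?thesis by (simp add: taylor_part_def norm_divide field_simps)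
qed

lemma holomorphic_bounded_on_cball:
  assumes "holomorphic_vec_on f (ball 0 1)" "r < 1"
  obtains M where "\<And>y. norm y \<le> r \<Longrightarrow> norm (f y) \<le> M"
proof -
  have "continuous_on (cball 0 r) f"
    by (rule continuous_on_subset[OF holomorphic_vec_on_continuous[OF assms(1)]]) (use assms(2) in auto)
  then have "bounded (f ` cball 0 r)"
    by (intro compact_imp_bounded compact_continuous_image) auto
  then obtain M where "\<forall>x\<in>cball 0 r. norm (f x) \<le> M" by (auto simp: bounded_iff)
  then show ?thesis by (intro that[of M]) auto
qed

text \<open>If the parts of lower degree are known to be holomorphic, the next one is the uniform limit, as \<open>x\<close> tends to
\<open>0\<close>, of \<open>(f (x *s z) - (\<Sum>l<k. taylor_part f l z * x ^ l)) / x ^ k\<close>: the Cauchy bounds on the later parts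
make the error at most a multiple of \<open>x\<close>.\<close>

lemma taylor_part_holomorphic_near_0:
  fixes f :: "complex ^ 'n::finite \<Rightarrow> complex"
  assumes f: "holomorphic_vec_on f (ball 0 1)"
    and lower: "\<And>l. l < k \<Longrightarrow> holomorphic_vec_on (taylor_part f l) UNIV"
  shows "holomorphic_vec_on (taylor_part f k) (ball 0 (1/2))"
proof -
  define c :: "nat \<Rightarrow> real" where "c n = 1 / (real n + 2)" for n
  have c: "0 < c n" "c n \<le> 1 / 2" for n by (auto simp: c_def field_simps)
  obtain M where M: "\<And>y. norm y \<le> 1/2 \<Longrightarrow> norm (f y) \<le> M"
    using holomorphic_bounded_on_cball[OF f, of "1/2"] by auto
  have "norm (f 0) \<le> M" using M[of 0] by simp
  then have M0: "M \<ge> 0" using norm_ge_zero order_trans by blast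
  define G where "G n z = (f (of_real (c n) *s z) - (\<Sum>l<k. taylor_part f l z * of_real (c n) ^ l))
      * (1 / of_real (c n) ^ k)" for n z
  have bound: "norm (G n z - taylor_part f k z) \<le> 2 * M * c n" if z: "norm z \<le> 1/2" for n z
  proof -
    define x where "x = complex_of_real (c n)"
    have x: "x \<noteq> 0" "norm x = c n" using c[of n] by (auto simp: x_def)
    have "norm x * norm z \<le> 1/2 * (1/2)" using c z x by (intro mult_mono) auto
    then have "norm x * norm z < 1" by simp
    from taylor_part_sums[OF f this]
    have sums: "(\<lambda>l. taylor_part f l z * x ^ l) sums f (x *s z)" .
    define S where "S = (\<Sum>l<Suc k. taylor_part f l z * x ^ l)"
    have 1: "(\<lambda>l. taylor_part f (l + Suc k) z * x ^ (l + Suc k)) sums (f (x *s z) - S)"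
      using sums_iff_shift'[of "\<lambda>l. taylor_part f l z * x ^ l" "Suc k" "f (x *s z)"] sums
      unfolding S_def by blast
    have le: "norm (taylor_part f (l + Suc k) z * x ^ (l + Suc k)) \<le> M * c n ^ Suc k * c n ^ l" for l
    proof -
      have "norm (taylor_part f (l + Suc k) z) \<le> M"
        by (rule taylor_part_bound[OF f _ z M]) auto
      then have "norm (taylor_part f (l + Suc k) z) * c n ^ (l + Suc k) \<le> M * c n ^ (l + Suc k)"
        using c[of n] by (intro mult_right_mono) auto
      then show ?thesis by (simp add: norm_mult norm_power x power_add mult_ac)
    qed
    have cn1: "norm (c n) < 1" using c[of n] by auto
    have "norm (f (x *s z) - S) \<le> (\<Sum>l. M * c n ^ Suc k * c n ^ l)"
      unfolding sums_unique[OF 1]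
      by (intro norm_suminf_le le summable_mult summable_geometric cn1)
    also have "\<dots> = M * c n ^ Suc k * (1 / (1 - c n))"
      using cn1 by (subst suminf_mult) (auto simp: suminf_geometric summable_geometric)
    also have "\<dots> \<le> M * c n ^ Suc k * 2"
    proof (intro mult_left_mono)
      show "1 / (1 - c n) \<le> 2" using c[of n] by (simp add: field_simps)
    qed (use M0 c[of n] in auto)
    finally have 2: "norm (f (x *s z) - S) \<le> 2 * M * c n * c n ^ k" by (simp add: mult_ac)
    have "G n z - taylor_part f k z = (f (x *s z) - S) / x ^ k"
      using x by (simp add: G_def S_def x_def field_simps)
    then have "norm (G n z - taylor_part f k z) = norm (f (x *s z) - S) / c n ^ k"
      by (simp add: norm_divide norm_power x)
    also have "\<dots> \<le> 2 * M * c n"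
      using 2 c[of n] by (simp add: pos_divide_le_eq)
    finally show ?thesis .
  qed
  show ?thesis
  proof (rule holomorphic_vec_on_uniform_limit[of _ G])
    show "holomorphic_vec_on (G n) (ball 0 (1/2))" for n
      unfolding G_def
    proof (intro holomorphic_vec_on_mult holomorphic_vec_on_diff holomorphic_vec_on_const holomorphic_vec_on_sum)
      show "holomorphic_vec_on (\<lambda>z. f (complex_of_real (c n) *s z)) (ball 0 (1/2))"
      proof (rule holomorphic_vec_on_scale[OF f open_ball])
        fix z :: "complex ^ 'n" assume "z \<in> ball 0 (1/2)"
        then have "c n * norm z \<le> 1/2 * (1/2)" using c[of n] by (intro mult_mono) auto
        then show "complex_of_real (c n) *s z \<in> ball 0 1"
          using c[of n] by (simp add: norm_vector_smult)
      qed
      show "holomorphic_vec_on (taylor_part f l) (ball 0 (1/2))" if "l \<in> {..<k}" for l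
        using lower[of l] that unfolding holomorphic_vec_on_def
        by (metis UNIV_I has_derivative_at_withinI lessThan_iff)
    qed
    show "\<exists>d>0. cball z d \<subseteq> ball 0 (1/2) \<and> uniform_limit (cball z d) G (taylor_part f k) sequentially"
      if z: "z \<in> ball 0 (1/2)" for z
    proof -
      obtain d where d: "d > 0" "cball z d \<subseteq> ball 0 (1/2)"
        using z open_contains_cball open_ball by blast
      have "uniform_limit (cball z d) G (taylor_part f k) sequentially"
        unfolding uniform_limit_iff
      proof (intro allI impI)
        fix e :: real assume "e > 0"
        have "(\<lambda>n. 2 * M * c n) \<longlonglongrightarrow> 2 * M * 0"
          unfolding c_def using LIMSEQ_ignore_initial_segment[OF lim_1_over_n[where 'a = real], of 2]
          by (intro tendsto_intros) (simp add: add.commute)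
        then have "\<forall>\<^sub>F n in sequentially. 2 * M * c n < e"
          using \<open>e > 0\<close> by (auto dest: order_tendstoD)
        then show "\<forall>\<^sub>F n in sequentially. \<forall>x\<in>cball z d. dist (G n x) (taylor_part f k x) < e"
        proof eventually_elim
          case (elim n)
          show ?case
          proof
            fix x assume "x \<in> cball z d"
            then have "x \<in> ball 0 (1/2)" using d by blast
            then have "norm x \<le> 1/2" by simp
            from bound[OF this, of n] elim show "dist (G n x) (taylor_part f k x) < e"
              by (simp add: dist_norm)
          qed
        qed
      qed
      with d show ?thesis by blast
    qed
  qed auto
qed

text \<open>Homogeneity extends holomorphy from a neighbourhood of \<open>0\<close> to the whole space and bounds the part by a multiple
of \<open>norm z ^ k\<close>. Liouville's theorem in each variable separately then makes it a polynomial of degree at most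
\<open>k\<close> in that variable, and so a polynomial.\<close>

lemma taylor_part_eq_hpart:
  fixes f :: "complex ^ 'n::finite \<Rightarrow> complex"
  assumes f: "holomorphic_vec_on f (ball 0 1)"
  shows "\<exists>b. \<forall>z. taylor_part f k z = hpart b k z"
proof (induction k rule: less_induct)
  case (less k)
  have "holomorphic_vec_on (taylor_part f l) UNIV" if l: "l < k" for l
  proof -
    obtain b where "taylor_part f l = hpart b l" using less[OF l] by blast
    then show ?thesis by (simp add: holomorphic_hpart)
  qed
  from taylor_part_holomorphic_near_0[OF f this]
  have near0: "holomorphic_vec_on (taylor_part f k) (ball 0 (1/2))" .
  have entire: "holomorphic_vec_on (taylor_part f k) (ball 0 \<rho>)" if "\<rho> > 0" for \<rho>
  proof -
    define t where "t = complex_of_real (1 / (2 * \<rho>))"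
    have "t \<noteq> 0" using that by (simp add: t_def)
    then have eq: "taylor_part f k = (\<lambda>z. (1 / t ^ k) * taylor_part f k (t *s z))"
      using taylor_part_scale[OF f] by (simp add: fun_eq_iff)
    show ?thesis
      by (subst eq, intro holomorphic_vec_on_mult holomorphic_vec_on_const holomorphic_vec_on_scale[OF near0 open_ball])
         (use that in \<open>simp add: t_def norm_vector_smult norm_divide field_simps\<close>)
  qed
  obtain M where M: "\<And>y. norm y \<le> 1/2 \<Longrightarrow> norm (f y) \<le> M"
    using holomorphic_bounded_on_cball[OF f, of "1/2"] by auto
  have growth: "norm (taylor_part f k z) \<le> M * (2 * norm z) ^ k" for z
  proof (cases "z = 0")
    case True
    show ?thesis
    proof (cases k)
      case 0
      then show ?thesis using taylor_part_bound[OF f, of "1/2" z M k] M True by simp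
    next
      case (Suc k')
      have "taylor_part f k (0 *s z) = 0 ^ k * taylor_part f k z" by (rule taylor_part_scale[OF f])
      then show ?thesis using Suc True by simp
    qed
  next
    case False
    define y where "y = complex_of_real (1 / (2 * norm z)) *s z"
    have "z = complex_of_real (2 * norm z) *s y" using False by (simp add: y_def vec_eq_iff)
    then have "taylor_part f k z = complex_of_real (2 * norm z) ^ k * taylor_part f k y"
      using taylor_part_scale[OF f] by metis
    moreover have "norm (taylor_part f k y) \<le> M"
      by (rule taylor_part_bound[OF f, of "1/2"])
         (use False M in \<open>auto simp: y_def norm_vector_smult norm_divide\<close>)
    ultimately show ?thesis
      by (simp add: norm_mult norm_power power_mult_distrib mult_left_mono mult.commute[of M])
  qed
  have "\<exists>p. degree p \<le> k \<and> (\<forall>\<zeta>. taylor_part f k (\<chi> j. if j = i then \<zeta> else z $ j) = poly p \<zeta>)" for i z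
  proof -
    define g where "g \<zeta> = taylor_part f k ((z - z $ i *s axis i 1) + \<zeta> *s axis i 1)" for \<zeta>
    have upd: "(\<chi> j. if j = i then \<zeta> else z $ j) = (z - z $ i *s axis i 1) + \<zeta> *s axis i 1" for \<zeta>
      by (auto simp: vec_eq_iff axis_def)
    have normax: "norm (axis i 1 :: complex ^ 'n) = 1" by simp
    define A where "A = norm (z - z $ i *s axis i 1) + 1"
    have le: "norm ((z - z $ i *s axis i 1) + \<zeta> *s axis i 1) \<le> A + norm \<zeta>" for \<zeta>
      using norm_triangle_ineq[of "z - z $ i *s axis i 1" "\<zeta> *s axis i 1"]
      by (simp add: A_def norm_vector_smult normax)
    have A: "A > 0" by (simp add: A_def add_nonneg_pos)
    have hol: "g holomorphic_on UNIV"
    proof (rule holomorphic_on_balls_imp_entire')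
      fix R :: real assume "R > 0"
      show "g holomorphic_on ball 0 R"
        unfolding g_def
      proof (rule holomorphic_on_complex_line[OF entire open_ball])
        show "A + R > 0" using A \<open>R > 0\<close> by simp
        fix \<zeta> :: complex assume "\<zeta> \<in> ball 0 R"
        then have "norm \<zeta> < R" by simp
        then show "(z - z $ i *s axis i 1) + \<zeta> *s axis i 1 \<in> ball 0 (A + R)"
          using le[of \<zeta>] unfolding mem_ball_0 by linarith
      qed
    qed
    have M0: "M \<ge> 0" using M[of 0] order_trans[OF norm_ge_zero] by auto
    have g: "g \<xi> = (\<Sum>l\<le>k. (deriv ^^ l) g 0 / fact l * \<xi> ^ l)" for \<xi>
    proof (rule Liouville_polynomial[OF hol, of A "M * 4 ^ k"])
      fix \<zeta> :: complex assume "A \<le> norm \<zeta>"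
      then have "2 * norm ((z - z $ i *s axis i 1) + \<zeta> *s axis i 1) \<le> 4 * norm \<zeta>" using le[of \<zeta>] by linarith
      then have "(2 * norm ((z - z $ i *s axis i 1) + \<zeta> *s axis i 1)) ^ k \<le> (4 * norm \<zeta>) ^ k"
        by (intro power_mono) auto
      then have "M * (2 * norm ((z - z $ i *s axis i 1) + \<zeta> *s axis i 1)) ^ k \<le> M * (4 * norm \<zeta>) ^ k"
        using M0 by (intro mult_left_mono)
      then show "norm (g \<zeta>) \<le> M * 4 ^ k * norm \<zeta> ^ k"
        using growth unfolding g_def power_mult_distrib mult.assoc[symmetric] by (meson order_trans)
    qed
    define p where "p = (\<Sum>l\<le>k. monom ((deriv ^^ l) g 0 / fact l) l)"
    have "degree p \<le> k"
      unfolding p_def by (intro degree_sum_le) (auto intro: order_trans[OF degree_monom_le])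
    moreover have "poly p \<zeta> = g \<zeta>" for \<zeta>
      by (subst g) (simp add: p_def poly_sum poly_monom)
    ultimately show ?thesis unfolding upd g_def[symmetric] by metis
  qed
  then have "polynomial_vec (taylor_part f k)" by (rule polynomial_vec_of_separately_polynomial)
  then show ?case using homogeneous_polynomial_eq_hpart taylor_part_scale[OF f] by blast
qed

lemma holomorphic_expansion:
  fixes f :: "complex ^ 'n::finite \<Rightarrow> complex"
  assumes f: "holomorphic_vec_on f (ball 0 1)"
  obtains a where "locally_bounded_parts a" "\<And>z. z \<in> ball 0 1 \<Longrightarrow> f z = hseries a z"
proof -
  obtain b where b: "\<And>k z. taylor_part f k z = hpart (b k) k z"
    using taylor_part_eq_hpart[OF f] by metis
  define a where "a m = b (mi_size m) m" for m
  have a: "hpart a k z = taylor_part f k z" for k z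
    unfolding b hpart_def a_def by (intro sum.cong refl) auto
  show ?thesis
  proof
    show "locally_bounded_parts a"
      unfolding locally_bounded_parts_def a
    proof (intro allI impI)
      fix r :: real assume r: "0 < r \<and> r < 1"
      then obtain M where "\<And>y. norm y \<le> r \<Longrightarrow> norm (f y) \<le> M"
        using holomorphic_bounded_on_cball[OF f] by blast
      then show "\<exists>C. \<forall>k z. norm z \<le> r \<longrightarrow> norm (taylor_part f k z) \<le> C"
        using taylor_part_bound[OF f] r by blast
    qed
    show "f z = hseries a z" if "z \<in> ball 0 1" for z
      using taylor_part_sums[OF f, of 1 z] that by (simp add: hseries_def a sums_iff)
  qed
qed

section \<open>Torus invariance of Lebesgue measure and orthogonality of monomials\<close>

lemma lborel_complex_eq_distr_real2:
  "(lborel :: complex measure) = distr lborel borel (\<lambda>x :: real ^ 2. Complex (x $ 1) (x $ 2))"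
proof (rule lborel_eqI)
  fix l u :: complex assume le: "\<And>b. b \<in> Basis \<Longrightarrow> l \<bullet> b \<le> u \<bullet> b"
  have le': "Re l \<le> Re u" "Im l \<le> Im u" using le[of 1] le[of \<i>] by (auto simp: Basis_complex_def)
  have [measurable]: "(\<lambda>x :: real ^ 2. Complex (x $ 1) (x $ 2)) \<in> borel_measurable borel"
    by (intro borel_measurable_continuous_onI continuous_intros)
  define l' u' :: "real ^ 2" where "l' = vector [Re l, Im l]" and "u' = vector [Re u, Im u]"
  have vim: "(\<lambda>x :: real ^ 2. Complex (x $ 1) (x $ 2)) -` box l u = box l' u'"
    by (auto simp: box_def l'_def u'_def Basis_complex_def Basis_vec_def inner_axis UNIV_2)
  have B2: "(Basis :: (real ^ 2) set) = {axis 1 1, axis 2 1}"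
    by (auto simp: Basis_vec_def UNIV_2)
  have ne: "axis 1 1 \<noteq> (axis 2 1 :: real ^ 2)" by (simp add: axis_eq_axis)
  have "emeasure (distr lborel borel (\<lambda>x :: real ^ 2. Complex (x $ 1) (x $ 2))) (box l u) = emeasure lborel (box l' u')"
    by (simp add: emeasure_distr vim)
  also have "\<dots> = (\<Prod>b\<in>Basis. (u' - l') \<bullet> b)"
    by (rule emeasure_lborel_box) (use le' in \<open>auto simp: B2 inner_axis l'_def u'_def\<close>)
  also have "\<dots> = (\<Prod>b\<in>Basis. (u - l) \<bullet> b)"
    using ne by (simp add: B2 Basis_complex_def inner_axis l'_def u'_def)
  finally show "emeasure (distr lborel borel (\<lambda>x :: real ^ 2. Complex (x $ 1) (x $ 2))) (box l u)
      = (\<Prod>b\<in>Basis. (u - l) \<bullet> b)" .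
qed simp

text \<open>In real coordinates a rotation of the plane is an orthogonal transformation, so the change of variables formula
for linear maps applies.\<close>

lemma lborel_complex_rotation:
  assumes c: "norm c = 1"
  shows "distr lborel borel ((*) c) = (lborel :: complex measure)"
proof (rule lborel_eqI[symmetric])
  fix l u :: complex assume le: "\<And>b. b \<in> Basis \<Longrightarrow> l \<bullet> b \<le> u \<bullet> b"
  define \<phi> where "\<phi> x = Complex (x $ 1) (x $ 2)" for x :: "real ^ 2"
  define \<psi> :: "complex \<Rightarrow> real ^ 2" where "\<psi> z = vector [Re z, Im z]" for z
  have \<phi>\<psi>: "\<phi> (\<psi> z) = z" for z by (simp add: \<phi>_def \<psi>_def complex_eq_iff)
  have \<psi>\<phi>: "\<psi> (\<phi> x) = x" for x by (simp add: \<phi>_def \<psi>_def vec_eq_iff forall_2)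
  have \<phi>_borel [measurable]: "\<phi> \<in> borel_measurable borel"
    unfolding \<phi>_def[abs_def] by (intro borel_measurable_continuous_onI continuous_intros)
  have lb: "lborel = distr lborel borel \<phi>"
    unfolding \<phi>_def[abs_def] by (rule lborel_complex_eq_distr_real2)
  define T where "T d x = \<psi> (d * \<phi> x)" for d x
  have norm\<phi>: "norm (\<phi> x) = norm x" for x
    by (simp add: \<phi>_def norm_vec_def L2_set_def sum_2 complex_norm)
  have orth: "orthogonal_transformation (T d)" if "norm d = 1" for d
  proof -
    have "linear (T d)"
      by (auto simp: linear_iff T_def \<phi>_def \<psi>_def vec_eq_iff forall_2 algebra_simps)
    moreover have "norm (T d x) = norm x" for x
      using that by (metis T_def \<phi>\<psi> mult_1 norm\<phi> norm_mult)
    ultimately show ?thesis by (simp add: orthogonal_transformation)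
  qed
  define S where "S = \<phi> -` box l u"
  have S_borel: "S \<in> sets borel" unfolding S_def by (rule measurable_sets_borel[OF \<phi>_borel]) simp
  have "bounded S"
  proof -
    have "bounded (box l u)" by (rule bounded_box)
    then obtain a where "\<forall>x\<in>box l u. norm x \<le> a" by (auto simp: bounded_iff)
    then show ?thesis unfolding bounded_iff S_def by (metis norm\<phi> vimageE)
  qed
  then have S: "S \<in> lmeasurable"
    using S_borel by (intro bounded_set_imp_lmeasurable) auto
  have cc: "c * cnj c = 1" "norm (cnj c) = 1" using c by (auto simp: complex_norm_square[symmetric])
  have vim: "(\<lambda>x. c * \<phi> x) -` box l u = T (cnj c) ` S"
  proof
    show "(\<lambda>x. c * \<phi> x) -` box l u \<subseteq> T (cnj c) ` S"
    proof
      fix x assume x: "x \<in> (\<lambda>x. c * \<phi> x) -` box l u"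
      have "x = T (cnj c) (T c x)"
        using cc by (simp add: T_def \<phi>\<psi> \<psi>\<phi> mult.assoc[symmetric] mult.commute)
      moreover have "T c x \<in> S" using x by (simp add: S_def T_def \<phi>\<psi>)
      ultimately show "x \<in> T (cnj c) ` S" by blast
    qed
    show "T (cnj c) ` S \<subseteq> (\<lambda>x. c * \<phi> x) -` box l u"
      using cc by (auto simp: S_def T_def \<phi>\<psi> mult.assoc[symmetric])
  qed
  have c\<phi>: "(\<lambda>x. c * \<phi> x) -` box l u \<in> sets borel"
    by (rule measurable_sets_borel[of _ borel]) auto
  have "emeasure (distr lborel borel ((*) c)) (box l u) = emeasure lborel ((*) c -` box l u)"
    by (simp add: emeasure_distr)
  also have "\<dots> = emeasure (distr lborel borel \<phi>) ((*) c -` box l u)"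
    using lb by simp
  also have "\<dots> = emeasure lborel (T (cnj c) ` S)"
    unfolding vim[symmetric] by (subst emeasure_distr) (auto simp: vimage_def intro!: borel_open open_vimage[unfolded vimage_def] continuous_intros)
  also have "\<dots> = emeasure lebesgue (T (cnj c) ` S)"
    unfolding vim[symmetric] using c\<phi> by simp
  also have "\<dots> = measure lebesgue (T (cnj c) ` S)"
    by (intro emeasure_eq_measure2 measurable_orthogonal_image orth cc S)
  also have "\<dots> = measure lebesgue S"
    unfolding measure_orthogonal_image[OF orth[OF cc(2)] S] ..
  also have "\<dots> = emeasure lebesgue S"
    by (intro emeasure_eq_measure2[symmetric] S)
  also have "\<dots> = emeasure lborel S"
    using S_borel by simp
  also have "\<dots> = emeasure (distr lborel borel \<phi>) (box l u)"
    by (simp add: emeasure_distr S_def)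
  also have "\<dots> = emeasure lborel (box l u)" using lb by simp
  also have "\<dots> = (\<Prod>b\<in>Basis. (u - l) \<bullet> b)" by (rule emeasure_lborel_box[OF le])
  finally show "emeasure (distr lborel borel ((*) c)) (box l u) = (\<Prod>b\<in>Basis. (u - l) \<bullet> b)" .
qed simp

interpretation lborel_family: product_sigma_finite "\<lambda>_ :: 'n. lborel :: 'a::euclidean_space measure"
  by standard

lemma measurable_vec_lambda [measurable]:
  "(\<lambda>f. \<chi> i. f i) \<in> measurable (\<Pi>\<^sub>M i\<in>(UNIV :: 'n::finite set). borel :: complex measure) (borel :: (complex ^ 'n) measure)"
proof -
  have "(\<lambda>f. (\<chi> i. f i) \<bullet> b) \<in> borel_measurable (\<Pi>\<^sub>M i\<in>(UNIV :: 'n set). borel :: complex measure)"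
    if "b \<in> Basis" for b :: "complex ^ 'n"
  proof -
    obtain i u where b: "b = axis i u" using \<open>b \<in> Basis\<close> by (auto simp: Basis_vec_def)
    show ?thesis unfolding b inner_axis by (simp, measurable)
  qed
  then show ?thesis by (subst borel_measurable_euclidean_space) auto
qed

text \<open>Viewing Lebesgue measure as a product over the complex coordinates makes it invariant under independent
rotations of the coordinates and lets the Gaussian integral below factorise.\<close>

lemma lborel_vec_eq_PiM:
  "(lborel :: (complex ^ 'n::finite) measure)
     = distr (\<Pi>\<^sub>M i\<in>UNIV. lborel) borel (\<lambda>f. \<chi> i. f i)"
proof (rule lborel_eqI)
  fix l u :: "complex ^ 'n" assume le: "\<And>b. b \<in> Basis \<Longrightarrow> l \<bullet> b \<le> u \<bullet> b"
  have [measurable_cong]: "sets (\<Pi>\<^sub>M i\<in>(UNIV :: 'n set). lborel :: complex measure) = sets (\<Pi>\<^sub>M i\<in>UNIV. borel)"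
    by (intro sets_PiM_cong) auto
  have vim: "(\<lambda>f. \<chi> i. f i) -` box l u \<inter> space (\<Pi>\<^sub>M i\<in>UNIV. lborel)
      = (\<Pi>\<^sub>E i\<in>UNIV. box (l $ i) (u $ i))"
    by (auto simp: space_PiM box_def Basis_vec_def inner_axis)
  have Basis_eq: "(Basis :: (complex ^ 'n) set) = (\<lambda>(i, b). axis i b) ` (UNIV \<times> Basis)"
    by (auto simp: Basis_vec_def)
  have inj: "inj_on (\<lambda>(i, b). axis i b :: complex ^ 'n) (UNIV \<times> Basis)"
    by (auto simp: inj_on_def axis_eq_axis)
  have "emeasure (distr (\<Pi>\<^sub>M i\<in>UNIV. lborel) borel (\<lambda>f. \<chi> i. f i)) (box l u)
      = emeasure (\<Pi>\<^sub>M i\<in>UNIV. lborel) (\<Pi>\<^sub>E i\<in>UNIV. box (l $ i) (u $ i))"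
    by (subst emeasure_distr) (auto simp: vim)
  also have "\<dots> = (\<Prod>i\<in>UNIV. emeasure lborel (box (l $ i) (u $ i)))"
    by (rule lborel_family.emeasure_PiM) auto
  also have "\<dots> = (\<Prod>i\<in>UNIV. ennreal (\<Prod>b\<in>Basis. (u $ i - l $ i) \<bullet> b))"
  proof (intro prod.cong refl emeasure_lborel_box)
    fix i :: 'n and b :: complex assume "b \<in> Basis"
    then show "l $ i \<bullet> b \<le> u $ i \<bullet> b"
      using le[of "axis i b"] by (auto simp: Basis_vec_def inner_axis)
  qed
  also have "\<dots> = ennreal (\<Prod>i\<in>UNIV. \<Prod>b\<in>Basis. (u $ i - l $ i) \<bullet> b)"
  proof (rule prod_ennreal)
    fix i :: 'n
    show "0 \<le> (\<Prod>b\<in>Basis. (u $ i - l $ i) \<bullet> b)"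
    proof (rule prod_nonneg)
      fix b :: complex assume "b \<in> Basis"
      then show "0 \<le> (u $ i - l $ i) \<bullet> b"
        using le[of "axis i b"] by (auto simp: Basis_vec_def inner_axis inner_diff_left)
    qed
  qed
  also have "(\<Prod>i\<in>UNIV. \<Prod>b\<in>Basis. (u $ i - l $ i) \<bullet> b) = (\<Prod>b\<in>Basis. (u - l) \<bullet> b)"
    unfolding Basis_eq prod.cartesian_product
    by (subst prod.reindex[OF inj]) (auto simp: inner_axis intro!: prod.cong)
  finally show "emeasure (distr (\<Pi>\<^sub>M i\<in>UNIV. lborel) borel (\<lambda>f. \<chi> i. f i)) (box l u)
      = (\<Prod>b\<in>Basis. (u - l) \<bullet> b)" .
qed simp

lemma measurable_vec_nth [measurable]: "(\<lambda>z. z $ i) \<in> borel_measurable (borel :: (complex ^ 'n::finite) measure)"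
  by (intro borel_measurable_continuous_onI continuous_intros)

lemma nn_integral_vec_prod:
  fixes f :: "'n::finite \<Rightarrow> complex \<Rightarrow> ennreal"
  assumes [measurable]: "\<And>i. f i \<in> borel_measurable borel"
  shows "(\<integral>\<^sup>+ z. (\<Prod>i\<in>UNIV. f i (z $ i)) \<partial>(lborel :: (complex ^ 'n) measure)) = (\<Prod>i\<in>UNIV. \<integral>\<^sup>+ x. f i x \<partial>lborel)"
proof -
  have [measurable_cong]: "sets (\<Pi>\<^sub>M i\<in>(UNIV :: 'n set). lborel :: complex measure) = sets (\<Pi>\<^sub>M i\<in>UNIV. borel)"
    by (intro sets_PiM_cong) auto
  have "(\<integral>\<^sup>+ z. (\<Prod>i\<in>UNIV. f i (z $ i)) \<partial>(lborel :: (complex ^ 'n) measure))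
      = (\<integral>\<^sup>+ g. (\<Prod>i\<in>UNIV. f i (g i)) \<partial>(\<Pi>\<^sub>M i\<in>UNIV. lborel))"
    by (subst lborel_vec_eq_PiM, subst nn_integral_distr) auto
  also have "\<dots> = (\<Prod>i\<in>UNIV. \<integral>\<^sup>+ x. f i x \<partial>lborel)"
    by (rule lborel_family.product_nn_integral_prod) auto
  finally show ?thesis .
qed

lemma lborel_vec_rotation:
  fixes c :: "'n::finite \<Rightarrow> complex"
  assumes c: "\<And>i. norm (c i) = 1"
  shows "distr lborel borel (\<lambda>z. \<chi> i. c i * z $ i) = (lborel :: (complex ^ 'n) measure)"
proof -
  let ?P = "\<Pi>\<^sub>M i\<in>(UNIV :: 'n set). lborel :: complex measure"
  have [measurable_cong]: "sets ?P = sets (\<Pi>\<^sub>M i\<in>UNIV. borel)"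
    by (intro sets_PiM_cong) auto
  have m1 [measurable]: "(\<lambda>f i. c i * f i) \<in> measurable ?P ?P"
    by (rule measurable_PiM_single') (auto simp: space_PiM)
  have P: "distr ?P ?P (\<lambda>f i. c i * f i) = ?P"
  proof (rule lborel_family.PiM_eqI)
    fix A :: "'n \<Rightarrow> complex set" assume A: "\<And>i. i \<in> UNIV \<Longrightarrow> A i \<in> sets lborel"
    then have [measurable]: "\<And>i. A i \<in> sets borel" by simp
    have vim: "(\<lambda>f i. c i * f i) -` Pi\<^sub>E UNIV A \<inter> space ?P = (\<Pi>\<^sub>E i\<in>UNIV. (*) (c i) -` A i)"
      by (auto simp: space_PiM)
    have "emeasure (distr ?P ?P (\<lambda>f i. c i * f i)) (Pi\<^sub>E UNIV A) = emeasure ?P (\<Pi>\<^sub>E i\<in>UNIV. (*) (c i) -` A i)"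
      by (subst emeasure_distr[OF m1]) (use A in \<open>auto simp: vim intro!: sets_PiM_I_finite\<close>)
    also have "\<dots> = (\<Prod>i\<in>UNIV. emeasure lborel ((*) (c i) -` A i))"
      by (rule lborel_family.emeasure_PiM) (auto intro: measurable_sets_borel[of "(*) _" borel])
    also have "\<dots> = (\<Prod>i\<in>UNIV. emeasure (distr lborel borel ((*) (c i))) (A i))"
      by (intro prod.cong refl) (simp add: emeasure_distr)
    finally show "emeasure (distr ?P ?P (\<lambda>f i. c i * f i)) (Pi\<^sub>E UNIV A) = (\<Prod>i\<in>UNIV. emeasure lborel (A i))"
      by (simp add: lborel_complex_rotation c)
  qed simp_all
  have [measurable]: "(\<lambda>z. \<chi> i. c i * z $ i) \<in> borel_measurable (borel :: (complex ^ 'n) measure)"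
    by (intro borel_measurable_continuous_onI continuous_intros)
  have "distr lborel borel (\<lambda>z. \<chi> i. c i * z $ i) = distr ?P borel (\<lambda>f. \<chi> i. c i * f i)"
    by (subst lborel_vec_eq_PiM, subst distr_distr) (auto simp: o_def)
  also have "\<dots> = distr (distr ?P ?P (\<lambda>f i. c i * f i)) borel (\<lambda>f. \<chi> i. f i)"
    by (subst distr_distr) (auto simp: o_def)
  also have "\<dots> = lborel" unfolding P by (rule lborel_vec_eq_PiM[symmetric])
  finally show ?thesis .
qed

lemma measurable_mi_monom [measurable]: "(\<lambda>z. mi_monom z m) \<in> borel_measurable borel"
  unfolding mi_monom_def by measurable

lemma measurable_cnj [measurable]: "cnj \<in> borel_measurable borel"
  by (intro borel_measurable_continuous_onI continuous_intros)

text \<open>If \<open>m i\<close> and \<open>m' i\<close> differ, rotating the \<open>i\<close>-th coordinate by the angle \<open>pi / (m i - m' i)\<close> changes the sign of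
the integrand. By invariance the integral equals its own negative.\<close>

lemma monomials_orthogonal:
  fixes w :: "complex ^ 'n::finite \<Rightarrow> real"
  assumes [measurable]: "w \<in> borel_measurable borel"
    and w: "\<And>c z. (\<And>i. norm (c i) = 1) \<Longrightarrow> w (\<chi> i. c i * z $ i) = w z"
    and "m \<noteq> m'"
  shows "(\<integral>z. w z *\<^sub>R (mi_monom z m * cnj (mi_monom z m')) \<partial>lborel) = 0"
proof -
  obtain i where i: "m i \<noteq> m' i" using \<open>m \<noteq> m'\<close> by blast
  define \<zeta> where "\<zeta> = cis (pi / (real (m i) - real (m' i)))"
  have \<zeta>: "\<zeta> ^ m i * cnj \<zeta> ^ m' i = -1"
  proof -
    have "\<zeta> ^ m i * cnj \<zeta> ^ m' i = cis (real (m i) * (pi / (real (m i) - real (m' i))) - real (m' i) * (pi / (real (m i) - real (m' i))))"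
      by (simp add: \<zeta>_def Complex.DeMoivre cis_cnj cis_mult)
    also have "real (m i) * (pi / (real (m i) - real (m' i))) - real (m' i) * (pi / (real (m i) - real (m' i))) = pi"
      using i by (simp add: diff_divide_distrib[symmetric] left_diff_distrib[symmetric])
    finally show ?thesis by simp
  qed
  define c where "c j = (if j = i then \<zeta> else 1)" for j
  have c: "norm (c j) = 1" for j by (simp add: c_def \<zeta>_def)
  have prod_c: "(\<Prod>j\<in>UNIV. c j ^ m j) = \<zeta> ^ m i" for m :: "'n midx"
    by (subst prod.remove[of _ i]) (auto simp: c_def)
  have rot: "mi_monom (\<chi> j. c j * z $ j) m = \<zeta> ^ m i * mi_monom z m" for z and m :: "'n midx"
    by (simp add: mi_monom_def power_mult_distrib prod.distrib prod_c)
  let ?F = "\<lambda>z. w z *\<^sub>R (mi_monom z m * cnj (mi_monom z m'))"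
  have [measurable]: "(\<lambda>z. \<chi> j. c j * z $ j) \<in> borel_measurable (borel :: (complex ^ 'n) measure)"
    by (intro borel_measurable_continuous_onI continuous_intros)
  have "(\<integral>z. ?F z \<partial>lborel) = (\<integral>z. ?F z \<partial>(distr lborel borel (\<lambda>z. \<chi> j. c j * z $ j)))"
    by (simp add: lborel_vec_rotation c)
  also have "\<dots> = (\<integral>z. ?F (\<chi> j. c j * z $ j) \<partial>lborel)"
    by (subst integral_distr) auto
  also have "\<dots> = (\<integral>z. (\<zeta> ^ m i * cnj \<zeta> ^ m' i) * ?F z \<partial>lborel)"
    using w[of c] c by (intro Bochner_Integration.integral_cong refl) (simp add: rot mult_ac)
  also have "\<dots> = - (\<integral>z. ?F z \<partial>lborel)" unfolding \<zeta> by simp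
  finally show ?thesis by simp
qed

section \<open>Moments of the monomials\<close>

lemma nn_integral_scale_ball:
  fixes h :: "'a::euclidean_space \<Rightarrow> ennreal"
  assumes [measurable]: "h \<in> borel_measurable borel"
    and hom: "\<And>t z. t > 0 \<Longrightarrow> h (t *\<^sub>R z) = ennreal (t ^ p) * h z" and "r > 0"
  shows "(\<integral>\<^sup>+ z. h z * indicator (ball 0 r) z \<partial>lborel)
    = ennreal (r ^ (DIM('a) + p)) * (\<integral>\<^sup>+ z. h z * indicator (ball 0 1) z \<partial>lborel)"
proof -
  have [measurable]: "ball (0 :: 'a) t \<in> sets borel" for t by simp
  have "(\<integral>\<^sup>+ z. h z * indicator (ball 0 r) z \<partial>lborel)
      = (\<integral>\<^sup>+ z. h z * indicator (ball 0 r) z \<partial>(density (distr lborel borel (\<lambda>x. 0 + r *\<^sub>R x)) (\<lambda>_. ennreal (\<bar>r\<bar> ^ DIM('a)))))"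
    using lborel_affine[of r "0 :: 'a"] \<open>r > 0\<close> by simp
  also have "\<dots> = (\<integral>\<^sup>+ z. ennreal (r ^ DIM('a)) * (h (r *\<^sub>R z) * indicator (ball 0 r) (r *\<^sub>R z)) \<partial>lborel)"
  proof -
    have G: "(\<lambda>z. h z * indicator (ball 0 r) z) \<in> borel_measurable borel"
      by measurable
    show ?thesis
      using \<open>r > 0\<close> G by (subst nn_integral_density) (auto simp: nn_integral_distr)
  qed
  also have "\<dots> = (\<integral>\<^sup>+ z. ennreal (r ^ (DIM('a) + p)) * (h z * indicator (ball 0 1) z) \<partial>lborel)"
    using \<open>r > 0\<close> by (intro nn_integral_cong)
      (auto simp: hom power_add ennreal_mult' mult_ac split: split_indicator)
  also have "\<dots> = ennreal (r ^ (DIM('a) + p)) * (\<integral>\<^sup>+ z. h z * indicator (ball 0 1) z \<partial>lborel)"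
    by (rule nn_integral_cmult) measurable
  finally show ?thesis .
qed

text \<open>Integration in polar coordinates for a homogeneous function, without integrals over spheres. By scaling, the
integral of \<open>h\<close> over the ball of squared radius \<open>t\<close> is \<open>A * t ^ s\<close>, so the measure with density \<open>h\<close> is pushed
forward by the squared norm to the measure with density \<open>A * s * t ^ (s - 1)\<close>.\<close>

lemma nn_integral_homogeneous_radial:
  fixes h :: "'a::euclidean_space \<Rightarrow> ennreal" and s :: nat
  assumes [measurable]: "h \<in> borel_measurable borel" "\<phi> \<in> borel_measurable borel"
    and hom: "\<And>t z. t > 0 \<Longrightarrow> h (t *\<^sub>R z) = ennreal (t ^ p) * h z"
    and s: "DIM('a) + p = 2 * s" "s > 0"
    and A: "A = (\<integral>\<^sup>+ z. h z * indicator (ball 0 1) z \<partial>lborel)" "A < \<infinity>"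
  shows "(\<integral>\<^sup>+ z. h z * \<phi> ((norm z)\<^sup>2) \<partial>lborel)
    = A * (\<integral>\<^sup>+ t. ennreal (real s * t ^ (s - 1)) * indicator {0..} t * \<phi> t \<partial>lborel)"
proof -
  define g where "g t = A * (ennreal (real s * t ^ (s - 1)) * indicator {0..} t)" for t :: real
  have [measurable]: "g \<in> borel_measurable borel" unfolding g_def by measurable
  \<comment> \<open>The sign is reversed so that the half-lines unbounded above, on which the two measures are compared, have
    finite measure.\<close>
  define M where "M = distr (density lborel h) borel (\<lambda>z. - (norm z)\<^sup>2)"
  define N where "N = distr (density lborel g) borel (uminus :: real \<Rightarrow> real)"
  have eM: "emeasure M {x<..} = (if x < 0 then ennreal ((- x) ^ s) * A else 0)" for x
  proof -
    have "emeasure M {x<..} = (\<integral>\<^sup>+ z. h z * indicator {z. x < - (norm z)\<^sup>2} z \<partial>lborel)"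
      unfolding M_def by (subst emeasure_distr) (auto simp: emeasure_density vimage_def greaterThan_def)
    also have "\<dots> = (if x < 0 then ennreal ((- x) ^ s) * A else 0)"
    proof (cases "x < 0")
      case True
      have "norm z < sqrt (- x) \<longleftrightarrow> x < - (norm z)\<^sup>2" for z :: 'a
        using real_sqrt_less_iff[of "(norm z)\<^sup>2" "- x"]
        unfolding real_sqrt_abs abs_norm_cancel by linarith
      then have "{z :: 'a. x < - (norm z)\<^sup>2} = ball 0 (sqrt (- x))"
        unfolding set_eq_iff mem_Collect_eq mem_ball_0 by blast
      moreover have "(\<integral>\<^sup>+ z. h z * indicator (ball 0 (sqrt (- x))) z \<partial>lborel)
          = ennreal (sqrt (- x) ^ (DIM('a) + p)) * A"
        unfolding A by (rule nn_integral_scale_ball[OF _ hom]) (use True in auto)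
      moreover have "sqrt (- x) ^ (DIM('a) + p) = (- x) ^ s"
        using True unfolding s power_mult by simp
      ultimately show ?thesis using True by simp
    next
      case False
      have "\<not> x < - (norm z)\<^sup>2" for z :: 'a
        using False zero_le_power2[of "norm z"] by linarith
      then have "{z :: 'a. x < - (norm z)\<^sup>2} = {}" by blast
      then show ?thesis using False by simp
    qed
    finally show ?thesis .
  qed
  have eN: "emeasure N {x<..} = (if x < 0 then ennreal ((- x) ^ s) * A else 0)" for x
  proof -
    have "emeasure N {x<..} = (\<integral>\<^sup>+ t. g t * indicator {t. x < - t} t \<partial>lborel)"
      unfolding N_def by (subst emeasure_distr) (auto simp: emeasure_density vimage_def greaterThan_def)
    also have "\<dots> = (if x < 0 then ennreal ((- x) ^ s) * A else 0)"
    proof (cases "x < 0")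
      case True
      have "(\<integral>\<^sup>+ t. g t * indicator {t. x < - t} t \<partial>lborel)
          = (\<integral>\<^sup>+ t. A * (ennreal (real s * t ^ (s - 1)) * indicator {0..-x} t) \<partial>lborel)"
        using AE_lborel_singleton[of "-x"]
        by (intro nn_integral_cong_AE) (auto simp: g_def split: split_indicator)
      also have "\<dots> = A * (\<integral>\<^sup>+ t. ennreal (real s * t ^ (s - 1)) * indicator {0..-x} t \<partial>lborel)"
        by (rule nn_integral_cmult) measurable
      also have "(\<integral>\<^sup>+ t. ennreal (real s * t ^ (s - 1)) * indicator {0..-x} t \<partial>lborel) = (-x) ^ s - 0 ^ s"
        using True by (intro nn_integral_FTC_Icc) (auto intro!: derivative_eq_intros)
      finally show ?thesis using True s by (simp add: mult.commute zero_power)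
    next
      case False
      then have "(\<integral>\<^sup>+ t. g t * indicator {t. x < - t} t \<partial>lborel) = (\<integral>\<^sup>+ t. 0 \<partial>(lborel :: real measure))"
        by (intro nn_integral_cong) (auto simp: g_def split: split_indicator)
      then show ?thesis using False by simp
    qed
    finally show ?thesis .
  qed
  have MN: "M = N"
  proof (rule measure_eqI_lessThan)
    show "emeasure M {x<..} < \<infinity>" for x
      unfolding eM using A(2) by (auto simp: ennreal_mult_less_top)
    show "emeasure M {x<..} = emeasure N {x<..}" for x by (simp only: eM eN)
  qed (auto simp: M_def N_def)
  have "(\<integral>\<^sup>+ z. h z * \<phi> ((norm z)\<^sup>2) \<partial>lborel) = (\<integral>\<^sup>+ y. \<phi> (- y) \<partial>M)"
    unfolding M_def by (subst nn_integral_distr) (auto simp: nn_integral_density)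
  also have "\<dots> = (\<integral>\<^sup>+ t. g t * \<phi> t \<partial>lborel)"
    unfolding MN N_def by (subst nn_integral_distr) (auto simp: nn_integral_density)
  also have "\<dots> = (\<integral>\<^sup>+ t. A * (ennreal (real s * t ^ (s - 1)) * indicator {0..} t * \<phi> t) \<partial>lborel)"
    by (simp add: g_def mult.assoc)
  also have "\<dots> = A * (\<integral>\<^sup>+ t. ennreal (real s * t ^ (s - 1)) * indicator {0..} t * \<phi> t \<partial>lborel)"
    by (rule nn_integral_cmult) measurable
  finally show ?thesis .
qed

lemma nn_integral_power_exp:
  "(\<integral>\<^sup>+ t. ennreal (t ^ k * exp (- t)) * indicator {0..} t \<partial>lborel) = ennreal (fact k)"
proof -
  have "(\<integral>\<^sup>+ t. ennreal (t ^ k * exp (- t)) * indicator {0..} t \<partial>lborel)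
      = (\<integral>\<^sup>+ t. ennreal (t powr (real (Suc k) - 1) / exp t) * indicator {0..} t \<partial>lborel)"
    using AE_lborel_singleton[of 0]
    by (intro nn_integral_cong_AE)
       (auto simp: powr_realpow exp_minus divide_inverse elim!: eventually_mono split: split_indicator)
  also have "\<dots> = ennreal (Gamma (real (Suc k)))"
    by (intro nn_integral_has_integral_lebesgue' Gamma_integral_real) auto
  also have "Gamma (real (Suc k)) = fact k"
    using Gamma_fact[of k, where ?'a = real] by (simp add: add.commute)
  finally show ?thesis .
qed

lemma nn_integral_complex_gaussian_moment:
  "(\<integral>\<^sup>+ z. ennreal (((norm z)\<^sup>2) ^ k * exp (- (norm z)\<^sup>2)) \<partial>(lborel :: complex measure)) = ennreal (pi * fact k)"
proof -
  have A: "emeasure lborel (ball (0 :: complex) 1) = ennreal pi"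
    by (subst emeasure_ball) (auto simp: unit_ball_vol_2)
  have "(\<integral>\<^sup>+ z. 1 * ennreal (((norm z)\<^sup>2) ^ k * exp (- (norm z)\<^sup>2)) \<partial>(lborel :: complex measure))
      = ennreal pi * (\<integral>\<^sup>+ t. ennreal (real 1 * t ^ (1 - 1)) * indicator {0..} t * ennreal (t ^ k * exp (- t)) \<partial>lborel)"
    by (rule nn_integral_homogeneous_radial[where p = 0]) (auto simp: A)
  also have "\<dots> = ennreal pi * ennreal (fact k)"
    using nn_integral_power_exp[of k] by (simp add: mult.commute)
  finally show ?thesis by (simp add: ennreal_mult')
qed

lemma norm_mi_monom_square: "(norm (mi_monom z m))\<^sup>2 = (\<Prod>i\<in>UNIV. ((norm (z $ i))\<^sup>2) ^ m i)"
  by (simp add: norm_mi_monom prod_power_distrib power_mult[symmetric] mult.commute)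

lemma nn_integral_vec_gaussian_moment:
  fixes m :: "'n::finite midx"
  shows "(\<integral>\<^sup>+ z. ennreal ((norm (mi_monom z m))\<^sup>2) * ennreal (exp (- (norm z)\<^sup>2)) \<partial>(lborel :: (complex ^ 'n) measure))
     = ennreal (pi ^ CARD('n) * mi_fact m)"
proof -
  have "(\<integral>\<^sup>+ z. ennreal ((norm (mi_monom z m))\<^sup>2) * ennreal (exp (- (norm z)\<^sup>2)) \<partial>(lborel :: (complex ^ 'n) measure))
      = (\<integral>\<^sup>+ z. (\<Prod>i\<in>UNIV. ennreal (((norm (z $ i))\<^sup>2) ^ m i * exp (- (norm (z $ i))\<^sup>2))) \<partial>(lborel :: (complex ^ 'n) measure))"
  proof (intro nn_integral_cong)
    fix z :: "complex ^ 'n"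
    have "(norm (mi_monom z m))\<^sup>2 * exp (- (norm z)\<^sup>2)
        = (\<Prod>i\<in>UNIV. ((norm (z $ i))\<^sup>2) ^ m i * exp (- (norm (z $ i))\<^sup>2))"
      by (simp add: norm_mi_monom_square norm_vec_square exp_sum prod.distrib sum_negf[symmetric] del: sum_negf)
    then show "ennreal ((norm (mi_monom z m))\<^sup>2) * ennreal (exp (- (norm z)\<^sup>2))
        = (\<Prod>i\<in>UNIV. ennreal (((norm (z $ i))\<^sup>2) ^ m i * exp (- (norm (z $ i))\<^sup>2)))"
      by (subst prod_ennreal) (auto simp: ennreal_mult'[symmetric])
  qed
  also have "\<dots> = (\<Prod>i\<in>UNIV. \<integral>\<^sup>+ z. ennreal (((norm z)\<^sup>2) ^ m i * exp (- (norm z)\<^sup>2)) \<partial>(lborel :: complex measure))"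
    by (rule nn_integral_vec_prod) measurable
  also have "\<dots> = (\<Prod>i\<in>(UNIV :: 'n set). ennreal (pi * fact (m i)))"
    by (simp add: nn_integral_complex_gaussian_moment)
  also have "\<dots> = ennreal (\<Prod>i\<in>(UNIV :: 'n set). pi * fact (m i))"
    by (rule prod_ennreal) auto
  also have "(\<Prod>i\<in>(UNIV :: 'n set). pi * fact (m i)) = pi ^ CARD('n) * mi_fact m"
    by (simp add: prod.distrib mi_fact_def)
  finally show ?thesis .
qed

lemma mi_monom_square_homogeneous:
  fixes z :: "complex ^ 'n::finite"
  assumes "t > 0"
  shows "ennreal ((norm (mi_monom (t *\<^sub>R z) m))\<^sup>2) = ennreal (t ^ (2 * mi_size m)) * ennreal ((norm (mi_monom z m))\<^sup>2)"
proof -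
  have "t *\<^sub>R z = complex_of_real t *s z" by (simp add: vec_eq_iff scaleR_conv_of_real[where 'a=complex])
  then have "(norm (mi_monom (t *\<^sub>R z) m))\<^sup>2 = t ^ (2 * mi_size m) * (norm (mi_monom z m))\<^sup>2"
    using assms by (simp add: mi_monom_scale norm_mult norm_power power_mult_distrib power_mult[symmetric] mult.commute)
  then show ?thesis using assms by (simp add: ennreal_mult')
qed

text \<open>The value follows by evaluating the Gaussian integral of \<open>|z^m|^2\<close> in two ways: as a product over the
coordinates it is \<open>pi^n * m!\<close>, and radially it is the unknown integral times \<open>s!\<close> with \<open>s = n + |m|\<close>.\<close>

lemma nn_integral_mi_monom_ball:
  fixes m :: "'n::finite midx"
  shows "(\<integral>\<^sup>+ z. ennreal ((norm (mi_monom z m))\<^sup>2) * indicator (ball 0 1) z \<partial>lborel)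
    = ennreal (pi ^ CARD('n) * mi_fact m / fact (CARD('n) + mi_size m))"
proof -
  define A where "A = (\<integral>\<^sup>+ z. ennreal ((norm (mi_monom z m))\<^sup>2) * indicator (ball 0 1) z \<partial>lborel)"
  define s where "s = CARD('n) + mi_size m"
  have s: "s > 0" by (simp add: s_def)
  have "A \<le> (\<integral>\<^sup>+ z. indicator (ball 0 1 :: (complex ^ 'n) set) z \<partial>lborel)"
    unfolding A_def
  proof (intro nn_integral_mono)
    fix z :: "complex ^ 'n"
    have "(norm (mi_monom z m))\<^sup>2 \<le> 1" if "norm z < 1"
    proof -
      have "norm (mi_monom z m) \<le> norm z ^ mi_size m" by (rule norm_mi_monom_le)
      also have "\<dots> \<le> 1" using that by (intro power_le_one) auto
      finally show ?thesis by (simp add: power_le_one)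
    qed
    then show "ennreal ((norm (mi_monom z m))\<^sup>2) * indicator (ball 0 1) z \<le> indicator (ball 0 1) z"
      by (auto split: split_indicator)
  qed
  also have "\<dots> < \<infinity>" using emeasure_lborel_ball_finite[of "0 :: complex ^ 'n" 1] by simp
  finally have A: "A < \<infinity>" .
  have "ennreal (pi ^ CARD('n) * mi_fact m)
      = (\<integral>\<^sup>+ z. ennreal ((norm (mi_monom z m))\<^sup>2) * ennreal (exp (- (norm z)\<^sup>2)) \<partial>(lborel :: (complex ^ 'n) measure))"
    by (rule nn_integral_vec_gaussian_moment[symmetric])
  also have "\<dots> = A * (\<integral>\<^sup>+ t. ennreal (real s * t ^ (s - 1)) * indicator {0..} t * ennreal (exp (- t)) \<partial>lborel)"
    by (rule nn_integral_homogeneous_radial[where p = "2 * mi_size m", OF _ _ mi_monom_square_homogeneous _ s A_def A])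
       (auto simp: s_def)
  also have "(\<integral>\<^sup>+ t. ennreal (real s * t ^ (s - 1)) * indicator {0..} t * ennreal (exp (- t)) \<partial>lborel)
      = (\<integral>\<^sup>+ t. ennreal (real s) * (ennreal (t ^ (s - 1) * exp (- t)) * indicator {0..} t) \<partial>lborel)"
    by (intro nn_integral_cong) (auto simp: ennreal_mult' mult_ac split: split_indicator)
  also have "\<dots> = ennreal (real s) * (\<integral>\<^sup>+ t. ennreal (t ^ (s - 1) * exp (- t)) * indicator {0..} t \<partial>lborel)"
    by (rule nn_integral_cmult) measurable
  also have "\<dots> = ennreal (real s) * ennreal (fact (s - 1))"
    by (simp only: nn_integral_power_exp)
  also have "\<dots> = ennreal (fact s)"
    using s by (simp add: ennreal_mult'[symmetric] fact_reduce[of s])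
  finally have eq: "ennreal (pi ^ CARD('n) * mi_fact m) = A * ennreal (fact s)" .
  obtain a where a: "a \<ge> 0" "A = ennreal a" using A by (cases A) auto
  have "pi ^ CARD('n) * mi_fact m = a * fact s"
    using eq a by (simp add: a(2) ennreal_mult'[symmetric] ennreal_inj del: ennreal_mult')
  then have "a = pi ^ CARD('n) * mi_fact m / fact s" by simp
  then show ?thesis using a unfolding A_def[symmetric] s_def by simp
qed

text \<open>Radial integration reduces the weighted moment to a Beta integral.\<close>

lemma nn_integral_mi_monom_weighted:
  fixes m :: "'n::finite midx"
  assumes "\<beta> > -1"
  shows "(\<integral>\<^sup>+ z. ennreal ((norm (mi_monom z m))\<^sup>2) * (ennreal ((1 - (norm z)\<^sup>2) powr \<beta>) * indicator (ball 0 1) z) \<partial>lborel)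
    = ennreal (pi ^ CARD('n) * mi_fact m * Gamma (\<beta> + 1) / Gamma (real CARD('n) + real (mi_size m) + \<beta> + 1))"
proof -
  define s where "s = CARD('n) + mi_size m"
  have s: "s > 0" by (simp add: s_def)
  let ?\<phi> = "\<lambda>t :: real. ennreal ((1 - t) powr \<beta>) * indicator {..<1} t"
  have "(\<integral>\<^sup>+ z. ennreal ((norm (mi_monom z m))\<^sup>2) * (ennreal ((1 - (norm z)\<^sup>2) powr \<beta>) * indicator (ball 0 1) z) \<partial>lborel)
      = (\<integral>\<^sup>+ z. ennreal ((norm (mi_monom z m))\<^sup>2) * ?\<phi> ((norm z)\<^sup>2) \<partial>(lborel :: (complex ^ 'n) measure))"
    by (intro nn_integral_cong) (auto simp: power_less_one_iff abs_square_less_1 split: split_indicator)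
  also have "\<dots> = ennreal (pi ^ CARD('n) * mi_fact m / fact s)
      * (\<integral>\<^sup>+ t. ennreal (real s * t ^ (s - 1)) * indicator {0..} t * ?\<phi> t \<partial>lborel)"
    by (rule nn_integral_homogeneous_radial[where p = "2 * mi_size m", OF _ _ mi_monom_square_homogeneous _ s])
       (auto simp: s_def nn_integral_mi_monom_ball)
  also have "(\<integral>\<^sup>+ t. ennreal (real s * t ^ (s - 1)) * indicator {0..} t * ?\<phi> t \<partial>lborel)
      = (\<integral>\<^sup>+ t. ennreal (real s) * (ennreal (t powr (real s - 1) * (1 - t) powr (\<beta> + 1 - 1)) * indicator {0..1} t) \<partial>lborel)"
    using AE_lborel_singleton[of 0] AE_lborel_singleton[of 1] s
    by (intro nn_integral_cong_AE)
       (auto simp: powr_realpow[symmetric] of_nat_diff ennreal_mult' mult_ac elim!: eventually_elim2 split: split_indicator)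
  also have "\<dots> = ennreal (real s) * (\<integral>\<^sup>+ t. ennreal (t powr (real s - 1) * (1 - t) powr (\<beta> + 1 - 1)) * indicator {0..1} t \<partial>lborel)"
    by (rule nn_integral_cmult) measurable
  also have "(\<integral>\<^sup>+ t. ennreal (t powr (real s - 1) * (1 - t) powr (\<beta> + 1 - 1)) * indicator {0..1} t \<partial>lborel)
      = ennreal (Beta (real s) (\<beta> + 1))"
    by (rule nn_integral_has_integral_lebesgue'[OF _ has_integral_Beta_real]) (use assms s in auto)
  also have "ennreal (pi ^ CARD('n) * mi_fact m / fact s) * (ennreal (real s) * ennreal (Beta (real s) (\<beta> + 1)))
      = ennreal (pi ^ CARD('n) * mi_fact m / fact s * (real s * Beta (real s) (\<beta> + 1)))"
    by (simp add: ennreal_mult'[symmetric])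
  also have "pi ^ CARD('n) * mi_fact m / fact s * (real s * Beta (real s) (\<beta> + 1))
      = pi ^ CARD('n) * mi_fact m * Gamma (\<beta> + 1) / Gamma (real CARD('n) + real (mi_size m) + \<beta> + 1)"
  proof -
    have "Gamma (real s) = fact (s - 1)" using Gamma_fact[of "s - 1", where ?'a = real] s by (simp add: of_nat_diff)
    moreover have "fact s = real s * fact (s - 1)" using s by (simp add: fact_reduce[of s])
    moreover have "real s + (\<beta> + 1) = real CARD('n) + real (mi_size m) + \<beta> + 1"
      by (simp add: s_def)
    ultimately show ?thesis using s by (simp add: Beta_def add.assoc[symmetric])
  qed
  finally show ?thesis .
qed

section \<open>Square integrals of homogeneous expansions\<close>

lemma sum_mi_size_less:
  fixes g :: "'n::finite midx \<Rightarrow> 'b::comm_monoid_add"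
  shows "(\<Sum>m | mi_size m < K. g m) = (\<Sum>k<K. \<Sum>m | mi_size m = k. g m)"
proof -
  have "(\<Sum>m | mi_size m < K. g m) = (\<Sum>k<K. \<Sum>m | m \<in> {m. mi_size m < K} \<and> mi_size m = k. g m)"
    by (rule sum.group[symmetric]) (auto intro: finite_subset[OF _ finite_mi_size_le[of K]])
  also have "\<dots> = (\<Sum>k<K. \<Sum>m | mi_size m = k. g m)"
    by (intro sum.cong refl) auto
  finally show ?thesis .
qed

lemma sum_hpart_eq: "(\<Sum>k<K. hpart b k z) = (\<Sum>m | mi_size m < K. b m * mi_monom z m)"
  by (simp add: sum_mi_size_less hpart_def)

lemma norm_torus_rotation:
  fixes z :: "complex ^ 'n::finite"
  assumes "\<And>i. norm (c i) = 1"
  shows "norm (\<chi> i. c i * z $ i) = norm z"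
proof -
  have "(norm (\<chi> i. c i * z $ i))\<^sup>2 = (norm z)\<^sup>2"
    using assms by (simp add: norm_vec_square norm_mult)
  then show ?thesis by (simp add: power2_eq_iff_nonneg)
qed

text \<open>Weights on the ball for which Parseval's identity is available. Besides the powers of \<open>1 - |z|^2\<close> the proof uses
their restrictions to smaller balls, on which homogeneous expansions converge uniformly.\<close>

locale torus_weight =
  fixes w :: "complex ^ 'n::finite \<Rightarrow> real"
  assumes w_integrable: "integrable lborel w"
    and w_nonneg: "w z \<ge> 0"
    and w_support: "z \<notin> ball 0 1 \<Longrightarrow> w z = 0"
    and w_invariant: "(\<And>i. norm (c i) = 1) \<Longrightarrow> w (\<chi> i. c i * z $ i) = w z"
begin

definition moment :: "'n midx \<Rightarrow> real" where
  "moment m = (\<integral>z. w z * (norm (mi_monom z m))\<^sup>2 \<partial>lborel)"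

lemma w_measurable [measurable]: "w \<in> borel_measurable borel"
  using borel_measurable_integrable[OF w_integrable] by simp

lemma integrable_bounded_times:
  fixes f :: "complex ^ 'n \<Rightarrow> 'b::{banach, second_countable_topology}"
  assumes [measurable]: "f \<in> borel_measurable borel" and bd: "\<And>z. z \<in> ball 0 1 \<Longrightarrow> norm (f z) \<le> C"
  shows "integrable lborel (\<lambda>z. w z *\<^sub>R f z)"
proof (rule Bochner_Integration.integrable_bound[OF integrable_mult_left[OF w_integrable, of C]])
  show "AE z in lborel. norm (w z *\<^sub>R f z) \<le> norm (w z * C)"
  proof (intro AE_I2)
    fix z
    show "norm (w z *\<^sub>R f z) \<le> norm (w z * C)"
    proof (cases "z \<in> ball 0 1")
      case True
      then have "norm (f z) \<le> \<bar>C\<bar>" using bd by fastforce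
      then show ?thesis by (simp add: abs_mult mult_left_mono)
    qed (simp add: w_support)
  qed
qed measurable

lemma norm_mi_monom_le_1: "z \<in> ball 0 1 \<Longrightarrow> norm (mi_monom z m) \<le> 1"
  by (rule order_trans[OF norm_mi_monom_le]) (simp add: power_le_one)

lemma integrable_monomials: "integrable lborel (\<lambda>z. w z *\<^sub>R (mi_monom z m * cnj (mi_monom z m')))"
  by (rule integrable_bounded_times[where C = 1])
     (auto simp: norm_mult intro!: mult_le_one norm_mi_monom_le_1)

lemma moment_nonneg: "moment m \<ge> 0"
  unfolding moment_def by (intro integral_nonneg_AE) (auto simp: w_nonneg)

lemma parseval_polynomial:
  "integrable lborel (\<lambda>z. w z * (norm (\<Sum>k<K. hpart b k z))\<^sup>2)" (is ?int)
  "(\<integral>z. w z * (norm (\<Sum>k<K. hpart b k z))\<^sup>2 \<partial>lborel) = (\<Sum>k<K. \<Sum>m | mi_size m = k. (norm (b m))\<^sup>2 * moment m)" (is ?eq)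
proof -
  define F where "F = {m :: 'n midx. mi_size m < K}"
  define G where "G m m' z = w z *\<^sub>R (mi_monom z m * cnj (mi_monom z m'))" for m m' z
  have expand: "complex_of_real (w z * (norm (\<Sum>k<K. hpart b k z))\<^sup>2)
      = (\<Sum>m\<in>F. \<Sum>m'\<in>F. (b m * cnj (b m')) * G m m' z)" for z
  proof -
    have "complex_of_real ((norm (\<Sum>k<K. hpart b k z))\<^sup>2)
        = (\<Sum>m\<in>F. b m * mi_monom z m) * (\<Sum>m\<in>F. cnj (b m) * cnj (mi_monom z m))"
      unfolding sum_hpart_eq F_def complex_norm_square by simp
    also have "\<dots> = (\<Sum>m\<in>F. \<Sum>m'\<in>F. (b m * mi_monom z m) * (cnj (b m') * cnj (mi_monom z m')))"
      by (rule sum_product)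
    finally show ?thesis
      by (simp add: G_def scaleR_conv_of_real sum_distrib_left mult_ac)
  qed
  have Gint: "integrable lborel (G m m')" for m m'
    unfolding G_def by (rule integrable_monomials)
  have cint: "integrable lborel (\<lambda>z. complex_of_real (w z * (norm (\<Sum>k<K. hpart b k z))\<^sup>2))"
    unfolding expand by (intro Bochner_Integration.integrable_sum integrable_mult_right Gint)
  then show ?int by (rule complex_of_real_integrable_eq[THEN iffD1])
  have Gval: "(\<integral>z. G m m' z \<partial>lborel) = (if m' = m then of_real (moment m) else 0)" for m m'
  proof (cases "m' = m")
    case True
    have "(\<integral>z. G m m z \<partial>lborel) = (\<integral>z. complex_of_real (w z * (norm (mi_monom z m))\<^sup>2) \<partial>lborel)"
      unfolding G_def of_real_mult complex_norm_square scaleR_conv_of_real ..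
    then show ?thesis by (simp only: True if_True moment_def integral_complex_of_real simp_thms)
  next
    case False
    then show ?thesis unfolding G_def using monomials_orthogonal[OF w_measurable w_invariant, of m m'] by auto
  qed
  have "complex_of_real (\<integral>z. w z * (norm (\<Sum>k<K. hpart b k z))\<^sup>2 \<partial>lborel)
      = (\<integral>z. (\<Sum>m\<in>F. \<Sum>m'\<in>F. (b m * cnj (b m')) * G m m' z) \<partial>lborel)"
    unfolding expand[symmetric] by (rule integral_complex_of_real[symmetric])
  also have "\<dots> = (\<Sum>m\<in>F. \<Sum>m'\<in>F. (b m * cnj (b m')) * (\<integral>z. G m m' z \<partial>lborel))"
    by (simp add: Bochner_Integration.integral_sum Gint)
  also have "\<dots> = (\<Sum>m\<in>F. b m * cnj (b m) * of_real (moment m))"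
  proof (intro sum.cong refl)
    fix m assume "m \<in> F"
    have "finite F" unfolding F_def by (auto intro: finite_subset[OF _ finite_mi_size_le[of K]])
    then show "(\<Sum>m'\<in>F. (b m * cnj (b m')) * (\<integral>z. G m m' z \<partial>lborel)) = b m * cnj (b m) * of_real (moment m)"
      using \<open>m \<in> F\<close> by (simp add: Gval if_distrib[of "(*) _"] sum.delta cong: if_cong)
  qed
  also have "\<dots> = complex_of_real (\<Sum>m\<in>F. (norm (b m))\<^sup>2 * moment m)"
    unfolding of_real_sum of_real_mult complex_norm_square ..
  finally show ?eq
    unfolding of_real_eq_iff F_def sum_mi_size_less .
qed

end

lemma measurable_hseries_ball:
  assumes "locally_bounded_parts b"
  shows "(\<lambda>z. indicator (ball 0 1) z *\<^sub>R hseries b z) \<in> borel_measurable borel"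
  by (intro borel_measurable_continuous_on_indicator holomorphic_vec_on_continuous holomorphic_hseries assms) auto

context torus_weight
begin

lemma measurable_weighted_hseries:
  assumes "locally_bounded_parts b"
  shows "(\<lambda>z. w z * (norm (hseries b z))\<^sup>2) \<in> borel_measurable borel"
proof -
  note [measurable] = measurable_hseries_ball[OF assms]
  have eq: "(\<lambda>z. w z * (norm (hseries b z))\<^sup>2) = (\<lambda>z. w z * (norm (indicator (ball 0 1) z *\<^sub>R hseries b z))\<^sup>2)"
  proof
    show "w z * (norm (hseries b z))\<^sup>2 = w z * (norm (indicator (ball 0 1) z *\<^sub>R hseries b z))\<^sup>2" for z
      using w_support[of z] by (cases "z \<in> ball 0 1") auto
  qed
  show ?thesis unfolding eq by measurable
qed

text \<open>Fatou's lemma, applied to the partial sums, whose square integrals are known exactly.\<close>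

lemma integrable_hseries_of_bounded_sums:
  assumes b: "locally_bounded_parts b"
    and C: "\<And>K. (\<Sum>k<K. \<Sum>m | mi_size m = k. (norm (b m))\<^sup>2 * moment m) \<le> C"
  shows "integrable lborel (\<lambda>z. w z * (norm (hseries b z))\<^sup>2)"
proof (rule integrableI_nonneg)
  show "(\<lambda>z. w z * (norm (hseries b z))\<^sup>2) \<in> borel_measurable lborel"
    using measurable_weighted_hseries[OF b] by simp
  show "AE z in lborel. 0 \<le> w z * (norm (hseries b z))\<^sup>2" by (simp add: w_nonneg)
  let ?P = "\<lambda>K z. w z * (norm (\<Sum>k<K. hpart b k z))\<^sup>2"
  have "(\<integral>\<^sup>+ z. ennreal (w z * (norm (hseries b z))\<^sup>2) \<partial>lborel)
      = (\<integral>\<^sup>+ z. liminf (\<lambda>K. ennreal (?P K z)) \<partial>lborel)"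
  proof (intro nn_integral_cong)
    fix z
    have "(\<lambda>K. ?P K z) \<longlonglongrightarrow> w z * (norm (hseries b z))\<^sup>2"
    proof (cases "z \<in> ball 0 1")
      case True
      then show ?thesis using hseries_sums[OF b True] unfolding sums_def by (intro tendsto_intros)
    qed (simp add: w_support)
    then have "(\<lambda>K. ennreal (?P K z)) \<longlonglongrightarrow> ennreal (w z * (norm (hseries b z))\<^sup>2)"
      by (rule tendsto_ennrealI)
    then show "ennreal (w z * (norm (hseries b z))\<^sup>2) = liminf (\<lambda>K. ennreal (?P K z))"
      by (simp add: lim_imp_Liminf)
  qed
  also have "\<dots> \<le> liminf (\<lambda>K. \<integral>\<^sup>+ z. ennreal (?P K z) \<partial>lborel)"
    by (rule nn_integral_liminf) (use parseval_polynomial(1) in \<open>auto intro: borel_measurable_integrable\<close>)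
  also have "\<dots> \<le> liminf (\<lambda>K :: nat. ennreal C)"
  proof (intro Liminf_mono always_eventually allI)
    fix K
    have "(\<integral>\<^sup>+ z. ennreal (?P K z) \<partial>lborel) = ennreal (\<integral>z. ?P K z \<partial>lborel)"
      by (rule nn_integral_eq_integral[OF parseval_polynomial(1)]) (simp add: w_nonneg)
    then show "(\<integral>\<^sup>+ z. ennreal (?P K z) \<partial>lborel) \<le> ennreal C"
      using C[of K] by (simp add: parseval_polynomial(2) ennreal_leI)
  qed
  also have "\<dots> < \<infinity>" by (simp add: Liminf_const)
  finally show "(\<integral>\<^sup>+ z. ennreal (w z * (norm (hseries b z))\<^sup>2) \<partial>lborel) < \<infinity>" .
qed

end

lemma torus_weight_restrict:
  assumes "torus_weight w"
  shows "torus_weight (\<lambda>z. w z * indicator (ball 0 r) z)"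
proof -
  interpret torus_weight w by fact
  show ?thesis
  proof
    show "integrable lborel (\<lambda>z. w z * indicator (ball 0 r) z)"
    proof -
      have "integrable lborel (\<lambda>z. w z *\<^sub>R indicat_real (ball 0 r) z)"
        by (rule integrable_bounded_times[where C = 1])
           (auto intro!: borel_measurable_indicator split: split_indicator)
      then show ?thesis by simp
    qed
    show "w (\<chi> i. c i * z $ i) * indicator (ball 0 r) (\<chi> i. c i * z $ i) = w z * indicator (ball 0 r) z"
      if "\<And>i. norm (c i) = 1" for c z
      by (simp add: indicator_def w_invariant[OF that] norm_torus_rotation[OF that])
  qed (auto simp: w_nonneg w_support)
qed

text \<open>Inside a smaller ball the partial sums converge uniformly, and their square integrals increase by
orthogonality. So each of them is at most the square integral of the limit.\<close>

lemma bessel_inside: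
  assumes "torus_weight w" and b: "locally_bounded_parts b" and r: "0 < r" "r < 1"
  shows "integrable lborel (\<lambda>z. w z * indicator (ball 0 r) z * (norm (hseries b z))\<^sup>2)"
    and "(\<integral>z. w z * indicator (ball 0 r) z * (norm (\<Sum>k<K. hpart b k z))\<^sup>2 \<partial>lborel)
      \<le> (\<integral>z. w z * indicator (ball 0 r) z * (norm (hseries b z))\<^sup>2 \<partial>lborel)"
proof -
  interpret torus_weight "\<lambda>z. w z * indicator (ball 0 r) z" by (rule torus_weight_restrict) fact
  let ?v = "\<lambda>z. w z * indicator (ball 0 r) z"
  let ?P = "\<lambda>K z. ?v z * (norm (\<Sum>k<K. hpart b k z))\<^sup>2"
  obtain C q where C: "C \<ge> 0" "0 < q" "q < 1" "\<And>k z. norm z \<le> r \<Longrightarrow> norm (hpart b k z) \<le> C * q ^ k"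
    using hpart_geometric_bound[OF b r] by blast
  have partial: "norm (\<Sum>k<K. hpart b k z) \<le> C / (1 - q)" if "norm z \<le> r" for K z
  proof -
    have "norm (\<Sum>k<K. hpart b k z) \<le> (\<Sum>k<K. C * q ^ k)"
      by (rule order_trans[OF norm_sum]) (intro sum_mono C that)
    also have "\<dots> = C * (\<Sum>k<K. q ^ k)" by (simp add: sum_distrib_left)
    also have "\<dots> \<le> C * (\<Sum>k. q ^ k)"
      using C by (intro mult_left_mono sum_le_suminf summable_geometric) auto
    also have "\<dots> = C / (1 - q)" using C by (simp add: suminf_geometric)
    finally show ?thesis .
  qed
  let ?D = "\<lambda>z. (C / (1 - q))\<^sup>2 * ?v z"
  have Dint: "integrable lborel ?D" by (intro integrable_mult_right w_integrable)
  have meas: "(\<lambda>z. ?v z * (norm (hseries b z))\<^sup>2) \<in> borel_measurable lborel"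
    using measurable_weighted_hseries[OF b] by simp
  have Pmeas: "?P K \<in> borel_measurable lborel" for K
    by (rule borel_measurable_integrable[OF parseval_polynomial(1)])
  have lim: "AE z in lborel. (\<lambda>K. ?P K z) \<longlonglongrightarrow> ?v z * (norm (hseries b z))\<^sup>2"
  proof (intro AE_I2)
    fix z
    show "(\<lambda>K. ?P K z) \<longlonglongrightarrow> ?v z * (norm (hseries b z))\<^sup>2"
    proof (cases "z \<in> ball 0 1")
      case True
      then show ?thesis using hseries_sums[OF b True] unfolding sums_def by (intro tendsto_intros)
    next
      case False
      then have "?v z = 0" by (rule w_support)
      then show ?thesis by (simp only: mult_zero_left tendsto_const)
    qed
  qed
  have dom: "AE z in lborel. norm (?P K z) \<le> ?D z" for K
  proof (intro AE_I2)
    fix z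
    show "norm (?P K z) \<le> ?D z"
    proof (cases "z \<in> ball 0 r")
      case True
      then have "(norm (\<Sum>k<K. hpart b k z))\<^sup>2 \<le> (C / (1 - q))\<^sup>2"
        by (intro power_mono partial) auto
      then have "?v z * (norm (\<Sum>k<K. hpart b k z))\<^sup>2 \<le> ?D z"
        using w_nonneg[of z] by (simp add: mult.commute mult_left_mono)
      moreover have "0 \<le> w z" by (rule torus_weight.w_nonneg[OF assms(1)])
      ultimately show ?thesis by (simp add: abs_mult)
    qed simp
  qed
  show "integrable lborel (\<lambda>z. ?v z * (norm (hseries b z))\<^sup>2)"
    by (rule integrable_dominated_convergence[OF meas Pmeas Dint lim dom])
  have conv: "(\<lambda>K. \<integral>z. ?P K z \<partial>lborel) \<longlonglongrightarrow> (\<integral>z. ?v z * (norm (hseries b z))\<^sup>2 \<partial>lborel)"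
    by (rule integral_dominated_convergence[OF meas Pmeas Dint lim dom])
  have "incseq (\<lambda>K. \<integral>z. ?P K z \<partial>lborel)"
    unfolding parseval_polynomial(2) by (intro incseq_SucI) (auto intro!: sum_nonneg mult_nonneg_nonneg moment_nonneg)
  then show "(\<integral>z. ?P K z \<partial>lborel) \<le> (\<integral>z. ?v z * (norm (hseries b z))\<^sup>2 \<partial>lborel)"
    by (rule incseq_le[OF _ conv])
qed

context torus_weight
begin

text \<open>Bessel's inequality on the whole ball, by exhausting it with the balls of radius \<open>1 - 1 / (j + 2)\<close>.\<close>

lemma bessel:
  assumes b: "locally_bounded_parts b"
    and int: "integrable lborel (\<lambda>z. w z * (norm (hseries b z))\<^sup>2)"
  shows "(\<Sum>k<K. \<Sum>m | mi_size m = k. (norm (b m))\<^sup>2 * moment m) \<le> (\<integral>z. w z * (norm (hseries b z))\<^sup>2 \<partial>lborel)"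
proof -
  have tw: "torus_weight w" by unfold_locales
  define r where "r j = 1 - 1 / (real j + 2)" for j
  have r: "0 < r j" "r j < 1" for j by (auto simp: r_def field_simps)
  let ?P = "\<lambda>z. w z * (norm (\<Sum>k<K. hpart b k z))\<^sup>2"
  let ?v = "\<lambda>j z. w z * indicator (ball 0 (r j)) z"
  have le: "(\<integral>z. ?v j z * (norm (\<Sum>k<K. hpart b k z))\<^sup>2 \<partial>lborel) \<le> (\<integral>z. w z * (norm (hseries b z))\<^sup>2 \<partial>lborel)" for j
  proof -
    have "(\<integral>z. ?v j z * (norm (hseries b z))\<^sup>2 \<partial>lborel) \<le> (\<integral>z. w z * (norm (hseries b z))\<^sup>2 \<partial>lborel)"
      by (intro integral_mono bessel_inside(1)[OF tw b r] int) (auto simp: w_nonneg split: split_indicator)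
    then show ?thesis using bessel_inside(2)[OF tw b r, of j K] by linarith
  qed
  have "(\<lambda>j. \<integral>z. ?v j z * (norm (\<Sum>k<K. hpart b k z))\<^sup>2 \<partial>lborel) \<longlonglongrightarrow> (\<integral>z. ?P z \<partial>lborel)"
  proof (rule integral_dominated_convergence)
    have Pm [measurable]: "?P \<in> borel_measurable borel"
      using borel_measurable_integrable[OF parseval_polynomial(1)[of b K]] by simp
    show "?P \<in> borel_measurable lborel" by measurable
    have [measurable]: "ball (0 :: complex ^ 'n) t \<in> sets borel" for t by simp
    have "(\<lambda>z. ?v j z * (norm (\<Sum>k<K. hpart b k z))\<^sup>2) = (\<lambda>z. ?P z * indicator (ball 0 (r j)) z)" for j
      by (auto simp: mult_ac)
    then show "(\<lambda>z. ?v j z * (norm (\<Sum>k<K. hpart b k z))\<^sup>2) \<in> borel_measurable lborel" for j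
      by simp
    show "integrable lborel ?P" by (rule parseval_polynomial(1))
    show "AE z in lborel. norm (?v j z * (norm (\<Sum>k<K. hpart b k z))\<^sup>2) \<le> ?P z" for j
      by (auto simp: w_nonneg split: split_indicator)
    show "AE z in lborel. (\<lambda>j. ?v j z * (norm (\<Sum>k<K. hpart b k z))\<^sup>2) \<longlonglongrightarrow> ?P z"
    proof (intro AE_I2)
      fix z
      show "(\<lambda>j. ?v j z * (norm (\<Sum>k<K. hpart b k z))\<^sup>2) \<longlonglongrightarrow> ?P z"
      proof (cases "z \<in> ball 0 1")
        case True
        have "r \<longlonglongrightarrow> 1 - 0"
          unfolding r_def using LIMSEQ_ignore_initial_segment[OF lim_1_over_n[where 'a = real], of 2]
          by (intro tendsto_intros) (simp add: add.commute)
        then have "eventually (\<lambda>j. norm z < r j) sequentially"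
          using True by (intro order_tendstoD) auto
        then have "eventually (\<lambda>j. ?v j z * (norm (\<Sum>k<K. hpart b k z))\<^sup>2 = ?P z) sequentially"
          by eventually_elim simp
        then show ?thesis by (rule tendsto_eventually)
      qed (simp add: w_support)
    qed
  qed
  then have "(\<integral>z. ?P z \<partial>lborel) \<le> (\<integral>z. w z * (norm (hseries b z))\<^sup>2 \<partial>lborel)"
    by (rule LIMSEQ_le_const2) (use le in auto)
  then show ?thesis by (simp add: parseval_polynomial(2))
qed

theorem integrable_hseries_iff:
  assumes b: "locally_bounded_parts b"
  shows "integrable lborel (\<lambda>z. w z * (norm (hseries b z))\<^sup>2)
    \<longleftrightarrow> summable (\<lambda>k. \<Sum>m | mi_size m = k. (norm (b m))\<^sup>2 * moment m)"
proof
  have nonneg: "0 \<le> (\<Sum>m | mi_size m = k. (norm (b m))\<^sup>2 * moment m)" for k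
    by (auto intro!: sum_nonneg mult_nonneg_nonneg moment_nonneg)
  show "summable (\<lambda>k. \<Sum>m | mi_size m = k. (norm (b m))\<^sup>2 * moment m)"
    if "integrable lborel (\<lambda>z. w z * (norm (hseries b z))\<^sup>2)"
    by (rule summableI_nonneg_bounded[OF nonneg bessel[OF b that]])
  show "integrable lborel (\<lambda>z. w z * (norm (hseries b z))\<^sup>2)"
    if "summable (\<lambda>k. \<Sum>m | mi_size m = k. (norm (b m))\<^sup>2 * moment m)"
    by (rule integrable_hseries_of_bounded_sums[OF b])
       (use that nonneg in \<open>auto intro!: sum_le_suminf\<close>)
qed

end

definition ball_weight :: "real \<Rightarrow> complex ^ 'n::finite \<Rightarrow> real" where
  "ball_weight \<beta> z = (1 - (norm z)\<^sup>2) powr \<beta> * indicator (ball 0 1) z"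

lemma measurable_ball_weight [measurable]: "ball_weight \<beta> \<in> borel_measurable borel"
proof -
  have [measurable]: "ball (0 :: complex ^ 'n) t \<in> sets borel" for t by simp
  show ?thesis unfolding ball_weight_def[abs_def] by measurable
qed

lemma nn_integral_ball_weight_monom:
  fixes m :: "'n::finite midx"
  assumes "\<beta> > -1"
  shows "(\<integral>\<^sup>+ z. ennreal (ball_weight \<beta> z * (norm (mi_monom z m))\<^sup>2) \<partial>lborel)
    = ennreal (pi ^ CARD('n) * mi_fact m * Gamma (\<beta> + 1) / Gamma (real CARD('n) + real (mi_size m) + \<beta> + 1))"
  unfolding nn_integral_mi_monom_weighted[OF assms, symmetric]
  by (intro nn_integral_cong) (auto simp: ball_weight_def ennreal_mult'[symmetric] mult_ac split: split_indicator)

lemma torus_weight_ball_weight: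
  assumes "\<beta> > -1"
  shows "torus_weight (ball_weight \<beta> :: complex ^ 'n::finite \<Rightarrow> real)"
proof
  show "integrable lborel (ball_weight \<beta> :: complex ^ 'n \<Rightarrow> real)"
  proof (rule integrableI_nonneg)
    show "(\<integral>\<^sup>+ z. ennreal (ball_weight \<beta> z) \<partial>(lborel :: (complex ^ 'n) measure)) < \<infinity>"
      using nn_integral_ball_weight_monom[OF assms, of "\<lambda>_ :: 'n. 0"] by (simp add: mi_monom_def)
  qed (auto simp: ball_weight_def)
  show "ball_weight \<beta> (\<chi> i. c i * z $ i) = ball_weight \<beta> z" if "\<And>i. norm (c i) = 1" for c and z :: "complex ^ 'n"
    by (simp add: ball_weight_def indicator_def norm_torus_rotation[OF that])
qed (auto simp: ball_weight_def)

definition ball_moment :: "real \<Rightarrow> 'n::finite midx \<Rightarrow> real" where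
  "ball_moment \<beta> m = pi ^ CARD('n) * mi_fact m * Gamma (\<beta> + 1) / Gamma (real CARD('n) + real (mi_size m) + \<beta> + 1)"

lemma ball_moment_pos: "\<beta> > -1 \<Longrightarrow> ball_moment \<beta> m > 0"
  unfolding ball_moment_def by (intro divide_pos_pos mult_pos_pos Gamma_real_pos) auto

lemma moment_ball_weight:
  assumes "\<beta> > -1"
  shows "torus_weight.moment (ball_weight \<beta>) m = ball_moment \<beta> m"
proof -
  interpret torus_weight "ball_weight \<beta> :: complex ^ 'a \<Rightarrow> real" by (rule torus_weight_ball_weight) fact
  have "(\<integral>\<^sup>+ z. ennreal (ball_weight \<beta> z * (norm (mi_monom z m))\<^sup>2) \<partial>lborel) = ennreal (ball_moment \<beta> m)"
    using nn_integral_ball_weight_monom[OF assms, of m] by (simp add: ball_moment_def)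
  then show ?thesis
    unfolding moment_def using ball_moment_pos[OF assms, of m]
    by (subst integral_eq_nn_integral) (auto simp: w_nonneg)
qed

text \<open>Bessel's inequality for the constant weight gives uniqueness of the coefficients, because all moments are
positive.\<close>

lemma hseries_coeffs_unique:
  assumes b: "locally_bounded_parts b" and zero: "\<And>z. z \<in> ball 0 1 \<Longrightarrow> hseries b z = 0"
  shows "b m = (0 :: complex)"
proof -
  interpret torus_weight "ball_weight 0 :: complex ^ 'a \<Rightarrow> real" by (rule torus_weight_ball_weight) simp
  have eq0: "(\<lambda>z. ball_weight 0 z * (norm (hseries b z))\<^sup>2) = (\<lambda>z. 0)"
  proof
    show "ball_weight 0 z * (norm (hseries b z))\<^sup>2 = 0" for z
      using zero[of z] by (cases "z \<in> ball 0 1") (auto simp: ball_weight_def)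
  qed
  define g where "g k = (\<Sum>m | mi_size m = k. (norm (b m))\<^sup>2 * moment m)" for k
  have "(\<Sum>k<Suc (mi_size m). g k) \<le> 0"
    using bessel[OF b, of "Suc (mi_size m)"] unfolding eq0 g_def by simp
  moreover have "0 \<le> (\<Sum>k<mi_size m. g k)"
    unfolding g_def by (auto intro!: sum_nonneg mult_nonneg_nonneg moment_nonneg)
  ultimately have "g (mi_size m) \<le> 0" by simp
  moreover have "(norm (b m))\<^sup>2 * moment m \<le> g (mi_size m)"
    unfolding g_def by (rule member_le_sum) (auto intro!: mult_nonneg_nonneg moment_nonneg)
  ultimately have "(norm (b m))\<^sup>2 * moment m \<le> 0" by linarith
  then show ?thesis
    using ball_moment_pos[of 0 m] unfolding moment_ball_weight[of 0 m, simplified]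
    by (simp add: mult_le_0_iff)
qed

section \<open>Hilbert spaces of power series with weighted coefficients\<close>

lemma hpart_add: "hpart (\<lambda>m. a m + b m) k z = hpart a k z + hpart b k z"
  by (simp add: hpart_def sum.distrib distrib_right)

lemma hpart_scale_coeff: "hpart (\<lambda>m. x * a m) k z = x * hpart a k z"
  by (simp add: hpart_def sum_distrib_left mult.assoc)

lemma locally_bounded_parts_diff:
  assumes "locally_bounded_parts a" "locally_bounded_parts b"
  shows "locally_bounded_parts (\<lambda>m. a m - b m)"
  unfolding locally_bounded_parts_def
proof (intro allI impI)
  fix r :: real assume r: "0 < r \<and> r < 1"
  obtain C where C: "\<And>k z. norm z \<le> r \<Longrightarrow> norm (hpart a k z) \<le> C"
    using assms(1) r unfolding locally_bounded_parts_def by blast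
  obtain D where D: "\<And>k z. norm z \<le> r \<Longrightarrow> norm (hpart b k z) \<le> D"
    using assms(2) r unfolding locally_bounded_parts_def by blast
  have "hpart (\<lambda>m. a m - b m) k z = hpart a k z - hpart b k z" for k z
    by (simp add: hpart_def sum_subtractf left_diff_distrib)
  moreover have "norm (hpart a k z - hpart b k z) \<le> C + D" if "norm z \<le> r" for k z
    using norm_triangle_ineq4[of "hpart a k z" "hpart b k z"] C[OF that, of k] D[OF that, of k] by linarith
  ultimately show "\<exists>C. \<forall>k z. norm z \<le> r \<longrightarrow> norm (hpart (\<lambda>m. a m - b m) k z) \<le> C"
    by (intro exI[of _ "C + D"]) auto
qed

lemma hseries_add:
  assumes "locally_bounded_parts a" "locally_bounded_parts b" "z \<in> ball 0 1"
  shows "hseries (\<lambda>m. a m + b m) z = hseries a z + hseries b z"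
  unfolding hseries_def hpart_add
  using suminf_add[OF sums_summable[OF hseries_sums[OF assms(1,3)]] sums_summable[OF hseries_sums[OF assms(2,3)]]] ..

lemma hseries_scale_coeff:
  assumes "locally_bounded_parts a" "z \<in> ball 0 1"
  shows "hseries (\<lambda>m. x * a m) z = x * hseries a z"
  unfolding hseries_def hpart_scale_coeff
  by (rule suminf_mult[OF sums_summable[OF hseries_sums[OF assms]]])

lemma hseries_eq_imp_coeffs_eq:
  assumes a: "locally_bounded_parts a" and b: "locally_bounded_parts b"
    and eq: "\<And>z. z \<in> ball 0 1 \<Longrightarrow> hseries a z = hseries b z"
  shows "a = b"
proof
  fix m
  have d: "locally_bounded_parts (\<lambda>m. a m - b m)" by (rule locally_bounded_parts_diff[OF a b])
  have "hseries (\<lambda>m. a m - b m) z = 0" if z: "z \<in> ball 0 1" for z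
    using hseries_add[OF d b z] eq[OF z] by simp
  from hseries_coeffs_unique[OF d this, of m] show "a m = b m" by simp
qed

definition ball_function :: "('n::finite midx \<Rightarrow> complex) \<Rightarrow> complex ^ 'n \<Rightarrow> complex" where
  "ball_function a z = (if z \<in> ball 0 1 then hseries a z else 0)"

text \<open>The second assumption makes the diagonal \<open>\<Sum>m. c\<^sub>m * |z^m|^2\<close> of the kernel converge locally uniformly: being
homogeneous of degree \<open>2k\<close>, its \<open>k\<close>-th term decays geometrically once it is bounded on a larger ball.\<close>

locale coefficient_weight =
  fixes c :: "'n::finite midx \<Rightarrow> real"
  assumes c_pos: "c m > 0"
    and diagonal_bounded: "r < 1 \<Longrightarrow>
      \<exists>C. \<forall>k z. norm z \<le> r \<longrightarrow> (\<Sum>m | mi_size m = k. c m * (norm (mi_monom z m))\<^sup>2) \<le> C"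
begin

definition level :: "('n midx \<Rightarrow> complex) \<Rightarrow> nat \<Rightarrow> real" where
  "level a k = (\<Sum>m | mi_size m = k. (norm (a m))\<^sup>2 / c m)"

definition coeff_space :: "('n midx \<Rightarrow> complex) set" where
  "coeff_space = {a. summable (level a)}"

definition level_inner :: "('n midx \<Rightarrow> complex) \<Rightarrow> ('n midx \<Rightarrow> complex) \<Rightarrow> nat \<Rightarrow> complex" where
  "level_inner a b k = (\<Sum>m | mi_size m = k. a m * cnj (b m) / of_real (c m))"

definition function_space_of :: "(complex ^ 'n \<Rightarrow> complex) set" where
  "function_space_of = ball_function ` coeff_space"

definition coeffs :: "(complex ^ 'n \<Rightarrow> complex) \<Rightarrow> 'n midx \<Rightarrow> complex" where
  "coeffs = inv_into coeff_space ball_function"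

definition inner_function :: "(complex ^ 'n \<Rightarrow> complex) \<Rightarrow> (complex ^ 'n \<Rightarrow> complex) \<Rightarrow> complex" where
  "inner_function f g = (\<Sum>k. level_inner (coeffs f) (coeffs g) k)"

lemma level_nonneg: "level a k \<ge> 0"
  unfolding level_def using c_pos by (auto intro!: sum_nonneg divide_nonneg_pos)

lemma norm_square_le_level: "(norm (a m))\<^sup>2 / c m \<le> level a (mi_size m)"
  unfolding level_def using c_pos by (intro member_le_sum) (auto intro!: divide_nonneg_pos)

lemma level_add_le: "level (\<lambda>m. a m + b m) k \<le> 2 * level a k + 2 * level b k"
proof -
  have "(norm (a m + b m))\<^sup>2 / c m \<le> 2 * ((norm (a m))\<^sup>2 / c m) + 2 * ((norm (b m))\<^sup>2 / c m)" for m
  proof -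
    have "(norm (a m + b m))\<^sup>2 \<le> (norm (a m) + norm (b m))\<^sup>2"
      by (intro power_mono norm_triangle_ineq) auto
    also have "\<dots> \<le> 2 * (norm (a m))\<^sup>2 + 2 * (norm (b m))\<^sup>2"
      using sum_squares_bound[of "norm (a m)" "norm (b m)"] by (simp add: power2_sum)
    finally have "(norm (a m + b m))\<^sup>2 / c m \<le> (2 * (norm (a m))\<^sup>2 + 2 * (norm (b m))\<^sup>2) / c m"
      using c_pos[of m] by (intro divide_right_mono) auto
    then show ?thesis by (simp add: add_divide_distrib)
  qed
  then show ?thesis
    unfolding level_def sum_distrib_left sum.distrib[symmetric] by (intro sum_mono)
qed

lemma coeff_space_add:
  assumes "a \<in> coeff_space" "b \<in> coeff_space"
  shows "(\<lambda>m. a m + b m) \<in> coeff_space"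
proof -
  have "summable (\<lambda>k. 2 * level a k + 2 * level b k)"
    using assms by (auto simp: coeff_space_def intro!: summable_add summable_mult)
  then show ?thesis
    unfolding coeff_space_def mem_Collect_eq
    by (rule summable_comparison_test'[where N = 0]) (use level_add_le level_nonneg in auto)
qed

lemma level_scale: "level (\<lambda>m. x * a m) k = (norm x)\<^sup>2 * level a k"
  by (simp add: level_def norm_mult power_mult_distrib sum_distrib_left)

lemma coeff_space_scale: "a \<in> coeff_space \<Longrightarrow> (\<lambda>m. x * a m) \<in> coeff_space"
  unfolding coeff_space_def mem_Collect_eq level_scale[abs_def] by (rule summable_mult)

lemma coeff_space_diff:
  assumes "a \<in> coeff_space" "b \<in> coeff_space"
  shows "(\<lambda>m. a m - b m) \<in> coeff_space"
  using coeff_space_add[OF assms(1) coeff_space_scale[OF assms(2), of "-1"]] by simp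

lemma coeff_space_zero: "(\<lambda>_. 0) \<in> coeff_space"
  by (simp add: coeff_space_def level_def[abs_def])

lemma norm_level_inner_le: "norm (level_inner a b k) \<le> level a k + level b k"
proof -
  have "norm (a m * cnj (b m) / of_real (c m)) \<le> (norm (a m))\<^sup>2 / c m + (norm (b m))\<^sup>2 / c m" for m
  proof -
    have "2 * norm (a m) * norm (b m) \<le> (norm (a m))\<^sup>2 + (norm (b m))\<^sup>2"
      by (rule sum_squares_bound)
    moreover have "0 \<le> norm (a m) * norm (b m)" by simp
    ultimately have "norm (a m) * norm (b m) \<le> (norm (a m))\<^sup>2 + (norm (b m))\<^sup>2" by linarith
    then have "norm (a m) * norm (b m) / c m \<le> ((norm (a m))\<^sup>2 + (norm (b m))\<^sup>2) / c m"
      using c_pos[of m] by (intro divide_right_mono) auto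
    then show ?thesis using c_pos[of m] by (simp add: norm_mult norm_divide add_divide_distrib)
  qed
  then show ?thesis
    unfolding level_inner_def level_def sum.distrib[symmetric]
    by (intro order_trans[OF norm_sum] sum_mono)
qed

lemma level_inner_summable:
  assumes "a \<in> coeff_space" "b \<in> coeff_space"
  shows "summable (level_inner a b)"
  by (rule summable_comparison_test'[where N = 0, OF summable_add[of "level a" "level b"]])
     (use assms norm_level_inner_le in \<open>auto simp: coeff_space_def\<close>)

text \<open>The estimate \<open>|a\<^sub>m * z^m| \<le> |a\<^sub>m|^2 / c\<^sub>m + c\<^sub>m * |z^m|^2\<close> plays the role of the Cauchy-Schwarz inequality.\<close>

lemma coeff_space_locally_bounded:
  assumes "a \<in> coeff_space"
  shows "locally_bounded_parts a"
  unfolding locally_bounded_parts_def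
proof (intro allI impI)
  fix r :: real assume "0 < r \<and> r < 1"
  then obtain C where C: "\<And>k z. norm z \<le> r \<Longrightarrow> (\<Sum>m | mi_size m = k. c m * (norm (mi_monom z m))\<^sup>2) \<le> C"
    using diagonal_bounded[of r] by blast
  have "norm (hpart a k z) \<le> suminf (level a) + C" if "norm z \<le> r" for k z
  proof -
    have *: "norm (a m * mi_monom z m) \<le> (norm (a m))\<^sup>2 / c m + c m * (norm (mi_monom z m))\<^sup>2" for m
    proof -
      define x where "x = norm (a m) / sqrt (c m)"
      define y where "y = sqrt (c m) * norm (mi_monom z m)"
      have "0 \<le> x * y" using c_pos[of m] by (simp add: x_def y_def)
      then have "x * y \<le> x\<^sup>2 + y\<^sup>2" using sum_squares_bound[of x y] by linarith
      then show ?thesis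
        using c_pos[of m] by (simp add: x_def y_def power_divide power_mult_distrib norm_mult)
    qed
    have "norm (hpart a k z) \<le> level a k + (\<Sum>m | mi_size m = k. c m * (norm (mi_monom z m))\<^sup>2)"
      unfolding hpart_def level_def sum.distrib[symmetric]
      by (intro order_trans[OF norm_sum] sum_mono *)
    moreover have "level a k \<le> suminf (level a)"
    proof -
      have "(\<Sum>i\<in>{k}. level a i) \<le> suminf (level a)"
        using assms level_nonneg by (intro sum_le_suminf) (auto simp: coeff_space_def)
      then show ?thesis by simp
    qed
    ultimately show ?thesis using C[OF that, of k] by linarith
  qed
  then show "\<exists>C. \<forall>k z. norm z \<le> r \<longrightarrow> norm (hpart a k z) \<le> C" by blast
qed

lemma inj_ball_function: "inj_on ball_function coeff_space"
proof (rule inj_onI)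
  fix a b :: "'n midx \<Rightarrow> complex"
  assume a: "a \<in> coeff_space" and b: "b \<in> coeff_space" and eq: "ball_function a = ball_function b"
  have "hseries a z = hseries b z" if "z \<in> ball 0 1" for z
    using fun_cong[OF eq, of z] that by (simp add: ball_function_def)
  then show "a = b"
    by (intro hseries_eq_imp_coeffs_eq coeff_space_locally_bounded a b)
qed

lemma coeffs_ball_function: "a \<in> coeff_space \<Longrightarrow> coeffs (ball_function a) = a"
  unfolding coeffs_def by (rule inv_into_f_f[OF inj_ball_function])

lemma function_space_ofE:
  assumes "f \<in> function_space_of"
  obtains a where "a \<in> coeff_space" "f = ball_function a" "coeffs f = a"
  using assms coeffs_ball_function unfolding function_space_of_def by blast

lemma ball_function_add:
  assumes "a \<in> coeff_space" "b \<in> coeff_space"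
  shows "(\<lambda>z. ball_function a z + ball_function b z) = ball_function (\<lambda>m. a m + b m)"
  using hseries_add[OF coeff_space_locally_bounded[OF assms(1)] coeff_space_locally_bounded[OF assms(2)]]
  by (auto simp: ball_function_def)

lemma ball_function_scale:
  assumes "a \<in> coeff_space"
  shows "(\<lambda>z. x * ball_function a z) = ball_function (\<lambda>m. x * a m)"
  using hseries_scale_coeff[OF coeff_space_locally_bounded[OF assms]]
  by (auto simp: ball_function_def)

lemma ball_function_diff:
  assumes "a \<in> coeff_space" "b \<in> coeff_space"
  shows "(\<lambda>z. ball_function a z - ball_function b z) = ball_function (\<lambda>m. a m - b m)"
  using ball_function_add[OF assms(1) coeff_space_scale[OF assms(2), of "-1"]]
  unfolding ball_function_scale[OF assms(2), of "-1", symmetric] by simp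

lemma ball_function_zero: "ball_function (\<lambda>_. 0) = (\<lambda>_. 0)"
  by (simp add: fun_eq_iff ball_function_def hseries_def hpart_def)

lemma function_space_function_space_of: "function_space function_space_of"
  unfolding function_space_def
proof (intro conjI ballI allI)
  show "(\<lambda>_. 0) \<in> function_space_of"
    unfolding function_space_of_def ball_function_zero[symmetric]
    by (rule imageI[OF coeff_space_zero])
  show "(\<lambda>x. f x + g x) \<in> function_space_of" if "f \<in> function_space_of" "g \<in> function_space_of" for f g
    using that unfolding function_space_of_def
    by (auto simp: ball_function_add intro!: imageI coeff_space_add)
  show "(\<lambda>z. x * f z) \<in> function_space_of" if "f \<in> function_space_of" for x f
    using that unfolding function_space_of_def
    by (auto simp: ball_function_scale intro!: imageI coeff_space_scale)
qed

lemma level_inner_self: "level_inner a a k = of_real (level a k)"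
  unfolding level_inner_def level_def of_real_sum of_real_divide complex_norm_square ..

lemma inner_function_self:
  assumes "a \<in> coeff_space"
  shows "inner_function (ball_function a) (ball_function a) = of_real (suminf (level a))"
  using assms unfolding inner_function_def coeffs_ball_function[OF assms] ext[OF level_inner_self] coeff_space_def
  by (simp add: suminf_of_real)

lemma ip_norm_inner_function:
  assumes "a \<in> coeff_space"
  shows "ip_norm inner_function (ball_function a) = sqrt (suminf (level a))"
  by (simp add: ip_norm_def inner_function_self[OF assms])

lemma inner_product_inner_function: "inner_product_on function_space_of inner_function"
  unfolding inner_product_on_def
proof (intro conjI ballI allI impI)
  fix f g h assume "f \<in> function_space_of" "g \<in> function_space_of" "h \<in> function_space_of"
  then obtain a b d where a: "a \<in> coeff_space" "f = ball_function a" "coeffs f = a"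
    and b: "b \<in> coeff_space" "g = ball_function b" "coeffs g = b"
    and d: "d \<in> coeff_space" "h = ball_function d" "coeffs h = d"
    by (elim function_space_ofE)
  have sum: "coeffs (\<lambda>x. f x + g x) = (\<lambda>m. a m + b m)"
    unfolding a(2) b(2) ball_function_add[OF a(1) b(1)]
    by (rule coeffs_ball_function[OF coeff_space_add[OF a(1) b(1)]])
  have add: "level_inner (\<lambda>m. a m + b m) d = (\<lambda>k. level_inner a d k + level_inner b d k)"
    by (simp add: fun_eq_iff level_inner_def sum.distrib distrib_right add_divide_distrib)
  show "inner_function (\<lambda>x. f x + g x) h = inner_function f h + inner_function g h"
    unfolding inner_function_def sum a(3) b(3) d(3) add
    by (rule suminf_add[OF level_inner_summable[OF a(1) d(1)] level_inner_summable[OF b(1) d(1)], symmetric])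
next
  fix x f g assume "f \<in> function_space_of" "g \<in> function_space_of"
  then obtain a b where a: "a \<in> coeff_space" "f = ball_function a" "coeffs f = a"
    and b: "b \<in> coeff_space" "g = ball_function b" "coeffs g = b"
    by (elim function_space_ofE)
  have scale: "coeffs (\<lambda>z. x * f z) = (\<lambda>m. x * a m)"
    unfolding a(2) ball_function_scale[OF a(1)]
    by (rule coeffs_ball_function[OF coeff_space_scale[OF a(1)]])
  have mult: "level_inner (\<lambda>m. x * a m) b = (\<lambda>k. x * level_inner a b k)"
    by (simp add: fun_eq_iff level_inner_def sum_distrib_left mult.assoc)
  show "inner_function (\<lambda>z. x * f z) g = x * inner_function f g"
    unfolding inner_function_def scale a(3) b(3) mult
    by (rule suminf_mult[OF level_inner_summable[OF a(1) b(1)]])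
next
  fix f g assume "f \<in> function_space_of" "g \<in> function_space_of"
  then obtain a b where a: "a \<in> coeff_space" "f = ball_function a" "coeffs f = a"
    and b: "b \<in> coeff_space" "g = ball_function b" "coeffs g = b"
    by (elim function_space_ofE)
  have "(\<lambda>k. cnj (level_inner a b k)) sums cnj (suminf (level_inner a b))"
    using level_inner_summable[OF a(1) b(1)] by (simp add: sums_cnj summable_sums)
  moreover have "cnj (level_inner a b k) = level_inner b a k" for k
    by (simp add: level_inner_def mult.commute)
  ultimately have "level_inner b a sums cnj (suminf (level_inner a b))" by simp
  then show "inner_function g f = cnj (inner_function f g)"
    unfolding inner_function_def a(3) b(3) by (simp add: sums_iff)
next
  fix f assume "f \<in> function_space_of" and nz: "f \<noteq> (\<lambda>_. 0)"
  then obtain a where a: "a \<in> coeff_space" "f = ball_function a" by (elim function_space_ofE)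
  have "a \<noteq> (\<lambda>_. 0)" using nz ball_function_zero a by metis
  then obtain m where "a m \<noteq> 0" by auto
  then have "0 < (norm (a m))\<^sup>2 / c m" using c_pos by simp
  also have "\<dots> \<le> level a (mi_size m)" by (rule norm_square_le_level)
  finally have "0 < suminf (level a)"
    using a(1) level_nonneg by (intro suminf_pos2) (auto simp: coeff_space_def)
  then show "0 < Re (inner_function f f)"
    unfolding a(2) by (simp add: inner_function_self a)
qed

text \<open>Completeness of a weighted sequence space: coordinates converge, and the Cauchy bound passes to the limit first
in every partial sum and then in the whole series.\<close>

lemma coeff_space_complete:
  fixes A :: "nat \<Rightarrow> 'n midx \<Rightarrow> complex"
  assumes A: "\<And>i. A i \<in> coeff_space"
    and cauchy: "\<And>\<epsilon>. \<epsilon> > 0 \<Longrightarrow> \<exists>M. \<forall>i\<ge>M. \<forall>j\<ge>M. sqrt (suminf (level (\<lambda>m. A i m - A j m))) < \<epsilon>"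
  obtains a where "a \<in> coeff_space" "(\<lambda>i. sqrt (suminf (level (\<lambda>m. A i m - a m)))) \<longlonglongrightarrow> 0"
proof -
  define \<Delta> where "\<Delta> i j = level (\<lambda>m. A i m - A j m)" for i j
  have summ: "summable (\<Delta> i j)" for i j
    using coeff_space_diff[OF A A] by (simp add: \<Delta>_def coeff_space_def)
  have partial: "(\<Sum>k<K. \<Delta> i j k) \<le> suminf (\<Delta> i j)" for i j K
    using level_nonneg by (intro sum_le_suminf summ) (auto simp: \<Delta>_def)
  have nonneg: "0 \<le> suminf (\<Delta> i j)" for i j
    using level_nonneg by (intro suminf_nonneg summ) (auto simp: \<Delta>_def)
  have "convergent (\<lambda>i. A i m)" for m
  proof -
    have "Cauchy (\<lambda>i. A i m)"
    proof (rule metric_CauchyI)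
      fix e :: real assume "e > 0"
      then have "e / sqrt (c m) > 0" using c_pos[of m] by simp
      then obtain M where M: "\<And>i j. i \<ge> M \<Longrightarrow> j \<ge> M \<Longrightarrow> sqrt (suminf (\<Delta> i j)) < e / sqrt (c m)"
        using cauchy unfolding \<Delta>_def by blast
      have "dist (A i m) (A j m) < e" if "i \<ge> M" "j \<ge> M" for i j
      proof -
        have "(norm (A i m - A j m))\<^sup>2 / c m \<le> \<Delta> i j (mi_size m)"
          unfolding \<Delta>_def by (rule norm_square_le_level)
        also have "\<dots> \<le> (\<Sum>k<Suc (mi_size m). \<Delta> i j k)"
          using level_nonneg by (intro member_le_sum) (auto simp: \<Delta>_def)
        also have "\<dots> \<le> suminf (\<Delta> i j)" by (rule partial)
        finally have "sqrt ((norm (A i m - A j m))\<^sup>2 / c m) \<le> sqrt (suminf (\<Delta> i j))"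
          by (rule real_sqrt_le_mono)
        then have "norm (A i m - A j m) / sqrt (c m) < e / sqrt (c m)"
          using M[OF that] by (simp add: real_sqrt_divide)
        then show ?thesis using c_pos[of m] by (simp add: dist_norm divide_less_cancel)
      qed
      then show "\<exists>M. \<forall>i\<ge>M. \<forall>j\<ge>M. dist (A i m) (A j m) < e" by blast
    qed
    then show ?thesis by (simp add: Cauchy_convergent_iff)
  qed
  then obtain a where a: "\<And>m. (\<lambda>i. A i m) \<longlonglongrightarrow> a m"
    unfolding convergent_def by metis
  define D where "D i = level (\<lambda>m. A i m - a m)" for i
  have bound: "\<exists>M. \<forall>i\<ge>M. summable (D i) \<and> suminf (D i) \<le> \<epsilon>\<^sup>2" if "\<epsilon> > 0" for \<epsilon>
  proof -
    obtain M where M: "\<And>i j. i \<ge> M \<Longrightarrow> j \<ge> M \<Longrightarrow> sqrt (suminf (\<Delta> i j)) < \<epsilon>"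
      using cauchy[OF \<open>\<epsilon> > 0\<close>] unfolding \<Delta>_def by blast
    have "summable (D i) \<and> suminf (D i) \<le> \<epsilon>\<^sup>2" if i: "i \<ge> M" for i
    proof -
      have le: "(\<Sum>k<K. D i k) \<le> \<epsilon>\<^sup>2" for K
      proof (rule tendsto_upperbound)
        show "(\<lambda>j. \<Sum>k<K. \<Delta> i j k) \<longlonglongrightarrow> (\<Sum>k<K. D i k)"
          unfolding \<Delta>_def D_def level_def
          using c_pos by (intro tendsto_intros a) (auto simp: less_imp_neq[symmetric])
        have "(\<Sum>k<K. \<Delta> i j k) \<le> \<epsilon>\<^sup>2" if j: "j \<ge> M" for j
        proof -
          have "suminf (\<Delta> i j) = (sqrt (suminf (\<Delta> i j)))\<^sup>2" using nonneg by simp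
          also have "\<dots> \<le> \<epsilon>\<^sup>2" using M[OF i j] nonneg by (intro power_mono) auto
          finally show ?thesis using partial[of i j K] by linarith
        qed
        then show "\<forall>\<^sub>F j in sequentially. (\<Sum>k<K. \<Delta> i j k) \<le> \<epsilon>\<^sup>2"
          unfolding eventually_sequentially by blast
      qed simp
      have s: "summable (D i)"
        by (rule summableI_nonneg_bounded[OF _ le]) (simp add: D_def level_nonneg)
      then show ?thesis using suminf_le_const[OF s le] by blast
    qed
    then show ?thesis by blast
  qed
  obtain M where M: "\<And>i. i \<ge> M \<Longrightarrow> summable (D i)" using bound[of 1] by auto
  have "(\<lambda>m. A M m - a m) \<in> coeff_space"
    using M[of M] by (simp add: coeff_space_def D_def)
  from coeff_space_diff[OF A[of M] this] have aV: "a \<in> coeff_space" by simp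
  have "(\<lambda>i. sqrt (suminf (D i))) \<longlonglongrightarrow> 0"
  proof (rule LIMSEQ_I)
    fix r :: real assume r: "r > 0"
    then obtain M where M: "\<And>i. i \<ge> M \<Longrightarrow> summable (D i) \<and> suminf (D i) \<le> (r / 2)\<^sup>2"
      using bound[of "r / 2"] by auto
    have "norm (sqrt (suminf (D i)) - 0) < r" if "i \<ge> M" for i
    proof -
      have "0 \<le> suminf (D i)" using M[OF that] level_nonneg by (intro suminf_nonneg) (auto simp: D_def)
      moreover have "sqrt (suminf (D i)) \<le> sqrt ((r / 2)\<^sup>2)" using M[OF that] by (intro real_sqrt_le_mono) auto
      ultimately show ?thesis using r by simp
    qed
    then show "\<exists>M. \<forall>i\<ge>M. norm (sqrt (suminf (D i)) - 0) < r" by blast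
  qed
  then show ?thesis using that aV unfolding D_def by blast
qed

lemma hilbert_space_function_space_of: "hilbert_space_on function_space_of inner_function"
  unfolding hilbert_space_on_def
proof (intro conjI allI impI function_space_function_space_of inner_product_inner_function, elim conjE)
  fix F :: "nat \<Rightarrow> complex ^ 'n \<Rightarrow> complex"
  assume F: "range F \<subseteq> function_space_of"
    and cauchy: "\<forall>\<epsilon>>0. \<exists>M. \<forall>i\<ge>M. \<forall>j\<ge>M. ip_norm inner_function (\<lambda>x. F i x - F j x) < \<epsilon>"
  have "\<exists>a. a \<in> coeff_space \<and> F i = ball_function a" for i
    using F unfolding function_space_of_def by auto
  then obtain A where A: "\<And>i. A i \<in> coeff_space" "\<And>i. F i = ball_function (A i)" by metis
  have nrm: "ip_norm inner_function (\<lambda>x. ball_function (A i) x - ball_function b x) = sqrt (suminf (level (\<lambda>m. A i m - b m)))"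
    if "b \<in> coeff_space" for i b
    unfolding ball_function_diff[OF A(1) that] by (rule ip_norm_inner_function[OF coeff_space_diff[OF A(1) that]])
  obtain a where a: "a \<in> coeff_space" "(\<lambda>i. sqrt (suminf (level (\<lambda>m. A i m - a m)))) \<longlonglongrightarrow> 0"
  proof (rule coeff_space_complete[of A])
    show "A i \<in> coeff_space" for i by (rule A(1))
    show "\<exists>M. \<forall>i\<ge>M. \<forall>j\<ge>M. sqrt (suminf (level (\<lambda>m. A i m - A j m))) < \<epsilon>" if "\<epsilon> > 0" for \<epsilon>
      using cauchy that unfolding A(2) nrm[OF A(1)] by blast
  qed
  show "\<exists>f\<in>function_space_of. (\<lambda>i. ip_norm inner_function (\<lambda>x. F i x - f x)) \<longlonglongrightarrow> 0"
  proof
    show "ball_function a \<in> function_space_of" using a by (auto simp: function_space_of_def)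
    show "(\<lambda>i. ip_norm inner_function (\<lambda>x. F i x - ball_function a x)) \<longlonglongrightarrow> 0"
      using a(2) unfolding A(2) nrm[OF a(1)] .
  qed
qed

text \<open>The coefficients of the kernel section at \<open>w\<close>: in the inner product with a coefficient family \<open>a\<close> the weights
cancel and leave \<open>a m * mi_monom w m\<close>, the terms of the value at \<open>w\<close>.\<close>

definition kernel_coeff :: "complex ^ 'n \<Rightarrow> 'n midx \<Rightarrow> complex" where
  "kernel_coeff w m = of_real (c m) * cnj (mi_monom w m)"

lemma kernel_coeff_in_space:
  assumes w: "w \<in> ball 0 1"
  shows "kernel_coeff w \<in> coeff_space"
proof -
  define q where "q = (1 + norm w) / 2"
  have "0 \<le> norm w" "norm w < 1" using w by auto
  then have "0 < q \<and> q < 1 \<and> norm w < q"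
    unfolding q_def by argo
  then have q: "0 < q" "q < 1" "norm w < q" by auto
  define w' where "w' = complex_of_real (1 / q) *s w"
  have w': "norm w' < 1" using q by (simp add: w'_def norm_vector_smult norm_divide)
  obtain C where C: "\<And>k z. norm z \<le> norm w' \<Longrightarrow> (\<Sum>m | mi_size m = k. c m * (norm (mi_monom z m))\<^sup>2) \<le> C"
    using diagonal_bounded[OF w'] by blast
  have w_eq: "w = complex_of_real q *s w'" using q by (simp add: w'_def vec_eq_iff)
  have lev: "level (kernel_coeff w) k = (q\<^sup>2) ^ k * (\<Sum>m | mi_size m = k. c m * (norm (mi_monom w' m))\<^sup>2)" for k
    unfolding level_def sum_distrib_left
  proof (intro sum.cong refl)
    fix m :: "'n midx" assume "m \<in> {m. mi_size m = k}"
    then have "norm (mi_monom w m) = q ^ k * norm (mi_monom w' m)"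
      using q unfolding w_eq by (simp add: mi_monom_scale norm_mult norm_power)
    then show "(norm (kernel_coeff w m))\<^sup>2 / c m = (q\<^sup>2) ^ k * (c m * (norm (mi_monom w' m))\<^sup>2)"
      using c_pos[of m] by (simp add: kernel_coeff_def norm_mult power_mult_distrib power2_eq_square)
  qed
  have "summable (\<lambda>k. (q\<^sup>2) ^ k * C)"
    using q by (intro summable_mult2 summable_geometric) (simp add: power_less_one_iff)
  then show ?thesis
    unfolding coeff_space_def mem_Collect_eq
  proof (rule summable_comparison_test'[where N = 0])
    show "norm (level (kernel_coeff w) k) \<le> (q\<^sup>2) ^ k * C" for k
      using C[of w' k] level_nonneg[of "kernel_coeff w" k] unfolding lev by (simp add: mult_left_mono)
  qed
qed

theorem reproducing_kernel_function_space_of: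
  assumes K: "\<And>z w. z \<in> ball 0 1 \<Longrightarrow> w \<in> ball 0 1 \<Longrightarrow> K z w = hseries (kernel_coeff w) z"
  shows "has_reproducing_kernel (ball 0 1) function_space_of inner_function K"
  unfolding has_reproducing_kernel_def
proof (intro conjI ballI hilbert_space_function_space_of)
  fix w :: "complex ^ 'n" assume w: "w \<in> ball 0 1"
  have eq: "(\<lambda>z. if z \<in> ball 0 1 then K z w else 0) = ball_function (kernel_coeff w)"
    using K w by (auto simp: ball_function_def)
  show "(\<lambda>z. if z \<in> ball 0 1 then K z w else 0) \<in> function_space_of"
    unfolding eq function_space_of_def by (intro imageI kernel_coeff_in_space w)
  fix f assume "f \<in> function_space_of"
  then obtain a where a: "a \<in> coeff_space" "f = ball_function a" "coeffs f = a"
    by (rule function_space_ofE)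
  have lev: "level_inner a (kernel_coeff w) = (\<lambda>k. hpart a k w)"
    unfolding level_inner_def hpart_def
  proof (intro ext sum.cong refl)
    show "a m * cnj (kernel_coeff w m) / of_real (c m) = a m * mi_monom w m" for m
      using c_pos[of m] by (simp add: kernel_coeff_def)
  qed
  show "f w = inner_function f (\<lambda>z. if z \<in> ball 0 1 then K z w else 0)"
    unfolding eq inner_function_def coeffs_ball_function[OF kernel_coeff_in_space[OF w]] a(3) lev
    using w by (simp add: a(2) ball_function_def hseries_def)
qed

end

section \<open>Identification of the space and of its kernel\<close>

lemma square_integrable_weighted_volume_iff:
  fixes g :: "complex ^ 'n::finite \<Rightarrow> complex"
  assumes b: "locally_bounded_parts b" and g: "\<And>z. z \<in> ball 0 1 \<Longrightarrow> g z = hseries b z"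
  shows "square_integrable (weighted_volume \<alpha>) (\<lambda>z. complex_of_real ((1 - (norm z)\<^sup>2) ^ k) * g z)
    \<longleftrightarrow> integrable lborel (\<lambda>z. ball_weight (2 * real k + \<alpha>) z * (norm (hseries b z))\<^sup>2)"
proof -
  let ?h = "\<lambda>z. complex_of_real ((1 - (norm z)\<^sup>2) ^ k) * g z"
  let ?B = "ball 0 1 :: (complex ^ 'n) set"
  have cont: "continuous_on ?B g"
    by (rule holomorphic_vec_on_continuous[OF holomorphic_vec_on_cong[OF holomorphic_hseries[OF b] open_ball]])
       (simp add: g)
  have "?h \<in> borel_measurable (restrict_space borel ?B)"
    by (intro borel_measurable_continuous_on_restrict continuous_intros cont)
  moreover have "sets (restrict_space lborel ?B) = sets (restrict_space borel ?B)"
    by (intro sets_restrict_space_cong) simp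
  ultimately have h [measurable]: "?h \<in> borel_measurable (restrict_space lborel ?B)"
    using measurable_cong_sets by blast
  have "(\<lambda>z. (1 - (norm z)\<^sup>2) powr \<alpha>) \<in> borel_measurable (borel :: (complex ^ 'n) measure)"
    by measurable
  then have w [measurable]: "(\<lambda>z. (1 - (norm z)\<^sup>2) powr \<alpha>) \<in> borel_measurable (restrict_space lborel ?B)"
    by (intro measurable_restrict_space1) simp
  have "square_integrable (weighted_volume \<alpha>) ?h \<longleftrightarrow> integrable (weighted_volume \<alpha>) (\<lambda>z. (norm (?h z))\<^sup>2)"
    using h by (simp add: square_integrable_def weighted_volume_def)
  also have "\<dots> \<longleftrightarrow> integrable (restrict_space lborel ?B) (\<lambda>z. (1 - (norm z)\<^sup>2) powr \<alpha> *\<^sub>R (norm (?h z))\<^sup>2)"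
    unfolding weighted_volume_def
  proof (rule integrable_density)
    show "(\<lambda>z. (norm (?h z))\<^sup>2) \<in> borel_measurable (restrict_space lborel ?B)"
      using h by measurable
  qed (use w in auto)
  also have "\<dots> \<longleftrightarrow> integrable lborel (\<lambda>z. indicator ?B z *\<^sub>R ((1 - (norm z)\<^sup>2) powr \<alpha> *\<^sub>R (norm (?h z))\<^sup>2))"
    by (rule integrable_restrict_space) simp
  also have "(\<lambda>z. indicator ?B z *\<^sub>R ((1 - (norm z)\<^sup>2) powr \<alpha> *\<^sub>R (norm (?h z))\<^sup>2))
      = (\<lambda>z. ball_weight (2 * real k + \<alpha>) z * (norm (hseries b z))\<^sup>2)"
  proof
    fix z
    show "indicator ?B z *\<^sub>R ((1 - (norm z)\<^sup>2) powr \<alpha> *\<^sub>R (norm (?h z))\<^sup>2)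
      = ball_weight (2 * real k + \<alpha>) z * (norm (hseries b z))\<^sup>2"
    proof (cases "z \<in> ?B")
      case True
      define x where "x = 1 - (norm z)\<^sup>2"
      have x: "x > 0" using True by (simp add: x_def power_less_one_iff abs_square_less_1)
      have "x powr (2 * real k + \<alpha>) = (x ^ k)\<^sup>2 * x powr \<alpha>"
        using powr_realpow[OF x, of "2 * k"]
        by (simp add: powr_add power_mult[symmetric] mult.commute)
      then show ?thesis
        using True x g[OF True] by (simp add: ball_weight_def x_def[symmetric] norm_mult power_mult_distrib norm_power mult_ac)
    qed (simp add: ball_weight_def)
  qed
  finally show ?thesis .
qed

lemma norm_cdot_less_1:
  assumes "z \<in> ball 0 1" "w \<in> ball 0 1"
  shows "norm (cdot z w) < 1"
proof -
  have "norm (cdot z w) \<le> (\<Sum>j\<in>UNIV. \<bar>norm (z $ j)\<bar> * \<bar>norm (w $ j)\<bar>)"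
    unfolding cdot_def by (rule order_trans[OF norm_sum]) (simp add: norm_mult)
  also have "\<dots> \<le> norm z * norm w"
    unfolding norm_vec_def by (rule L2_set_mult_ineq)
  also have "\<dots> \<le> norm z * 1" using assms by (intro mult_left_mono) auto
  finally show ?thesis using assms by simp
qed

lemma binomial_series_pochhammer:
  fixes s :: real
  assumes "norm x < 1"
  shows "(\<lambda>k. of_real (pochhammer s k / fact k) * x ^ k) sums (1 / (1 - x) powr complex_of_real s)"
proof -
  have "(\<lambda>k. ((- complex_of_real s) gchoose k) * (- x) ^ k) sums (1 + (- x)) powr (- complex_of_real s)"
    by (rule gen_binomial_complex) (use assms in simp)
  moreover have "((- complex_of_real s) gchoose k) * (- x) ^ k = of_real (pochhammer s k / fact k) * x ^ k" for k
  proof -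
    have "((- complex_of_real s) gchoose k) * (- x) ^ k
        = ((-1) ^ k * (-1) ^ k) * (pochhammer (complex_of_real s) k / fact k * x ^ k)"
      unfolding gbinomial_pochhammer power_minus[of x] by simp
    also have "(-1) ^ k * (-1) ^ k = (1 :: complex)" by (simp add: power_mult_distrib[symmetric])
    finally show ?thesis by (simp add: pochhammer_of_real)
  qed
  ultimately show ?thesis by (simp add: powr_minus_divide)
qed

lemma between_ints_not_nonpos_Int:
  assumes "- real N < s" "s < - real N + 1"
  shows "s \<notin> \<int>\<^sub>\<le>\<^sub>0"
proof
  assume "s \<in> \<int>\<^sub>\<le>\<^sub>0"
  then obtain i :: int where "s = of_int i" by (auto elim!: nonpos_Ints_cases)
  then have "- int N < i" "i < - int N + 1" using assms by linarith+
  then show False by linarith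
qed

text \<open>The parameter \<open>s\<close> stands for \<open>n + 1 + \<alpha>\<close>, and the lower bound for \<open>\<omega>\<close> is expressed by rising factorials instead of
quotients of Gamma values.\<close>

locale kernel_parameters =
  fixes s :: real and N :: nat and \<omega> :: "'n::finite midx \<Rightarrow> real"
  assumes N_pos: "N > 0" and s_lower: "- real N < s" and s_upper: "s < - real N + 1"
    and \<omega>_lower: "mi_size m \<le> N \<Longrightarrow> \<omega> m > (-1) ^ (N + 1) * (pochhammer s (mi_size m) / mi_fact m)"
begin

definition \<kappa> :: "'n midx \<Rightarrow> real" where
  "\<kappa> m = (if mi_size m \<le> N then \<omega> m else 0) + (-1) ^ N * (pochhammer s (mi_size m) / mi_fact m)"

text \<open>The factors \<open>s, ..., s + N - 1\<close> are negative and all later ones are positive.\<close>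

lemma pochhammer_sign:
  assumes "N \<le> k"
  shows "(-1) ^ N * pochhammer s k > 0"
proof -
  have "(-1) ^ N * pochhammer s N = (\<Prod>i<N. - (s + real i))"
    unfolding prod_uminus by (simp add: pochhammer_prod atLeast0LessThan)
  also have "\<dots> > 0"
  proof (intro prod_pos)
    fix i assume "i \<in> {..<N}"
    then have "real i + 1 \<le> real N" by simp
    then show "0 < - (s + real i)" using s_upper by linarith
  qed
  finally have "(-1) ^ N * pochhammer s N > 0" .
  moreover have "pochhammer (s + real N) (k - N) > 0"
    using s_lower by (intro pochhammer_pos) linarith
  ultimately show ?thesis
    using pochhammer_product[OF assms, of s] by (simp add: mult.assoc[symmetric])
qed

lemma \<kappa>_pos: "\<kappa> m > 0"
proof (cases "mi_size m \<le> N")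
  case True
  then show ?thesis using \<omega>_lower[OF True] by (simp add: \<kappa>_def)
next
  case False
  then have "0 < (-1) ^ N * pochhammer s (mi_size m) / mi_fact m"
    by (intro divide_pos_pos pochhammer_sign) auto
  then show ?thesis using False by (simp add: \<kappa>_def)
qed

lemma sum_\<kappa>:
  fixes F :: "'n midx \<Rightarrow> 'b::real_normed_field"
  shows "(\<Sum>m | mi_size m = k. of_real (\<kappa> m) * F m)
    = (if k \<le> N then \<Sum>m | mi_size m = k. of_real (\<omega> m) * F m else 0)
      + (-1) ^ N * of_real (pochhammer s k / fact k) * (\<Sum>m | mi_size m = k. fact k / of_nat (mi_fact m) * F m)"
proof -
  have "of_real (\<kappa> m) * F m = (if k \<le> N then of_real (\<omega> m) * F m else 0)
      + (-1) ^ N * of_real (pochhammer s k / fact k) * (fact k / of_nat (mi_fact m) * F m)"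
    if "mi_size m = k" for m
    using that by (simp add: \<kappa>_def distrib_right)
  then have "(\<Sum>m | mi_size m = k. of_real (\<kappa> m) * F m)
     = (\<Sum>m | mi_size m = k. (if k \<le> N then of_real (\<omega> m) * F m else 0)
      + (-1) ^ N * of_real (pochhammer s k / fact k) * (fact k / of_nat (mi_fact m) * F m))"
    by (intro sum.cong refl) auto
  then show ?thesis by (simp add: sum.distrib sum_distrib_left)
qed

lemma pochhammer_power_bounded:
  assumes "0 \<le> x" "x < 1"
  obtains C where "\<And>k. \<bar>pochhammer s k / fact k\<bar> * x ^ k \<le> C"
proof -
  have "summable (\<lambda>k. complex_of_real (pochhammer s k / fact k) * of_real x ^ k)"
    using binomial_series_pochhammer[of "complex_of_real x" s] assms by (simp add: sums_iff)
  then have "Bseq (\<lambda>k. complex_of_real (pochhammer s k / fact k) * of_real x ^ k)"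
    by (rule convergent_imp_Bseq[OF convergentI[OF summable_LIMSEQ_zero]])
  then obtain C where "\<And>k. norm (complex_of_real (pochhammer s k / fact k) * of_real x ^ k) \<le> C"
    by (auto simp: Bseq_def)
  then have "\<bar>pochhammer s k / fact k\<bar> * x ^ k \<le> C" for k
    using assms by (simp add: norm_mult norm_power norm_divide)
  then show ?thesis by (rule that)
qed

lemma coefficient_weight_\<kappa>: "coefficient_weight \<kappa>"
proof
  show "\<kappa> m > 0" for m by (rule \<kappa>_pos)
  fix r :: real assume r: "r < 1"
  define x where "x = (max r 0)\<^sup>2"
  have x: "0 \<le> x" "x < 1" using r by (auto simp: x_def power_less_one_iff max_def)
  obtain C where C: "\<And>k. \<bar>pochhammer s k / fact k\<bar> * x ^ k \<le> C"
    using pochhammer_power_bounded[OF x] by blast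
  define D where "D = (\<Sum>m | mi_size m \<le> N. \<bar>\<omega> m\<bar>)"
  have "(\<Sum>m | mi_size m = k. \<kappa> m * (norm (mi_monom z m))\<^sup>2) \<le> D + C" if z: "norm z \<le> r" for k z
  proof -
    have le1: "(norm (mi_monom z m))\<^sup>2 \<le> 1" for m
    proof -
      have "norm (mi_monom z m) \<le> 1"
        by (rule order_trans[OF norm_mi_monom_le power_le_one]) (use z r in auto)
      then show ?thesis by (simp add: power_le_one)
    qed
    have "(\<Sum>m | mi_size m = k. \<omega> m * (norm (mi_monom z m))\<^sup>2) \<le> D" if k: "k \<le> N"
    proof -
      have "(\<Sum>m | mi_size m = k. \<omega> m * (norm (mi_monom z m))\<^sup>2) \<le> (\<Sum>m | mi_size m = k. \<bar>\<omega> m\<bar> * 1)"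
        by (intro sum_mono mult_mono le1) auto
      also have "\<dots> \<le> D"
        unfolding D_def using k by (simp, intro sum_mono2 finite_mi_size_le) auto
      finally show ?thesis .
    qed
    moreover have "0 \<le> D" unfolding D_def by (intro sum_nonneg) auto
    ultimately have 1: "(if k \<le> N then \<Sum>m | mi_size m = k. \<omega> m * (norm (mi_monom z m))\<^sup>2 else 0) \<le> D" by simp
    have "norm z ^ (2 * k) \<le> x ^ k"
      unfolding power_mult x_def using z by (intro power_mono) auto
    then have "\<bar>pochhammer s k / fact k\<bar> * norm z ^ (2 * k) \<le> \<bar>pochhammer s k / fact k\<bar> * x ^ k"
      by (intro mult_left_mono) auto
    also have "\<dots> \<le> C" by (rule C)
    finally have "\<bar>(-1) ^ N * (pochhammer s k / fact k) * norm z ^ (2 * k)\<bar> \<le> C"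
      by (simp add: abs_mult power_abs)
    then have 2: "(-1) ^ N * (pochhammer s k / fact k) * norm z ^ (2 * k) \<le> C" by linarith
    show ?thesis
      using sum_\<kappa>[of "\<lambda>m. (norm (mi_monom z m))\<^sup>2" k] 1 2
      unfolding multinomial_norm of_real_eq_id id_apply by linarith
  qed
  then show "\<exists>C. \<forall>k z. norm z \<le> r \<longrightarrow> (\<Sum>m | mi_size m = k. \<kappa> m * (norm (mi_monom z m))\<^sup>2) \<le> C" by blast
qed

sublocale coefficient_weight \<kappa> by (rule coefficient_weight_\<kappa>)

text \<open>By the multinomial theorem, the degree \<open>k\<close> part of the diagonal expansion is the degree \<open>k\<close> part of \<open>Q\<close> plus the
\<open>k\<close>-th term of the binomial series.\<close>

lemma kernel_expansion:
  assumes z: "z \<in> ball 0 1" and w: "w \<in> ball 0 1"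
  shows "(\<Sum>m | mi_size m \<le> N. of_real (\<omega> m) * mi_monom z m * cnj (mi_monom w m))
      + (-1) ^ N / (1 - cdot z w) powr complex_of_real s = hseries (kernel_coeff w) z"
proof -
  have part: "hpart (kernel_coeff w) k z
      = (if k \<in> {..N} then \<Sum>m | mi_size m = k. of_real (\<omega> m) * mi_monom z m * cnj (mi_monom w m) else 0)
        + (-1) ^ N * (of_real (pochhammer s k / fact k) * cdot z w ^ k)" for k
    using sum_\<kappa>[of "\<lambda>m. mi_monom z m * cnj (mi_monom w m)" k]
    unfolding multinomial_cdot[symmetric] hpart_def kernel_coeff_def by (simp add: mult_ac)
  have "(\<lambda>k. if k \<in> {..N} then \<Sum>m | mi_size m = k. of_real (\<omega> m) * mi_monom z m * cnj (mi_monom w m) else 0)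
      sums (\<Sum>k\<in>{..N}. \<Sum>m | mi_size m = k. of_real (\<omega> m) * mi_monom z m * cnj (mi_monom w m))"
    by (rule sums_If_finite_set) simp
  moreover have "(\<lambda>k. (-1) ^ N * (of_real (pochhammer s k / fact k) * cdot z w ^ k))
      sums ((-1) ^ N * (1 / (1 - cdot z w) powr complex_of_real s))"
    by (intro sums_mult binomial_series_pochhammer norm_cdot_less_1 z w)
  ultimately have "(\<lambda>k. hpart (kernel_coeff w) k z) sums
      ((\<Sum>k\<in>{..N}. \<Sum>m | mi_size m = k. of_real (\<omega> m) * mi_monom z m * cnj (mi_monom w m))
        + (-1) ^ N * (1 / (1 - cdot z w) powr complex_of_real s))"
    unfolding part by (rule sums_add)
  moreover have "(\<Sum>k\<in>{..N}. \<Sum>m | mi_size m = k. of_real (\<omega> m) * mi_monom z m * cnj (mi_monom w m))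
      = (\<Sum>m | mi_size m \<le> N. of_real (\<omega> m) * mi_monom z m * cnj (mi_monom w m))"
    using sum_mi_size_less[of _ "Suc N", symmetric] by (simp add: less_Suc_eq_le lessThan_Suc_atMost)
  ultimately show ?thesis by (simp add: hseries_def sums_iff)
qed

text \<open>The Gamma factors of \<open>\<kappa> m\<close> and of the moment cancel up to a constant \<open>D\<close> and a rising factorial with \<open>2k\<close>
factors, each comparable to \<open>mi_size m\<close>. Positivity of \<open>D\<close> can be read off at any \<open>m\<close> of large size.\<close>

lemma \<kappa>_moment_bounds:
  fixes k :: nat
  assumes \<beta>: "2 * real k + \<alpha> > -1" and s: "s = real CARD('n) + 1 + \<alpha>"
  obtains L U where "0 < L" "0 < U"
    "\<And>m. N < mi_size m \<Longrightarrow> L \<le> \<kappa> m * (real (mi_size m) ^ (2 * k) * ball_moment (2 * real k + \<alpha>) m)"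
    "\<And>m. N < mi_size m \<Longrightarrow> \<kappa> m * (real (mi_size m) ^ (2 * k) * ball_moment (2 * real k + \<alpha>) m) \<le> U"
proof -
  define \<beta>' where "\<beta>' = 2 * real k + \<alpha>"
  define D where "D = (-1) ^ N / Gamma s * (pi ^ CARD('n) * Gamma (\<beta>' + 1))"
  define P where "P d = pochhammer (s + real d) (2 * k)" for d
  have s_nonint: "s \<notin> \<int>\<^sub>\<le>\<^sub>0" by (rule between_ints_not_nonpos_Int[OF s_lower s_upper])
  have key: "\<kappa> m * ball_moment \<beta>' m = D / P (mi_size m)" and D: "D > 0" and P: "P (mi_size m) > 0"
    if m: "N < mi_size m" for m
  proof -
    define d where "d = mi_size m"
    have sd: "s + real d > 0" using m s_lower unfolding d_def by linarith
    then have sd_nonint: "s + real d \<notin> \<int>\<^sub>\<le>\<^sub>0" by (auto elim!: nonpos_Ints_cases)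
    show "P (mi_size m) > 0" unfolding P_def using sd d_def by (intro pochhammer_pos) simp
    have \<kappa>: "\<kappa> m = (-1) ^ N * pochhammer s d / mi_fact m" using m by (simp add: \<kappa>_def d_def)
    have g1: "pochhammer s d = Gamma (s + real d) / Gamma s"
      using pochhammer_Gamma[OF s_nonint, of d] by simp
    have g2: "Gamma (s + real d + real (2 * k)) = Gamma (s + real d) * P d"
      using pochhammer_Gamma[OF sd_nonint, of "2 * k"] Gamma_real_pos[OF sd] by (simp add: P_def)
    have e: "real CARD('n) + real d + \<beta>' + 1 = s + real d + real (2 * k)"
      by (simp add: s \<beta>'_def)
    have Gpos: "Gamma (s + real d) > 0" by (rule Gamma_real_pos[OF sd])
    show "\<kappa> m * ball_moment \<beta>' m = D / P (mi_size m)"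
      unfolding \<kappa> ball_moment_def d_def[symmetric] e g2 g1 D_def
      using Gpos by simp
    have "0 < (-1) ^ N * pochhammer s d" using m by (intro pochhammer_sign) (simp add: d_def)
    then have "0 < (-1) ^ N / Gamma s * Gamma (s + real d)" unfolding g1 by simp
    then have "0 < (-1) ^ N / Gamma s" using Gpos by (rule zero_less_mult_pos2)
    then show "D > 0" unfolding D_def using \<beta> by (intro mult_pos_pos Gamma_real_pos) (auto simp: \<beta>'_def)
  qed
  have Dpos: "D > 0"
  proof -
    have "1 * Suc N \<le> CARD('n) * Suc N" by (intro mult_le_mono1) (simp add: Suc_le_eq)
    then have "N < mi_size (\<lambda>_ :: 'n. Suc N)" by (simp add: mi_size_def)
    then show ?thesis by (rule D)
  qed
  define U0 where "U0 = real N / (s + real N)"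
  have U0: "U0 > 0" using N_pos s_lower by (simp add: U0_def)
  have lower: "real d ^ (2 * k) \<le> U0 ^ (2 * k) * P d" and upper: "P d \<le> real (1 + 2 * k) ^ (2 * k) * real d ^ (2 * k)"
    if d: "N < d" for d
  proof -
    have "real d ^ (2 * k) = (\<Prod>i<2 * k. real d)" by simp
    also have "\<dots> \<le> (\<Prod>i<2 * k. U0 * (s + real d + real i))"
    proof (intro prod_mono conjI)
      fix i
      have "s < 0" using N_pos s_upper by linarith
      \<comment> \<open>As \<open>s < 0\<close>, the quotient \<open>d / (s + d)\<close> decreases in \<open>d\<close>, so its value \<open>U0\<close> at \<open>N\<close> is a bound.\<close>
      then have "s * real d \<le> s * real N" using d by (intro mult_left_mono_neg) auto
      then have "real d * (s + real N) \<le> real N * (s + real d)" by (simp add: algebra_simps)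
      then have "real d \<le> U0 * (s + real d)"
        using s_lower by (simp add: U0_def pos_le_divide_eq)
      also have "\<dots> \<le> U0 * (s + real d + real i)" using U0 by (intro mult_left_mono) auto
      finally show "real d \<le> U0 * (s + real d + real i)" .
    qed auto
    also have "\<dots> = U0 ^ (2 * k) * P d"
      by (simp add: prod.distrib P_def pochhammer_prod atLeast0LessThan)
    finally show "real d ^ (2 * k) \<le> U0 ^ (2 * k) * P d" .
    have "P d = (\<Prod>i<2 * k. s + real d + real i)" by (simp add: P_def pochhammer_prod atLeast0LessThan)
    also have "\<dots> \<le> (\<Prod>i<2 * k. real (1 + 2 * k) * real d)"
    proof (intro prod_mono conjI)
      fix i assume i: "i \<in> {..<2 * k}"
      show "0 \<le> s + real d + real i" using d s_lower by linarith
      have "s < 0" using N_pos s_upper by linarith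
      then have "s + real d + real i \<le> real d + real (2 * k) * 1" using i by simp
      also have "\<dots> \<le> real d + real (2 * k) * real d" using d by (intro add_left_mono mult_left_mono) auto
      finally show "s + real d + real i \<le> real (1 + 2 * k) * real d" by (simp add: algebra_simps)
    qed
    also have "\<dots> = real (1 + 2 * k) ^ (2 * k) * real d ^ (2 * k)"
      by (simp only: prod_constant card_lessThan power_mult_distrib)
    finally show "P d \<le> real (1 + 2 * k) ^ (2 * k) * real d ^ (2 * k)" .
  qed
  show ?thesis
  proof
    show "0 < D / real (1 + 2 * k) ^ (2 * k)" using Dpos by (intro divide_pos_pos zero_less_power) auto
    show "0 < D * U0 ^ (2 * k)" using Dpos U0 by simp
    fix m :: "'n midx" assume m: "N < mi_size m"
    define d where "d = mi_size m"
    have eq: "\<kappa> m * (real (mi_size m) ^ (2 * k) * ball_moment (2 * real k + \<alpha>) m) = D * (real d ^ (2 * k) / P d)"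
      unfolding mult.left_commute[of "\<kappa> m"] key[OF m, unfolded \<beta>'_def] by (simp add: d_def)
    have Pd: "P d > 0" using P[OF m] by (simp add: d_def)
    have "real d ^ (2 * k) / P d \<le> U0 ^ (2 * k)" using lower[of d] m Pd by (simp add: d_def pos_divide_le_eq)
    then show "\<kappa> m * (real (mi_size m) ^ (2 * k) * ball_moment (2 * real k + \<alpha>) m) \<le> D * U0 ^ (2 * k)"
      unfolding eq using Dpos by (intro mult_left_mono) auto
    have "real (1 + 2 * k) ^ (2 * k) > 0" by (intro zero_less_power) simp
    then have "1 / real (1 + 2 * k) ^ (2 * k) \<le> real d ^ (2 * k) / P d"
      using upper[of d] m Pd by (simp only: d_def frac_le_eq pos_le_divide_eq) (simp add: pos_divide_le_eq mult.commute)
    then have "D * (1 / real (1 + 2 * k) ^ (2 * k)) \<le> D * (real d ^ (2 * k) / P d)"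
      using Dpos by (intro mult_left_mono) auto
    then show "D / real (1 + 2 * k) ^ (2 * k) \<le> \<kappa> m * (real (mi_size m) ^ (2 * k) * ball_moment (2 * real k + \<alpha>) m)"
      unfolding eq by simp
  qed
qed

text \<open>Only finitely many degrees escape the bounds of \<open>\<kappa>_moment_bounds\<close>, so the two series of nonnegative terms
converge together. In particular the condition is the same for all admissible \<open>k\<close>.\<close>

lemma radial_square_integrable_iff:
  fixes k :: nat
  assumes \<beta>: "2 * real k + \<alpha> > -1" and s: "s = real CARD('n) + 1 + \<alpha>"
    and a: "locally_bounded_parts a" and f: "\<And>z. z \<in> ball 0 1 \<Longrightarrow> f z = hseries a z"
  shows "square_integrable (weighted_volume \<alpha>) (\<lambda>z. complex_of_real ((1 - (norm z)\<^sup>2) ^ k) * (radial_deriv ^^ k) f z)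
    \<longleftrightarrow> a \<in> coeff_space"
proof -
  let ?b = "(radial_coeff ^^ k) a"
  interpret bw: torus_weight "ball_weight (2 * real k + \<alpha>) :: complex ^ 'n \<Rightarrow> real"
    by (rule torus_weight_ball_weight[OF \<beta>])
  define S where "S j = (\<Sum>m | mi_size m = j. (norm (?b m))\<^sup>2 * ball_moment (2 * real k + \<alpha>) m)" for j
  have b: "locally_bounded_parts ?b" by (rule locally_bounded_radial_funpow[OF a])
  have "square_integrable (weighted_volume \<alpha>) (\<lambda>z. complex_of_real ((1 - (norm z)\<^sup>2) ^ k) * (radial_deriv ^^ k) f z)
      \<longleftrightarrow> integrable lborel (\<lambda>z. ball_weight (2 * real k + \<alpha>) z * (norm (hseries ?b z))\<^sup>2)"
    by (rule square_integrable_weighted_volume_iff[OF b radial_deriv_funpow_hseries[OF a f]])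
  also have "\<dots> \<longleftrightarrow> summable S"
    unfolding bw.integrable_hseries_iff[OF b] S_def moment_ball_weight[OF \<beta>] ..
  also have "\<dots> \<longleftrightarrow> summable (level a)"
  proof -
    obtain L U where LU: "0 < L" "0 < U"
      "\<And>m. N < mi_size m \<Longrightarrow> L \<le> \<kappa> m * (real (mi_size m) ^ (2 * k) * ball_moment (2 * real k + \<alpha>) m)"
      "\<And>m. N < mi_size m \<Longrightarrow> \<kappa> m * (real (mi_size m) ^ (2 * k) * ball_moment (2 * real k + \<alpha>) m) \<le> U"
      using \<kappa>_moment_bounds[OF \<beta> s] by blast
    have S_nonneg: "S j \<ge> 0" for j
      unfolding S_def using ball_moment_pos[OF \<beta>, THEN less_imp_le]
      by (intro sum_nonneg mult_nonneg_nonneg) auto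
    have term_eq: "(norm (?b m))\<^sup>2 * ball_moment (2 * real k + \<alpha>) m
        = (norm (a m))\<^sup>2 / \<kappa> m * (\<kappa> m * (real (mi_size m) ^ (2 * k) * ball_moment (2 * real k + \<alpha>) m))" for m
      using \<kappa>_pos[of m]
      by (simp add: radial_coeff_funpow norm_mult norm_power power_mult_distrib power_mult[symmetric] mult.commute)
    have nn: "0 \<le> (norm (a m))\<^sup>2 / \<kappa> m" for m using \<kappa>_pos[of m] by simp
    have lo: "L * level a j \<le> S j" if "Suc N \<le> j" for j
      unfolding level_def S_def sum_distrib_left term_eq
    proof (intro sum_mono)
      fix m :: "'n midx" assume "m \<in> {m. mi_size m = j}"
      then have "N < mi_size m" using that by simp
      from mult_left_mono[OF LU(3)[OF this] nn[of m]]
      show "L * ((norm (a m))\<^sup>2 / \<kappa> m) \<le> (norm (a m))\<^sup>2 / \<kappa> m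
          * (\<kappa> m * (real (mi_size m) ^ (2 * k) * ball_moment (2 * real k + \<alpha>) m))"
        by (simp only: mult.commute[of L])
    qed
    have hi: "S j \<le> U * level a j" if "Suc N \<le> j" for j
      unfolding level_def S_def sum_distrib_left term_eq
    proof (intro sum_mono)
      fix m :: "'n midx" assume "m \<in> {m. mi_size m = j}"
      then have "N < mi_size m" using that by simp
      from mult_left_mono[OF LU(4)[OF this] nn[of m]]
      show "(norm (a m))\<^sup>2 / \<kappa> m
          * (\<kappa> m * (real (mi_size m) ^ (2 * k) * ball_moment (2 * real k + \<alpha>) m)) \<le> U * ((norm (a m))\<^sup>2 / \<kappa> m)"
        by (simp only: mult.commute[of U])
    qed
    show ?thesis
    proof
      assume "summable S"
      then have "summable (\<lambda>j. L * level a j)"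
        by (rule summable_comparison_test'[where N = "Suc N"]) (use lo LU level_nonneg in auto)
      then show "summable (level a)" using LU by (simp add: summable_cmult_iff)
    next
      assume "summable (level a)"
      then have "summable (\<lambda>j. U * level a j)" by (rule summable_mult)
      then show "summable S"
        by (rule summable_comparison_test'[where N = "Suc N"]) (use hi S_nonneg in auto)
    qed
  qed
  finally show ?thesis by (simp add: coeff_space_def)
qed

theorem A2_eq_function_space_of:
  assumes s: "s = real CARD('n) + 1 + \<alpha>"
  shows "A2 \<alpha> = function_space_of"
proof
  show "A2 \<alpha> \<subseteq> function_space_of"
  proof
    fix f :: "complex ^ 'n \<Rightarrow> complex" assume f: "f \<in> A2 \<alpha>"
    then obtain k :: nat where hol: "holomorphic_vec_on f (ball 0 1)" and off: "\<And>z. z \<notin> ball 0 1 \<Longrightarrow> f z = 0"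
      and k: "2 * real k + \<alpha> > -1"
      and sq: "square_integrable (weighted_volume \<alpha>) (\<lambda>z. complex_of_real ((1 - (norm z)\<^sup>2) ^ k) * (radial_deriv ^^ k) f z)"
      unfolding A2_def by blast
    obtain a where a: "locally_bounded_parts a" "\<And>z. z \<in> ball 0 1 \<Longrightarrow> f z = hseries a z"
      using holomorphic_expansion[OF hol] by blast
    have "a \<in> coeff_space" using radial_square_integrable_iff[OF k s a] sq by blast
    moreover have "f = ball_function a" using a(2) off by (auto simp: ball_function_def)
    ultimately show "f \<in> function_space_of" by (simp add: function_space_of_def)
  qed
  show "function_space_of \<subseteq> A2 \<alpha>"
  proof
    fix f assume "f \<in> function_space_of"
    then obtain a where a: "a \<in> coeff_space" "f = ball_function a"
      by (rule function_space_ofE)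
    have la: "locally_bounded_parts a" by (rule coeff_space_locally_bounded[OF a(1)])
    have f: "\<And>z. z \<in> ball 0 1 \<Longrightarrow> f z = hseries a z" by (simp add: a(2) ball_function_def)
    obtain k :: nat where "- \<alpha> < real k" using reals_Archimedean2 by blast
    then have k: "2 * real k + \<alpha> > -1" by linarith
    have "holomorphic_vec_on f (ball 0 1)"
      by (rule holomorphic_vec_on_cong[OF holomorphic_hseries[OF la] open_ball]) (simp add: f)
    moreover have "f z = 0" if "z \<notin> ball 0 1" for z using that by (simp add: a(2) ball_function_def)
    moreover have "square_integrable (weighted_volume \<alpha>) (\<lambda>z. complex_of_real ((1 - (norm z)\<^sup>2) ^ k) * (radial_deriv ^^ k) f z)"
      using radial_square_integrable_iff[OF k s la f] a(1) by blast
    ultimately show "f \<in> A2 \<alpha>" unfolding A2_def using k by blast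
  qed
qed

end

theorem theorem43:
  fixes \<alpha> :: real and N :: nat and \<omega> :: "'n::finite midx \<Rightarrow> real"
    and Q K :: "complex ^ 'n \<Rightarrow> complex ^ 'n \<Rightarrow> complex"
  assumes "N > 0"
    and "- real N < real CARD('n) + 1 + \<alpha>" and "real CARD('n) + 1 + \<alpha> < - real N + 1"
    and "\<And>m. mi_size m \<le> N \<Longrightarrow>
           \<omega> m > (-1) ^ (N + 1) * Gamma (real CARD('n) + real (mi_size m) + \<alpha> + 1)
                    / (real (mi_fact m) * Gamma (real CARD('n) + \<alpha> + 1))"
  defines "Q \<equiv> \<lambda>z w. \<Sum>m | mi_size m \<le> N. complex_of_real (\<omega> m) * mi_monom z m * cnj (mi_monom w m)"
    and "K \<equiv> \<lambda>z w. Q z w + (-1) ^ N / (1 - cdot z w) powr complex_of_real (real CARD('n) + 1 + \<alpha>)"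
  shows "\<exists>ip. has_reproducing_kernel (ball 0 1) (A2 \<alpha>) ip K"
proof -
  define s where "s = real CARD('n) + 1 + \<alpha>"
  have s_nonint: "s \<notin> \<int>\<^sub>\<le>\<^sub>0"
    unfolding s_def by (rule between_ints_not_nonpos_Int[OF assms(2,3)])
  interpret kernel_parameters s N \<omega>
  proof
    show "N > 0" "- real N < s" "s < - real N + 1" using assms(1-3) by (auto simp: s_def)
    fix m :: "'n midx" assume m: "mi_size m \<le> N"
    have "pochhammer s (mi_size m) = Gamma (s + real (mi_size m)) / Gamma s"
      using pochhammer_Gamma[OF s_nonint] by simp
    moreover have e1: "real CARD('n) + real (mi_size m) + \<alpha> + 1 = s + real (mi_size m)"
      and e2: "real CARD('n) + \<alpha> + 1 = s" by (auto simp: s_def)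
    ultimately show "\<omega> m > (-1) ^ (N + 1) * (pochhammer s (mi_size m) / mi_fact m)"
      using assms(4)[OF m] unfolding e1 e2 by (simp add: mult.commute)
  qed
  have "has_reproducing_kernel (ball 0 1) (A2 \<alpha>) inner_function K"
    unfolding A2_eq_function_space_of[OF s_def]
  proof (rule reproducing_kernel_function_space_of)
    show "K z w = hseries (kernel_coeff w) z" if "z \<in> ball 0 1" "w \<in> ball 0 1" for z w
      using kernel_expansion[OF that] unfolding K_def Q_def s_def by simp
  qed
  then show ?thesis by blast
qed

end
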